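(* Let $\mathbb{K}\in\{\mathbb{R},\mathbb{C}\}$, let $(X,\pi)$ be a Poisson manifold, let $\star=\sum_{l=0}^\infty\lambda^lC_l$ be a star product on $(X,\pi)$ and let $x_0\in X$. Put $K=\mathbb{K}[[\lambda]]$, let $R$ be the unital $K$-algebra $(\mathcal{C}^\infty(X,\mathbb{K})[[\lambda]],\star)$, let $(R_{x_0},\star_{x_0})$ be the stalk at $x_0$ of the sheaf of $K$-algebras $U\mapsto R_U=(\mathcal{C}^\infty(U,\mathbb{K})[[\lambda]],\star_U)$, and let $\eta_{x_0}:R\to R_{x_0}$ be the canonical morphism sending an element to its germ. Put $$S(x_0)=\{g\in R\mid g_0(x_0)\neq0\}.$$ Then: 1. $(R_{x_0},\star_{x_0})$ together with $\eta_{x_0}$ is a right $K$-algebra of fractions of $(R,S(x_0))$. 2. $S(x_0)$ is a right denominator set in $R$. 3. The algebraic localization $RS^{-1}$ of $R$ with respect to $S=S(x_0)$ is isomorphic to the stalk $R_{x_0}$ as a unital $K$-algebra.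
   Context: All algebras are associative and unital. Manifolds are smooth, Hausdorff and second countable; $\mathcal{C}^\infty(X,\mathbb{K})$ is the algebra of smooth $\mathbb{K}$-valued functions. A bilinear map $C:\mathcal{C}^\infty(X,\mathbb{K})\times\mathcal{C}^\infty(X,\mathbb{K})\to\mathcal{C}^\infty(X,\mathbb{K})$ is a bidifferential operator if there is $l\in\mathbb{N}$ such that in every chart $(U,(x^1,\dots,x^N))$ one has $C(f,g)(x)=\sum_{|\alpha|,|\beta|\le l}C^{\alpha\beta}(x)\,\partial^{\alpha}f(x)\,\partial^{\beta}g(x)$ with smooth functions $C^{\alpha\beta}$ on $U$. For every open $U\subset X$ it has a unique localization $C_U$, a bidifferential operator on $\mathcal{C}^\infty(U,\mathbb{K})$ with $C(f,g)|_U=C_U(f|_U,g|_U)$. A (formal) star product on $X$ is a $\mathbb{K}[[\lambda]]$-bilinear associative multiplication on $\mathcal{C}^\infty(X,\mathbb{K})[[\lambda]]$ given by $f\star g=\sum_{k\ge0}\lambda^kC_k(f,g)$ for $f,g\in\mathcal{C}^\infty(X,\mathbb{K})$ (so $(f\star g)_k=\sum_{l+p+q=k}C_l(f_p,g_q)$ for formal series $f=\sum_p\lambda^pf_p$, $g=\sum_q\lambda^qg_q$), with all $C_k$ bidifferential operators, $C_0(f,g)=fg$, and $1\star f=f\star1=f$. It is a star product on the Poisson manifold $(X,\pi)$ if $\frac12(C_1(f,g)-C_1(g,f))=\{f,g\}=\pi(df,dg)$. For open $U\subset X$, $\star_U=\sum_k\lambda^k(C_k)_U$ is the localized star product on $\mathcal{C}^\infty(U,\mathbb{K})[[\lambda]]$.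 For a formal series $g$, $g_0$ denotes its $\lambda^0$-term. The stalk $R_{x_0}$ is the set of pairs $(U,f)$, with $U$ an open neighbourhood of $x_0$ and $f\in R_U$, modulo the equivalence relation $(U,f)\sim(V,g)$ iff there is an open neighbourhood $W\subset U\cap V$ of $x_0$ with $f|_W=g|_W$ (equality of formal power series of functions on $W$, i.e. one common $W$ for all orders in $\lambda$). Addition and multiplication $\star_{x_0}$ are induced by restricting both representatives to $U\cap V$ and adding, resp. multiplying with $\star_{U\cap V}$. The map $\eta_{x_0}$ sends $f\in R$ to the class of $(X,f)$. A multiplicative subset $S$ of an algebra $R$ is a subset containing $1$ and closed under multiplication; $S(x_0)$ is a multiplicative subset of $(R,\star)$. A right $K$-algebra of fractions of $(R,S)$ is a unital $K$-algebra $\check R$ with a morphism of unital $K$-algebras $\check\eta:R\to\check R$ such that (a) $\check\eta(s)$ is invertible for all $s\in S$; (b) every element of $\check R$ is of the form $\check\eta(r)\check\eta(s)^{-1}$ with $r\in R$, $s\in S$; (c) $\ker\check\eta=\{r\in R\mid rs=0\text{ for some }s\in S\}$. $S$ is a right denominator set if (a) (right Ore) for all $r\in R,s\in S$ there are $r'\in R,s'\in S$ with $rs'=sr'$; and (b) (right reversible) for all $r\in R,s'\in S$ with $s'r=0$ there is $s\in S$ with $rs=0$. For a right denominator set, $RS^{-1}=(R\times S)/\sim$, where $(r_1,s_1)\sim(r_2,s_2)$ iff there are $b_1,b_2\in R$ with $s_1b_1=s_2b_2\in S$ and $r_1b_1=r_2b_2$; it is a unital $K$-algebra with $r_1s_1^{-1}+r_2s_2^{-1}=(r_1c_1+r_2c_2)s^{-1}$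 where $s_1c_1=s_2c_2=s\in S$ ($c_1\in S$, $c_2\in R$), and $(r_1s_1^{-1})(r_2s_2^{-1})=(r_1r')(s_2s')^{-1}$ where $r_2s'=s_1r'$ ($s'\in S$, $r'\in R$). All products in $R$ here are taken with respect to $\star$. *)

theory Defs
  imports
    "HOL-Analysis.Analysis"
    "HOL-Algebra.Algebraic_Closure_Type"
begin

section \<open>The ground field\<close>

text \<open>The class says literally that the type is $\mathbb{R}$ or $\mathbb{C}$, with the usual
  absolute value (the multiplicative norm of \<^class>\<open>real_normed_field\<close>).\<close>

class real_or_complex = real_normed_field +
  assumes real_or_complex:
    "(\<forall>z. \<exists>a::real. z = a *\<^sub>R 1) \<or>
     (\<exists>i. i * i = - 1 \<and> (\<forall>z. \<exists>(a::real) b. z = a *\<^sub>R 1 + b *\<^sub>R i))"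

instance real :: real_or_complex
  by standard simp

instance complex :: real_or_complex
proof
  have "\<exists>(a::real) b. z = a *\<^sub>R 1 + b *\<^sub>R \<i>" for z :: complex
    by (rule exI[of _ "Re z"], rule exI[of _ "Im z"]) (simp add: complex_eq_iff)
  then show "(\<forall>z::complex. \<exists>a::real. z = a *\<^sub>R 1) \<or>
     (\<exists>i::complex. i * i = - 1 \<and> (\<forall>z. \<exists>(a::real) b. z = a *\<^sub>R 1 + b *\<^sub>R i))"
    by (intro disjI2 exI[of _ "\<i>"]) auto
qed


section \<open>Smooth manifolds\<close>

text \<open>This is $C^k$ for open \<open>S\<close> in a finite-dimensional space; in infinite dimensions it would be
  weaker, as the derivatives are only required to be continuous pointwise in the direction \<open>v\<close>.\<close>

primrec continuously_differentiable_on ::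
    "nat \<Rightarrow> 'a::real_normed_vector set \<Rightarrow> ('a \<Rightarrow> 'b::real_normed_vector) \<Rightarrow> bool" where
  "continuously_differentiable_on 0 S f \<longleftrightarrow> continuous_on S f"
| "continuously_differentiable_on (Suc k) S f \<longleftrightarrow>
     (\<forall>x\<in>S. f differentiable (at x)) \<and>
     (\<forall>v. continuously_differentiable_on k S (\<lambda>x. frechet_derivative f (at x) v))"

definition smooth_on :: "'a::real_normed_vector set \<Rightarrow> ('a \<Rightarrow> 'b::real_normed_vector) \<Rightarrow> bool" where
  "smooth_on S f \<longleftrightarrow> (\<forall>k. continuously_differentiable_on k S f)"

text \<open>The underlying Hausdorff second countable space is the type \<open>'x\<close>. The model space
  $\mathbb{R}^N$ is an inner product space \<open>'e\<close> with the orthonormal basis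
  \<open>frame 0, \<dots>, frame (N - 1)\<close>, \<open>N = mdim\<close>; in contrast to the class
  \<^class>\<open>euclidean_space\<close> this allows \<open>N = 0\<close>. A chart is a pair of an open domain and a map, whose
  values outside the domain are irrelevant.\<close>

type_synonym ('x, 'e) chart = "'x set \<times> ('x \<Rightarrow> 'e)"

record ('x, 'e) manifold =
  mdim :: nat
  frame :: "nat \<Rightarrow> 'e"
  atlas :: "('x, 'e) chart set"

definition chart :: "('x::topological_space, 'e::real_normed_vector) chart \<Rightarrow> bool" where
  "chart c \<longleftrightarrow> (case c of (U, \<phi>) \<Rightarrow>
     open U \<and> open (\<phi> ` U) \<and> homeomorphism U (\<phi> ` U) \<phi> (inv_into U \<phi>))"

definition in_chart :: "('x, 'e) chart \<Rightarrow> ('x \<Rightarrow> 'b) \<Rightarrow> 'e \<Rightarrow> 'b" where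
  "in_chart c f = f \<circ> inv_into (fst c) (snd c)"

definition compatible ::
    "('x, 'e::real_normed_vector) chart \<Rightarrow> ('x, 'e) chart \<Rightarrow> bool" where
  "compatible c d \<longleftrightarrow>
     smooth_on (snd c ` (fst c \<inter> fst d)) (in_chart c (snd d)) \<and>
     smooth_on (snd d ` (fst c \<inter> fst d)) (in_chart d (snd c))"

definition smooth_manifold ::
    "('x::{t2_space,second_countable_topology}, 'e::real_inner) manifold \<Rightarrow> bool" where
  "smooth_manifold M \<longleftrightarrow>
     (\<forall>i<mdim M. \<forall>j<mdim M. frame M i \<bullet> frame M j = (if i = j then 1 else 0)) \<and>
     span (frame M ` {..<mdim M}) = UNIV \<and>
     (\<forall>c\<in>atlas M. chart c) \<and>
     (\<Union>c\<in>atlas M. fst c) = UNIV \<and>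
     (\<forall>c\<in>atlas M. \<forall>d\<in>atlas M. compatible c d) \<and>
     (\<forall>c. chart c \<and> (\<forall>d\<in>atlas M. compatible c d) \<longrightarrow> c \<in> atlas M)"

text \<open>Functions on an open subset \<open>U\<close> are represented by extensional functions, so that
  \<^const>\<open>restrict\<close> is the restriction of functions. As the atlas is maximal, its members with domain
  in \<open>U\<close> are exactly the charts of the open submanifold \<open>U\<close>.\<close>

definition charts_in :: "('x, 'e) manifold \<Rightarrow> 'x set \<Rightarrow> ('x, 'e) chart set" where
  "charts_in M U = {c \<in> atlas M. fst c \<subseteq> U}"

definition smooth_functions ::
    "('x, 'e::real_normed_vector) manifold \<Rightarrow> 'x set \<Rightarrow> ('x \<Rightarrow> 'b::real_normed_vector) set" where
  "smooth_functions M U =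
     {f \<in> extensional U. \<forall>c\<in>charts_in M U. smooth_on (snd c ` fst c) (in_chart c f)}"


section \<open>Bidifferential operators\<close>

text \<open>A multi-index $\alpha$ is a function vanishing at all indices \<open>\<ge> N\<close>.\<close>

definition multi_indices :: "nat \<Rightarrow> nat \<Rightarrow> (nat \<Rightarrow> nat) set" where
  "multi_indices N l = {\<alpha>. (\<forall>i\<ge>N. \<alpha> i = 0) \<and> (\<Sum>i<N. \<alpha> i) \<le> l}"

definition directional_derivative ::
    "'e \<Rightarrow> ('e::real_normed_vector \<Rightarrow> 'b::real_normed_vector) \<Rightarrow> 'e \<Rightarrow> 'b" where
  "directional_derivative v F = (\<lambda>y. frechet_derivative F (at y) v)"

text \<open>$\partial^\alpha f(x)$ and $\partial_i f(x)$ with respect to the coordinates of the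
  chart \<open>c\<close>.\<close>

definition chart_derivative ::
    "('x, 'e::real_normed_vector) manifold \<Rightarrow> ('x, 'e) chart \<Rightarrow> (nat \<Rightarrow> nat) \<Rightarrow>
     ('x \<Rightarrow> 'b::real_normed_vector) \<Rightarrow> 'x \<Rightarrow> 'b" where
  "chart_derivative M c \<alpha> f x =
     fold (\<lambda>i. directional_derivative (frame M i) ^^ \<alpha> i) [0..<mdim M] (in_chart c f) (snd c x)"

definition chart_partial ::
    "('x, 'e::real_normed_vector) manifold \<Rightarrow> ('x, 'e) chart \<Rightarrow> nat \<Rightarrow>
     ('x \<Rightarrow> 'b::real_normed_vector) \<Rightarrow> 'x \<Rightarrow> 'b" where
  "chart_partial M c i f x = directional_derivative (frame M i) (in_chart c f) (snd c x)"

definition bidifferential_operator ::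
    "('x, 'e::real_normed_vector) manifold \<Rightarrow> 'x set \<Rightarrow>
     (('x \<Rightarrow> 'k::real_or_complex) \<Rightarrow> ('x \<Rightarrow> 'k) \<Rightarrow> 'x \<Rightarrow> 'k) \<Rightarrow> bool" where
  "bidifferential_operator M U C \<longleftrightarrow>
     (\<forall>f\<in>smooth_functions M U. \<forall>g\<in>smooth_functions M U. C f g \<in> smooth_functions M U) \<and>
     (\<forall>f\<in>smooth_functions M U. \<forall>g\<in>smooth_functions M U. \<forall>h\<in>smooth_functions M U. \<forall>a.
        C (\<lambda>x\<in>U. a * f x + g x) h = (\<lambda>x\<in>U. a * C f h x + C g h x) \<and>
        C h (\<lambda>x\<in>U. a * f x + g x) = (\<lambda>x\<in>U. a * C h f x + C h g x)) \<and>
     (\<exists>l. \<forall>c\<in>charts_in M U. \<exists>coeff.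
        (\<forall>\<alpha>\<in>multi_indices (mdim M) l. \<forall>\<beta>\<in>multi_indices (mdim M) l.
           coeff \<alpha> \<beta> \<in> smooth_functions M (fst c)) \<and>
        (\<forall>f\<in>smooth_functions M U. \<forall>g\<in>smooth_functions M U. \<forall>x\<in>fst c.
           C f g x = (\<Sum>\<alpha>\<in>multi_indices (mdim M) l. \<Sum>\<beta>\<in>multi_indices (mdim M) l.
             coeff \<alpha> \<beta> x * chart_derivative M c \<alpha> f x * chart_derivative M c \<beta> g x)))"

text \<open>The localization $C_U$. It is unique as a map on pairs of smooth functions on \<open>U\<close>; the choice
  only affects arguments which are not smooth functions on \<open>U\<close>.\<close>

definition localization ::
    "('x, 'e::real_normed_vector) manifold \<Rightarrow>
     (('x \<Rightarrow> 'k::real_or_complex) \<Rightarrow> ('x \<Rightarrow> 'k) \<Rightarrow> 'x \<Rightarrow> 'k) \<Rightarrow> 'x set \<Rightarrow>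
     ('x \<Rightarrow> 'k) \<Rightarrow> ('x \<Rightarrow> 'k) \<Rightarrow> 'x \<Rightarrow> 'k" where
  "localization M C U = (SOME D. bidifferential_operator M U D \<and>
     (\<forall>f\<in>smooth_functions M UNIV. \<forall>g\<in>smooth_functions M UNIV.
        restrict (C f g) U = D (restrict f U) (restrict g U)))"


section \<open>Poisson structures\<close>

text \<open>A bivector field is given by its components $\pi^{ij} = \pi(dx^i, dx^j)$ in each chart, which
  are smooth, antisymmetric and transform as a contravariant tensor.\<close>

definition bivector_field ::
    "('x, 'e::real_inner) manifold \<Rightarrow> (('x, 'e) chart \<Rightarrow> nat \<Rightarrow> nat \<Rightarrow> 'x \<Rightarrow> real) \<Rightarrow> bool" where
  "bivector_field M \<pi> \<longleftrightarrow>
     (\<forall>c\<in>atlas M. \<forall>i<mdim M. \<forall>j<mdim M.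
        \<pi> c i j \<in> smooth_functions M (fst c) \<and> (\<forall>x\<in>fst c. \<pi> c i j x = - \<pi> c j i x)) \<and>
     (\<forall>c\<in>atlas M. \<forall>d\<in>atlas M. \<forall>x\<in>fst c \<inter> fst d. \<forall>k<mdim M. \<forall>l<mdim M.
        \<pi> d k l x = (\<Sum>i<mdim M. \<Sum>j<mdim M.
          chart_partial M c i (\<lambda>y. snd d y \<bullet> frame M k) x *
          chart_partial M c j (\<lambda>y. snd d y \<bullet> frame M l) x * \<pi> c i j x))"

text \<open>$\pi(df, dg)$; for a bivector field the chart at \<open>x\<close> does not matter. The field $\pi$ is real
  and is extended $\mathbb{C}$-bilinearly to differentials of complex functions.\<close>

definition poisson_bracket ::
    "('x, 'e::real_inner) manifold \<Rightarrow> (('x, 'e) chart \<Rightarrow> nat \<Rightarrow> nat \<Rightarrow> 'x \<Rightarrow> real) \<Rightarrow>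
     ('x \<Rightarrow> 'k::real_normed_field) \<Rightarrow> ('x \<Rightarrow> 'k) \<Rightarrow> 'x \<Rightarrow> 'k" where
  "poisson_bracket M \<pi> f g x =
     (let c = (SOME c. c \<in> atlas M \<and> x \<in> fst c) in
      \<Sum>i<mdim M. \<Sum>j<mdim M.
        of_real (\<pi> c i j x) * chart_partial M c i f x * chart_partial M c j g x)"

definition poisson_manifold ::
    "('x::{t2_space,second_countable_topology}, 'e::real_inner) manifold \<Rightarrow>
     (('x, 'e) chart \<Rightarrow> nat \<Rightarrow> nat \<Rightarrow> 'x \<Rightarrow> real) \<Rightarrow> bool" where
  "poisson_manifold M \<pi> \<longleftrightarrow>
     smooth_manifold M \<and> bivector_field M \<pi> \<and>
     (\<forall>f\<in>smooth_functions M UNIV. \<forall>g\<in>smooth_functions M UNIV. \<forall>h\<in>smooth_functions M UNIV. \<forall>x.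
        poisson_bracket M \<pi> f (poisson_bracket M \<pi> g h) x +
        poisson_bracket M \<pi> g (poisson_bracket M \<pi> h f) x +
        poisson_bracket M \<pi> h (poisson_bracket M \<pi> f g) x = (0::real))"


section \<open>Algebras, fractions and localization\<close>

text \<open>The locale \<^locale>\<open>Module.algebra\<close> is restricted to commutative algebras.\<close>

locale unital_algebra = module K A + ring A for K (structure) and A (structure) +
  assumes smult_mult_left:
      "\<lbrakk>a \<in> carrier K; x \<in> carrier A; y \<in> carrier A\<rbrakk> \<Longrightarrow>
       (a \<odot>\<^bsub>A\<^esub> x) \<otimes>\<^bsub>A\<^esub> y = a \<odot>\<^bsub>A\<^esub> (x \<otimes>\<^bsub>A\<^esub> y)"
    and smult_mult_right:
      "\<lbrakk>a \<in> carrier K; x \<in> carrier A; y \<in> carrier A\<rbrakk> \<Longrightarrow>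
       x \<otimes>\<^bsub>A\<^esub> (a \<odot>\<^bsub>A\<^esub> y) = a \<odot>\<^bsub>A\<^esub> (x \<otimes>\<^bsub>A\<^esub> y)"

definition algebra_morphism ::
    "'c ring \<Rightarrow> ('c, 'a) module \<Rightarrow> ('c, 'b) module \<Rightarrow> ('a \<Rightarrow> 'b) \<Rightarrow> bool" where
  "algebra_morphism K A B h \<longleftrightarrow>
     unital_algebra K A \<and> unital_algebra K B \<and> h \<in> ring_hom A B \<and>
     (\<forall>a\<in>carrier K. \<forall>x\<in>carrier A. h (a \<odot>\<^bsub>A\<^esub> x) = a \<odot>\<^bsub>B\<^esub> h x)"

definition isomorphic_algebras ::
    "'c ring \<Rightarrow> ('c, 'a) module \<Rightarrow> ('c, 'b) module \<Rightarrow> bool" where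
  "isomorphic_algebras K A B \<longleftrightarrow>
     (\<exists>h. algebra_morphism K A B h \<and> bij_betw h (carrier A) (carrier B))"

definition multiplicative_subset :: "('c, 'a) module \<Rightarrow> 'a set \<Rightarrow> bool" where
  "multiplicative_subset A S \<longleftrightarrow>
     S \<subseteq> carrier A \<and> \<one>\<^bsub>A\<^esub> \<in> S \<and> (\<forall>s\<in>S. \<forall>t\<in>S. s \<otimes>\<^bsub>A\<^esub> t \<in> S)"

definition right_fraction_algebra ::
    "'c ring \<Rightarrow> ('c, 'a) module \<Rightarrow> 'a set \<Rightarrow> ('c, 'b) module \<Rightarrow> ('a \<Rightarrow> 'b) \<Rightarrow> bool" where
  "right_fraction_algebra K A S B h \<longleftrightarrow>
     multiplicative_subset A S \<and>
     algebra_morphism K A B h \<and>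
     (\<forall>s\<in>S. h s \<in> Units B) \<and>
     (\<forall>b\<in>carrier B. \<exists>r\<in>carrier A. \<exists>s\<in>S. b = h r \<otimes>\<^bsub>B\<^esub> inv\<^bsub>B\<^esub> (h s)) \<and>
     {r \<in> carrier A. h r = \<zero>\<^bsub>B\<^esub>} = {r \<in> carrier A. \<exists>s\<in>S. r \<otimes>\<^bsub>A\<^esub> s = \<zero>\<^bsub>A\<^esub>}"

definition right_denominator_set :: "('c, 'a) module \<Rightarrow> 'a set \<Rightarrow> bool" where
  "right_denominator_set A S \<longleftrightarrow>
     multiplicative_subset A S \<and>
     (\<forall>r\<in>carrier A. \<forall>s\<in>S. \<exists>r'\<in>carrier A. \<exists>s'\<in>S. r \<otimes>\<^bsub>A\<^esub> s' = s \<otimes>\<^bsub>A\<^esub> r') \<and>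
     (\<forall>r\<in>carrier A. \<forall>s'\<in>S. s' \<otimes>\<^bsub>A\<^esub> r = \<zero>\<^bsub>A\<^esub> \<longrightarrow> (\<exists>s\<in>S. r \<otimes>\<^bsub>A\<^esub> s = \<zero>\<^bsub>A\<^esub>))"

definition fraction_rel :: "('c, 'a) module \<Rightarrow> 'a set \<Rightarrow> (('a \<times> 'a) \<times> ('a \<times> 'a)) set" where
  "fraction_rel A S =
     {((r1, s1), (r2, s2)) | r1 s1 r2 s2.
        r1 \<in> carrier A \<and> s1 \<in> S \<and> r2 \<in> carrier A \<and> s2 \<in> S \<and>
        (\<exists>b1\<in>carrier A. \<exists>b2\<in>carrier A.
           s1 \<otimes>\<^bsub>A\<^esub> b1 = s2 \<otimes>\<^bsub>A\<^esub> b2 \<and> s2 \<otimes>\<^bsub>A\<^esub> b2 \<in> S \<and> r1 \<otimes>\<^bsub>A\<^esub> b1 = r2 \<otimes>\<^bsub>A\<^esub> b2)}"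

definition fraction :: "('c, 'a) module \<Rightarrow> 'a set \<Rightarrow> 'a \<Rightarrow> 'a \<Rightarrow> ('a \<times> 'a) set" where
  "fraction A S r s = fraction_rel A S `` {(r, s)}"

text \<open>The operations of $RS^{-1}$ are independent of all choices. They are written as the union of
  the resulting classes over all representatives and all possible choices of the auxiliary
  elements, as the library does for operations on quotients.\<close>

definition ore_localization ::
    "('c, 'a) module \<Rightarrow> 'a set \<Rightarrow> ('c, ('a \<times> 'a) set) module" where
  "ore_localization A S =
     \<lparr>carrier = (carrier A \<times> S) // fraction_rel A S,
      monoid.mult = (\<lambda>F G. \<Union>{fraction A S (r1 \<otimes>\<^bsub>A\<^esub> r') (s2 \<otimes>\<^bsub>A\<^esub> s') | r1 s1 r2 s2 r' s'.
        (r1, s1) \<in> F \<and> (r2, s2) \<in> G \<and> r' \<in> carrier A \<and> s' \<in> S \<and>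
        r2 \<otimes>\<^bsub>A\<^esub> s' = s1 \<otimes>\<^bsub>A\<^esub> r'}),
      one = fraction A S \<one>\<^bsub>A\<^esub> \<one>\<^bsub>A\<^esub>,
      zero = fraction A S \<zero>\<^bsub>A\<^esub> \<one>\<^bsub>A\<^esub>,
      add = (\<lambda>F G. \<Union>{fraction A S (r1 \<otimes>\<^bsub>A\<^esub> c1 \<oplus>\<^bsub>A\<^esub> r2 \<otimes>\<^bsub>A\<^esub> c2) s | r1 s1 r2 s2 c1 c2 s.
        (r1, s1) \<in> F \<and> (r2, s2) \<in> G \<and> c1 \<in> S \<and> c2 \<in> carrier A \<and> s \<in> S \<and>
        s1 \<otimes>\<^bsub>A\<^esub> c1 = s \<and> s2 \<otimes>\<^bsub>A\<^esub> c2 = s}),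
      smult = (\<lambda>a F. \<Union>{fraction A S (a \<odot>\<^bsub>A\<^esub> r) s | r s. (r, s) \<in> F})\<rparr>"


section \<open>Star products\<close>

text \<open>A formal series $\sum_k \lambda^k f_k$ of functions is the sequence of its coefficients, and
  $\mathbb{K}[[\lambda]]$ is the ring \<^term>\<open>ring_of_type_algebra :: 'k::real_or_complex fps ring\<close>.
  The following algebra is $\mathcal{C}^\infty(U,\mathbb{K})[[\lambda]]$ with the multiplication
  $\sum_k \lambda^k D_k$.\<close>

definition star ::
    "'x set \<Rightarrow> (nat \<Rightarrow> ('x \<Rightarrow> 'k) \<Rightarrow> ('x \<Rightarrow> 'k) \<Rightarrow> 'x \<Rightarrow> 'k::real_or_complex) \<Rightarrow>
     (nat \<Rightarrow> 'x \<Rightarrow> 'k) \<Rightarrow> (nat \<Rightarrow> 'x \<Rightarrow> 'k) \<Rightarrow> nat \<Rightarrow> 'x \<Rightarrow> 'k" where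
  "star U D f g = (\<lambda>n. \<lambda>x\<in>U. \<Sum>(l, p, q)\<in>{(l, p, q). l + p + q = n}. D l (f p) (g q) x)"

definition series_algebra ::
    "('x, 'e::real_normed_vector) manifold \<Rightarrow> 'x set \<Rightarrow>
     (nat \<Rightarrow> ('x \<Rightarrow> 'k) \<Rightarrow> ('x \<Rightarrow> 'k) \<Rightarrow> 'x \<Rightarrow> 'k::real_or_complex) \<Rightarrow>
     ('k fps, nat \<Rightarrow> 'x \<Rightarrow> 'k) module" where
  "series_algebra M U D =
     \<lparr>carrier = {f. \<forall>n. f n \<in> smooth_functions M U},
      monoid.mult = star U D,
      one = (\<lambda>n. \<lambda>x\<in>U. if n = 0 then 1 else 0),
      zero = (\<lambda>n. \<lambda>x\<in>U. 0),
      add = (\<lambda>f g n. \<lambda>x\<in>U. f n x + g n x),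
      smult = (\<lambda>a f n. \<lambda>x\<in>U. \<Sum>i\<le>n. fps_nth a i * f (n - i) x)\<rparr>"

text \<open>$\mathbb{K}[[\lambda]]$-bilinearity of the product is automatic, as the $C_k$ are bilinear.\<close>

definition star_product ::
    "('x::topological_space, 'e::real_normed_vector) manifold \<Rightarrow>
     (nat \<Rightarrow> ('x \<Rightarrow> 'k) \<Rightarrow> ('x \<Rightarrow> 'k) \<Rightarrow> 'x \<Rightarrow> 'k::real_or_complex) \<Rightarrow> bool" where
  "star_product M C \<longleftrightarrow>
     (\<forall>k. bidifferential_operator M UNIV (C k)) \<and>
     (\<forall>f\<in>smooth_functions M UNIV. \<forall>g\<in>smooth_functions M UNIV. C 0 f g = (\<lambda>x. f x * g x)) \<and>
     (let R = series_algebra M UNIV C in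
       (\<forall>f\<in>carrier R. \<forall>g\<in>carrier R. \<forall>h\<in>carrier R.
          (f \<otimes>\<^bsub>R\<^esub> g) \<otimes>\<^bsub>R\<^esub> h = f \<otimes>\<^bsub>R\<^esub> (g \<otimes>\<^bsub>R\<^esub> h)) \<and>
       (\<forall>f\<in>carrier R. \<one>\<^bsub>R\<^esub> \<otimes>\<^bsub>R\<^esub> f = f \<and> f \<otimes>\<^bsub>R\<^esub> \<one>\<^bsub>R\<^esub> = f))"

definition star_product_on_poisson ::
    "('x::topological_space, 'e::real_inner) manifold \<Rightarrow>
     (('x, 'e) chart \<Rightarrow> nat \<Rightarrow> nat \<Rightarrow> 'x \<Rightarrow> real) \<Rightarrow>
     (nat \<Rightarrow> ('x \<Rightarrow> 'k) \<Rightarrow> ('x \<Rightarrow> 'k) \<Rightarrow> 'x \<Rightarrow> 'k::real_or_complex) \<Rightarrow> bool" where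
  "star_product_on_poisson M \<pi> C \<longleftrightarrow>
     star_product M C \<and>
     (\<forall>f\<in>smooth_functions M UNIV. \<forall>g\<in>smooth_functions M UNIV. \<forall>x.
        (C 1 f g x - C 1 g f x) / 2 = poisson_bracket M \<pi> f g x)"

definition local_algebra ::
    "('x, 'e::real_normed_vector) manifold \<Rightarrow>
     (nat \<Rightarrow> ('x \<Rightarrow> 'k) \<Rightarrow> ('x \<Rightarrow> 'k) \<Rightarrow> 'x \<Rightarrow> 'k::real_or_complex) \<Rightarrow> 'x set \<Rightarrow>
     ('k fps, nat \<Rightarrow> 'x \<Rightarrow> 'k) module" where
  "local_algebra M C U = series_algebra M U (\<lambda>k. localization M (C k) U)"


section \<open>The stalk\<close>

definition restrict_series :: "(nat \<Rightarrow> 'x \<Rightarrow> 'k) \<Rightarrow> 'x set \<Rightarrow> nat \<Rightarrow> 'x \<Rightarrow> 'k" where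
  "restrict_series f W = (\<lambda>n. restrict (f n) W)"

definition local_sections ::
    "('x::topological_space, 'e::real_normed_vector) manifold \<Rightarrow>
     (nat \<Rightarrow> ('x \<Rightarrow> 'k) \<Rightarrow> ('x \<Rightarrow> 'k) \<Rightarrow> 'x \<Rightarrow> 'k::real_or_complex) \<Rightarrow> 'x \<Rightarrow>
     ('x set \<times> (nat \<Rightarrow> 'x \<Rightarrow> 'k)) set" where
  "local_sections M C x0 = (SIGMA U:{U. open U \<and> x0 \<in> U}. carrier (local_algebra M C U))"

definition germ_rel ::
    "('x::topological_space, 'e::real_normed_vector) manifold \<Rightarrow>
     (nat \<Rightarrow> ('x \<Rightarrow> 'k) \<Rightarrow> ('x \<Rightarrow> 'k) \<Rightarrow> 'x \<Rightarrow> 'k::real_or_complex) \<Rightarrow> 'x \<Rightarrow>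
     (('x set \<times> (nat \<Rightarrow> 'x \<Rightarrow> 'k)) \<times> ('x set \<times> (nat \<Rightarrow> 'x \<Rightarrow> 'k))) set" where
  "germ_rel M C x0 =
     {((U, f), (V, g)) | U f V g.
        (U, f) \<in> local_sections M C x0 \<and> (V, g) \<in> local_sections M C x0 \<and>
        (\<exists>W. open W \<and> x0 \<in> W \<and> W \<subseteq> U \<inter> V \<and> restrict_series f W = restrict_series g W)}"

definition germ ::
    "('x::topological_space, 'e::real_normed_vector) manifold \<Rightarrow>
     (nat \<Rightarrow> ('x \<Rightarrow> 'k) \<Rightarrow> ('x \<Rightarrow> 'k) \<Rightarrow> 'x \<Rightarrow> 'k::real_or_complex) \<Rightarrow> 'x \<Rightarrow> 'x set \<Rightarrow>
     (nat \<Rightarrow> 'x \<Rightarrow> 'k) \<Rightarrow> ('x set \<times> (nat \<Rightarrow> 'x \<Rightarrow> 'k)) set" where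
  "germ M C x0 U f = germ_rel M C x0 `` {(U, f)}"

definition stalk ::
    "('x::topological_space, 'e::real_normed_vector) manifold \<Rightarrow>
     (nat \<Rightarrow> ('x \<Rightarrow> 'k) \<Rightarrow> ('x \<Rightarrow> 'k) \<Rightarrow> 'x \<Rightarrow> 'k::real_or_complex) \<Rightarrow> 'x \<Rightarrow>
     ('k fps, ('x set \<times> (nat \<Rightarrow> 'x \<Rightarrow> 'k)) set) module" where
  "stalk M C x0 =
     \<lparr>carrier = local_sections M C x0 // germ_rel M C x0,
      monoid.mult = (\<lambda>F G. \<Union>(U, f)\<in>F. \<Union>(V, g)\<in>G. germ M C x0 (U \<inter> V)
        (restrict_series f (U \<inter> V) \<otimes>\<^bsub>local_algebra M C (U \<inter> V)\<^esub> restrict_series g (U \<inter> V))),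
      one = germ M C x0 UNIV \<one>\<^bsub>local_algebra M C UNIV\<^esub>,
      zero = germ M C x0 UNIV \<zero>\<^bsub>local_algebra M C UNIV\<^esub>,
      add = (\<lambda>F G. \<Union>(U, f)\<in>F. \<Union>(V, g)\<in>G. germ M C x0 (U \<inter> V)
        (restrict_series f (U \<inter> V) \<oplus>\<^bsub>local_algebra M C (U \<inter> V)\<^esub> restrict_series g (U \<inter> V))),
      smult = (\<lambda>a F. \<Union>(U, f)\<in>F. germ M C x0 U (a \<odot>\<^bsub>local_algebra M C U\<^esub> f))\<rparr>"

definition nonvanishing_at ::
    "('x, 'e::real_normed_vector) manifold \<Rightarrow>
     (nat \<Rightarrow> ('x \<Rightarrow> 'k) \<Rightarrow> ('x \<Rightarrow> 'k) \<Rightarrow> 'x \<Rightarrow> 'k::real_or_complex) \<Rightarrow> 'x \<Rightarrow>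
     (nat \<Rightarrow> 'x \<Rightarrow> 'k) set" where
  "nonvanishing_at M C x0 = {g \<in> carrier (series_algebra M UNIV C). g 0 x0 \<noteq> 0}"

end

theory Submission
  imports Defs
begin

text \<open>Multiplying by a bump function shows that every germ at $x_0$ is the germ of a global series,
  so $R_{x_0} = \eta(R)$ and all algebra axioms of the stalk are inherited from $R$. A series whose
  leading term does not vanish at $x_0$ can be inverted near $x_0$ order by order in $\lambda$, so
  $\eta$ maps $S(x_0)$ to units. If the germ of $r$ vanishes on $W$, a bump function $s$ supported in
  $W$ satisfies $r \star s = 0$ because the $C_k$ are local. This gives the first claim, and the other
  two hold for every right algebra of fractions: the Ore condition is read off from
  $\eta(s)^{-1}\eta(r) = \eta(r')\eta(s')^{-1}$, and $rs^{-1} \mapsto \eta(r)\eta(s)^{-1}$ is the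
  isomorphism.\<close>

section \<open>Algebras of fractions and Ore localization\<close>

text \<open>Two features of the encoding shape the work. The operations on the stalk and on
  \<open>ore_localization\<close> are unions over every choice of representatives, so an operation
  is computed by showing that all choices yield one class and that at least one choice exists; ring
  axioms are never checked on classes but transported along surjections. Localized operators are
  selected by \<open>SOME\<close>, so nothing is known about them until an operator with the
  required properties has been constructed. The analytic difficulty is uniformity: a germ of a
  formal series needs one neighbourhood for infinitely many coefficients. Hence extension multiplies
  all coefficients by the same bump function, and inversion fixes one global substitute for the
  reciprocal of the leading term before the recursion starts, so that no order in \<lambda> shrinks
  the neighbourhood. As the product is not commutative, left and right inverses are found separately
  and identified only in the stalk.\<close>

lemma Union_eqI_unique: "F \<in> \<F> \<Longrightarrow> (\<And>G. G \<in> \<F> \<Longrightarrow> G = F') \<Longrightarrow> \<Union>\<F> = F'"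
  by auto

lemma (in monoid) inv_mult_Units:
  assumes "x \<in> Units G" "y \<in> Units G"
  shows "inv (x \<otimes> y) = inv y \<otimes> inv x"
proof (rule inv_unique'[symmetric])
  show "x \<otimes> y \<otimes> (inv y \<otimes> inv x) = \<one>"
    using assms by (metis Units_closed Units_inv_closed Units_r_inv m_assoc m_closed r_one)
  show "inv y \<otimes> inv x \<otimes> (x \<otimes> y) = \<one>"
    using assms by (metis Units_closed Units_inv_closed Units_l_inv m_assoc m_closed r_one)
qed (use assms in auto)

text \<open>Each axiom is an identity, a closure condition or the existence of negatives, and all of
  these survive a surjection that respects the operations. \<open>B\<close> is only a bare record at
  the start: this is what first gives the stalk and the Ore localization their algebra
  structure.\<close>

lemma unital_algebra_surjective_image:
  fixes K :: "'c ring" and A :: "('c, 'a) module" and B :: "('c, 'b) module"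
  assumes A: "unital_algebra K A"
    and carrier: "carrier B = h ` carrier A"
    and one: "h \<one>\<^bsub>A\<^esub> = \<one>\<^bsub>B\<^esub>" and zero: "h \<zero>\<^bsub>A\<^esub> = \<zero>\<^bsub>B\<^esub>"
    and add: "\<And>x y. x \<in> carrier A \<Longrightarrow> y \<in> carrier A \<Longrightarrow> h (x \<oplus>\<^bsub>A\<^esub> y) = h x \<oplus>\<^bsub>B\<^esub> h y"
    and mult: "\<And>x y. x \<in> carrier A \<Longrightarrow> y \<in> carrier A \<Longrightarrow> h (x \<otimes>\<^bsub>A\<^esub> y) = h x \<otimes>\<^bsub>B\<^esub> h y"
    and smult: "\<And>a x. a \<in> carrier K \<Longrightarrow> x \<in> carrier A \<Longrightarrow> h (a \<odot>\<^bsub>A\<^esub> x) = a \<odot>\<^bsub>B\<^esub> h x"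
  shows "algebra_morphism K A B h"
proof -
  interpret A: unital_algebra K A by fact
  have "abelian_group B"
  proof (rule abelian_groupI)
    show "\<exists>y\<in>carrier B. y \<oplus>\<^bsub>B\<^esub> x = \<zero>\<^bsub>B\<^esub>" if "x \<in> carrier B" for x
    proof -
      from that obtain u where u: "u \<in> carrier A" "x = h u"
        unfolding carrier by blast
      then have "h (\<ominus>\<^bsub>A\<^esub> u) \<oplus>\<^bsub>B\<^esub> x = \<zero>\<^bsub>B\<^esub>"
        by (metis A.M.l_neg A.M.a_inv_closed add zero)
      then show ?thesis using u carrier by blast
    qed
  \<comment> \<open>Read backwards, the homomorphism equations turn the identities into goals
    \<open>h u = h v\<close>, where \<open>u = v\<close> is the same axiom in
    \<open>A\<close>.\<close>
  qed (auto simp: carrier simp flip: add zero intro!: arg_cong[where f = h]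
      intro: A.M.a_assoc A.M.a_comm)
  moreover have "monoid B"
    by (rule monoidI) (auto simp: carrier simp flip: mult one intro!: arg_cong[where f = h]
      intro: A.m_assoc)
  ultimately have ring: "ring B"
    by (intro ringI) (auto simp: carrier simp flip: add mult intro!: arg_cong[where f = h]
      intro: A.l_distr A.r_distr)
  then have "module K B"
    by (intro moduleI A.is_cring ring.is_abelian_group)
      (auto simp: carrier simp flip: add smult intro!: arg_cong[where f = h]
      intro: A.smult_l_distr A.smult_r_distr A.smult_assoc1)
  then have "unital_algebra K B"
    using ring by (intro unital_algebra.intro unital_algebra_axioms.intro)
      (auto simp: carrier simp flip: mult smult intro!: arg_cong[where f = h]
      intro: A.smult_mult_left A.smult_mult_right)
  then show ?thesis
    using A smult by (auto simp: algebra_morphism_def ring_hom_def carrier one add mult)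
qed

text \<open>The kernel condition applied to the difference of \<open>r\<close> and
  \<open>r'\<close>: pulling an equation back from \<open>B\<close> costs one right factor
  \<open>t\<close> from \<open>S\<close>.\<close>

lemma right_fraction_algebra_eqD:
  assumes "right_fraction_algebra K A S B h"
    and r: "r \<in> carrier A" and r': "r' \<in> carrier A" and eq: "h r = h r'"
  shows "\<exists>t\<in>S. r \<otimes>\<^bsub>A\<^esub> t = r' \<otimes>\<^bsub>A\<^esub> t"
proof -
  have S: "multiplicative_subset A S" and h: "algebra_morphism K A B h"
    and ker: "{r \<in> carrier A. h r = \<zero>\<^bsub>B\<^esub>} = {r \<in> carrier A. \<exists>s\<in>S. r \<otimes>\<^bsub>A\<^esub> s = \<zero>\<^bsub>A\<^esub>}"
    using assms(1) by (auto simp: right_fraction_algebra_def)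
  interpret A: unital_algebra K A using h by (simp add: algebra_morphism_def)
  interpret B: unital_algebra K B using h by (simp add: algebra_morphism_def)
  interpret h: ring_hom_ring A B h
    using h by unfold_locales (simp add: algebra_morphism_def)
  have "h (r \<ominus>\<^bsub>A\<^esub> r') = \<zero>\<^bsub>B\<^esub>"
    using r r' eq by (simp add: A.minus_eq B.r_neg)
  then have "r \<ominus>\<^bsub>A\<^esub> r' \<in> {r \<in> carrier A. h r = \<zero>\<^bsub>B\<^esub>}"
    using r r' by simp
  then obtain t where t: "t \<in> S" "(r \<ominus>\<^bsub>A\<^esub> r') \<otimes>\<^bsub>A\<^esub> t = \<zero>\<^bsub>A\<^esub>"
    unfolding ker by blast
  moreover have "t \<in> carrier A"
    using S t(1) by (auto simp: multiplicative_subset_def)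
  ultimately have "r \<otimes>\<^bsub>A\<^esub> t \<ominus>\<^bsub>A\<^esub> r' \<otimes>\<^bsub>A\<^esub> t = \<zero>\<^bsub>A\<^esub>"
    using r r' by (simp add: A.minus_eq A.l_distr A.l_minus)
  then have "r \<otimes>\<^bsub>A\<^esub> t = r' \<otimes>\<^bsub>A\<^esub> t"
    using r r' \<open>t \<in> carrier A\<close> by simp
  then show ?thesis using t(1) by blast
qed

lemma right_fraction_algebra_denominator_set:
  assumes "right_fraction_algebra K A S B h"
  shows "right_denominator_set A S"
proof -
  have S: "multiplicative_subset A S" and h: "algebra_morphism K A B h"
    and units: "\<And>s. s \<in> S \<Longrightarrow> h s \<in> Units B"
    and frac: "\<And>b. b \<in> carrier B \<Longrightarrow> \<exists>r\<in>carrier A. \<exists>s\<in>S. b = h r \<otimes>\<^bsub>B\<^esub> inv\<^bsub>B\<^esub> (h s)"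
    and ker: "{r \<in> carrier A. h r = \<zero>\<^bsub>B\<^esub>} = {r \<in> carrier A. \<exists>s\<in>S. r \<otimes>\<^bsub>A\<^esub> s = \<zero>\<^bsub>A\<^esub>}"
    using assms by (auto simp: right_fraction_algebra_def)
  interpret A: unital_algebra K A using h by (simp add: algebra_morphism_def)
  interpret B: unital_algebra K B using h by (simp add: algebra_morphism_def)
  interpret h: ring_hom_ring A B h
    using h by unfold_locales (simp add: algebra_morphism_def)
  have SA: "s \<in> carrier A" if "s \<in> S" for s
    using S that by (auto simp: multiplicative_subset_def)
  show ?thesis unfolding right_denominator_set_def
  proof (intro conjI ballI impI)
    fix r s assume r: "r \<in> carrier A" and s: "s \<in> S"
    obtain r' s' where r': "r' \<in> carrier A" and s': "s' \<in> S"
      and eq: "inv\<^bsub>B\<^esub> (h s) \<otimes>\<^bsub>B\<^esub> h r = h r' \<otimes>\<^bsub>B\<^esub> inv\<^bsub>B\<^esub> (h s')"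
      using frac[of "inv\<^bsub>B\<^esub> (h s) \<otimes>\<^bsub>B\<^esub> h r"] units[OF s] r by auto
    have "h r \<otimes>\<^bsub>B\<^esub> h s' = h s \<otimes>\<^bsub>B\<^esub> (inv\<^bsub>B\<^esub> (h s) \<otimes>\<^bsub>B\<^esub> h r) \<otimes>\<^bsub>B\<^esub> h s'"
      using r SA[OF s] SA[OF s'] units[OF s] by (simp add: B.m_assoc[symmetric])
    also have "\<dots> = h s \<otimes>\<^bsub>B\<^esub> h r'"
      unfolding eq using r' SA[OF s] SA[OF s'] units[OF s'] by (simp add: B.m_assoc)
    finally have "h (r \<otimes>\<^bsub>A\<^esub> s') = h (s \<otimes>\<^bsub>A\<^esub> r')"
      using r r' SA[OF s] SA[OF s'] by simp
    \<comment> \<open>The identity holds only after \<open>h\<close>; the factor \<open>t\<close>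
      that makes it hold in \<open>A\<close> is absorbed into both \<open>r'\<close> and
      \<open>s'\<close>.\<close>
    then obtain t where t: "t \<in> S" "r \<otimes>\<^bsub>A\<^esub> s' \<otimes>\<^bsub>A\<^esub> t = s \<otimes>\<^bsub>A\<^esub> r' \<otimes>\<^bsub>A\<^esub> t"
      using right_fraction_algebra_eqD[OF assms, of "r \<otimes>\<^bsub>A\<^esub> s'" "s \<otimes>\<^bsub>A\<^esub> r'"] r r' SA[OF s] SA[OF s']
      by auto
    then have "r \<otimes>\<^bsub>A\<^esub> (s' \<otimes>\<^bsub>A\<^esub> t) = s \<otimes>\<^bsub>A\<^esub> (r' \<otimes>\<^bsub>A\<^esub> t)"
      using r r' SA[OF s] SA[OF s'] SA[of t] by (simp add: A.m_assoc)
    moreover have "s' \<otimes>\<^bsub>A\<^esub> t \<in> S"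
      using S s' t(1) by (simp add: multiplicative_subset_def)
    ultimately show "\<exists>r'\<in>carrier A. \<exists>s'\<in>S. r \<otimes>\<^bsub>A\<^esub> s' = s \<otimes>\<^bsub>A\<^esub> r'"
      using r' SA[OF t(1)] by blast
  next
    fix r s' assume r: "r \<in> carrier A" and s': "s' \<in> S" and 0: "s' \<otimes>\<^bsub>A\<^esub> r = \<zero>\<^bsub>A\<^esub>"
    \<comment> \<open>Cancelling the unit \<open>h s'\<close> puts \<open>r\<close> into the kernel,
      and the kernel is described by annihilation on the right. This is how a relation with a left
      factor becomes one with a right factor.\<close>
    then have "h s' \<otimes>\<^bsub>B\<^esub> h r = \<zero>\<^bsub>B\<^esub>"
      using SA[OF s'] by (simp flip: h.hom_mult)
    then have "h r = inv\<^bsub>B\<^esub> (h s') \<otimes>\<^bsub>B\<^esub> \<zero>\<^bsub>B\<^esub>"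
      using r SA[OF s'] units[OF s'] by (metis B.Units_inv_closed B.Units_l_inv B.l_one B.m_assoc h.hom_closed)
    then have "h r = \<zero>\<^bsub>B\<^esub>"
      using units[OF s'] by simp
    then show "\<exists>s\<in>S. r \<otimes>\<^bsub>A\<^esub> s = \<zero>\<^bsub>A\<^esub>"
      using ker r by blast
  qed fact
qed

text \<open>The class of \<open>(r, s)\<close> turns out to be the whole fibre \<open>P b\<close> of
  \<open>\<iota>\<close> over \<open>b = \<iota> r s\<close>. Hence \<open>P\<close> is a bijection
  from \<open>carrier B\<close> onto the classes, the operations can be computed in
  \<open>B\<close>, and neither transitivity of \<open>fraction_rel\<close> nor independence of
  choices has to be derived inside \<open>A\<close>.\<close>

lemma right_fraction_algebra_isomorphic_ore_localization:
  assumes frac_alg: "right_fraction_algebra K A S B h"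
  shows "isomorphic_algebras K (ore_localization A S) B"
proof -
  have S: "multiplicative_subset A S" and h: "algebra_morphism K A B h"
    and units: "\<And>s. s \<in> S \<Longrightarrow> h s \<in> Units B"
    and frac: "\<And>b. b \<in> carrier B \<Longrightarrow> \<exists>r\<in>carrier A. \<exists>s\<in>S. b = h r \<otimes>\<^bsub>B\<^esub> inv\<^bsub>B\<^esub> (h s)"
    using frac_alg by (auto simp: right_fraction_algebra_def)
  interpret A: unital_algebra K A using h by (simp add: algebra_morphism_def)
  interpret B: unital_algebra K B using h by (simp add: algebra_morphism_def)
  interpret h: ring_hom_ring A B h
    using h by unfold_locales (simp add: algebra_morphism_def)
  have SA [simp]: "s \<in> carrier A" if "s \<in> S" for s
    using S that by (auto simp: multiplicative_subset_def)
  have S_mult [simp]: "s \<otimes>\<^bsub>A\<^esub> t \<in> S" if "s \<in> S" "t \<in> S" for s t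
    using S that by (auto simp: multiplicative_subset_def)
  have S_one [simp]: "\<one>\<^bsub>A\<^esub> \<in> S"
    using S by (auto simp: multiplicative_subset_def)
  have ore: "\<exists>r'\<in>carrier A. \<exists>s'\<in>S. r \<otimes>\<^bsub>A\<^esub> s' = s \<otimes>\<^bsub>A\<^esub> r'" if "r \<in> carrier A" "s \<in> S" for r s
    using right_fraction_algebra_denominator_set[OF frac_alg] that
    by (auto simp: right_denominator_set_def)
  define \<iota> where "\<iota> r s = h r \<otimes>\<^bsub>B\<^esub> inv\<^bsub>B\<^esub> (h s)" for r s
  define P where "P b = {(r, s). r \<in> carrier A \<and> s \<in> S \<and> \<iota> r s = b}" for b
  have \<iota>_closed [simp]: "\<iota> r s \<in> carrier B" if "r \<in> carrier A" "s \<in> S" for r s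
    using that units by (simp add: \<iota>_def)
  \<comment> \<open>The factor \<open>c\<close> need not lie in \<open>S\<close>, so
    \<open>h c\<close> is not known to be a unit in advance. But \<open>h c\<close> times the
    inverse of \<open>h\<close> at the product of \<open>s\<close> and \<open>c\<close> is a right
    inverse of the unit \<open>h s\<close>, hence equal to its inverse.\<close>
  have \<iota>_expand: "\<iota> (r \<otimes>\<^bsub>A\<^esub> c) (s \<otimes>\<^bsub>A\<^esub> c) = \<iota> r s"
    if r: "r \<in> carrier A" and s: "s \<in> S" and c: "c \<in> carrier A" and sc: "s \<otimes>\<^bsub>A\<^esub> c \<in> S" for r s c
  proof -
    have "h s \<otimes>\<^bsub>B\<^esub> (h c \<otimes>\<^bsub>B\<^esub> inv\<^bsub>B\<^esub> (h (s \<otimes>\<^bsub>A\<^esub> c))) = \<one>\<^bsub>B\<^esub>"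
      using s c units[OF sc] by (simp flip: B.m_assoc)
    then have "inv\<^bsub>B\<^esub> (h s) \<otimes>\<^bsub>B\<^esub> (h s \<otimes>\<^bsub>B\<^esub> (h c \<otimes>\<^bsub>B\<^esub> inv\<^bsub>B\<^esub> (h (s \<otimes>\<^bsub>A\<^esub> c)))) = inv\<^bsub>B\<^esub> (h s)"
      using units[OF s] by simp
    then have "h c \<otimes>\<^bsub>B\<^esub> inv\<^bsub>B\<^esub> (h (s \<otimes>\<^bsub>A\<^esub> c)) = inv\<^bsub>B\<^esub> (h s)"
      using s c units[OF sc] units[OF s] by (simp add: B.m_assoc[symmetric] del: h.hom_mult)
    then show ?thesis
      using r s c units[OF sc]
      by (simp add: \<iota>_def B.m_assoc h.hom_mult[OF r c] del: h.hom_mult)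
  qed
  have rel_iff: "((r1, s1), (r2, s2)) \<in> fraction_rel A S \<longleftrightarrow>
      r1 \<in> carrier A \<and> s1 \<in> S \<and> r2 \<in> carrier A \<and> s2 \<in> S \<and> \<iota> r1 s1 = \<iota> r2 s2" for r1 s1 r2 s2
  proof
    assume "((r1, s1), (r2, s2)) \<in> fraction_rel A S"
    then obtain b1 b2 where *: "r1 \<in> carrier A" "s1 \<in> S" "r2 \<in> carrier A" "s2 \<in> S"
      and b: "b1 \<in> carrier A" "b2 \<in> carrier A"
      and eq: "s1 \<otimes>\<^bsub>A\<^esub> b1 = s2 \<otimes>\<^bsub>A\<^esub> b2" "s2 \<otimes>\<^bsub>A\<^esub> b2 \<in> S" "r1 \<otimes>\<^bsub>A\<^esub> b1 = r2 \<otimes>\<^bsub>A\<^esub> b2"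
      unfolding fraction_rel_def by blast
    have "\<iota> r1 s1 = \<iota> r2 s2"
      using \<iota>_expand[OF *(1,2) b(1)] \<iota>_expand[OF *(3,4) b(2)] eq by metis
    then show "r1 \<in> carrier A \<and> s1 \<in> S \<and> r2 \<in> carrier A \<and> s2 \<in> S \<and> \<iota> r1 s1 = \<iota> r2 s2"
      using * by blast
  next
    \<comment> \<open>The Ore condition supplies a common denominator. Cancelling it in
      \<open>B\<close> leaves numerators that are equal only under \<open>h\<close>, and a further
      factor \<open>t\<close> makes them equal in \<open>A\<close>; \<open>c1\<close> and
      \<open>c2\<close>, each multiplied by \<open>t\<close>, are the witnesses \<open>b1\<close>
      and \<open>b2\<close>.\<close>
    assume *: "r1 \<in> carrier A \<and> s1 \<in> S \<and> r2 \<in> carrier A \<and> s2 \<in> S \<and> \<iota> r1 s1 = \<iota> r2 s2"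
    then obtain c1 c2 where c: "c1 \<in> S" "c2 \<in> carrier A" "s1 \<otimes>\<^bsub>A\<^esub> c1 = s2 \<otimes>\<^bsub>A\<^esub> c2"
      using ore[of s1 s2] by auto
    have sc: "s1 \<otimes>\<^bsub>A\<^esub> c1 \<in> S" using * c(1) by simp
    have "\<iota> (r1 \<otimes>\<^bsub>A\<^esub> c1) (s1 \<otimes>\<^bsub>A\<^esub> c1) = \<iota> (r2 \<otimes>\<^bsub>A\<^esub> c2) (s1 \<otimes>\<^bsub>A\<^esub> c1)"
      using * c sc \<iota>_expand[of r1 s1 c1] \<iota>_expand[of r2 s2 c2] by simp
    then have "h (r1 \<otimes>\<^bsub>A\<^esub> c1) \<otimes>\<^bsub>B\<^esub> inv\<^bsub>B\<^esub> (h (s1 \<otimes>\<^bsub>A\<^esub> c1)) \<otimes>\<^bsub>B\<^esub> h (s1 \<otimes>\<^bsub>A\<^esub> c1) =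
        h (r2 \<otimes>\<^bsub>A\<^esub> c2) \<otimes>\<^bsub>B\<^esub> inv\<^bsub>B\<^esub> (h (s1 \<otimes>\<^bsub>A\<^esub> c1)) \<otimes>\<^bsub>B\<^esub> h (s1 \<otimes>\<^bsub>A\<^esub> c1)"
      by (simp add: \<iota>_def)
    then have "h (r1 \<otimes>\<^bsub>A\<^esub> c1) = h (r2 \<otimes>\<^bsub>A\<^esub> c2)"
      using * c units[OF sc] by (simp add: B.m_assoc del: h.hom_mult)
    then obtain t where t: "t \<in> S" "r1 \<otimes>\<^bsub>A\<^esub> c1 \<otimes>\<^bsub>A\<^esub> t = r2 \<otimes>\<^bsub>A\<^esub> c2 \<otimes>\<^bsub>A\<^esub> t"
      using right_fraction_algebra_eqD[OF frac_alg, of "r1 \<otimes>\<^bsub>A\<^esub> c1" "r2 \<otimes>\<^bsub>A\<^esub> c2"] * c(1,2) by auto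
    then have "r1 \<otimes>\<^bsub>A\<^esub> (c1 \<otimes>\<^bsub>A\<^esub> t) = r2 \<otimes>\<^bsub>A\<^esub> (c2 \<otimes>\<^bsub>A\<^esub> t)"
      using * c(1,2) by (simp add: A.m_assoc)
    moreover have "s1 \<otimes>\<^bsub>A\<^esub> (c1 \<otimes>\<^bsub>A\<^esub> t) = s2 \<otimes>\<^bsub>A\<^esub> (c2 \<otimes>\<^bsub>A\<^esub> t)"
      using * c t by (simp flip: A.m_assoc)
    moreover have "s2 \<otimes>\<^bsub>A\<^esub> (c2 \<otimes>\<^bsub>A\<^esub> t) \<in> S"
      using * c t sc by (simp flip: A.m_assoc)
    moreover have "c1 \<otimes>\<^bsub>A\<^esub> t \<in> carrier A" "c2 \<otimes>\<^bsub>A\<^esub> t \<in> carrier A"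
      using c t by simp_all
    ultimately show "((r1, s1), (r2, s2)) \<in> fraction_rel A S"
      using * unfolding fraction_rel_def by blast
  qed
  have fraction: "fraction A S r s = P (\<iota> r s)" if "r \<in> carrier A" "s \<in> S" for r s
    using that by (auto simp: fraction_def P_def rel_iff)
  have P_nonempty: "\<exists>r s. (r, s) \<in> P b \<and> r \<in> carrier A \<and> s \<in> S \<and> b = \<iota> r s" if "b \<in> carrier B" for b
    using frac[OF that] by (auto simp: P_def \<iota>_def)
  \<comment> \<open>Every \<open>b\<close> is a fraction, so no fibre is empty, and any member of
    \<open>P b\<close> determines \<open>b\<close>.\<close>
  have P_inj: "inj_on P (carrier B)"
  proof (rule inj_onI)
    fix b b' assume "b \<in> carrier B" "b' \<in> carrier B" "P b = P b'"
    then show "b = b'" using P_nonempty[of b] by (auto simp: P_def)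
  qed
  have carrier: "carrier (ore_localization A S) = P ` carrier B"
  proof -
    have "carrier (ore_localization A S) = (\<lambda>(r, s). fraction A S r s) ` (carrier A \<times> S)"
      by (auto simp: ore_localization_def quotient_def fraction_def)
    also have "\<dots> = P ` (\<lambda>(r, s). \<iota> r s) ` (carrier A \<times> S)"
      unfolding image_image by (rule image_cong) (auto simp: fraction)
    also have "(\<lambda>(r, s). \<iota> r s) ` (carrier A \<times> S) = carrier B"
    proof
      show "carrier B \<subseteq> (\<lambda>(r, s). \<iota> r s) ` (carrier A \<times> S)"
        using frac unfolding \<iota>_def by fast
    qed auto
    finally show ?thesis .
  qed
  have add: "P (b \<oplus>\<^bsub>B\<^esub> b') = P b \<oplus>\<^bsub>ore_localization A S\<^esub> P b'"
    if b: "b \<in> carrier B" and b': "b' \<in> carrier B" for b b'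
  proof -
    let ?X = "{fraction A S (r1 \<otimes>\<^bsub>A\<^esub> c1 \<oplus>\<^bsub>A\<^esub> r2 \<otimes>\<^bsub>A\<^esub> c2) s | r1 s1 r2 s2 c1 c2 s.
        (r1, s1) \<in> P b \<and> (r2, s2) \<in> P b' \<and> c1 \<in> S \<and> c2 \<in> carrier A \<and> s \<in> S \<and>
        s1 \<otimes>\<^bsub>A\<^esub> c1 = s \<and> s2 \<otimes>\<^bsub>A\<^esub> c2 = s}"
    have eq: "fraction A S (r1 \<otimes>\<^bsub>A\<^esub> c1 \<oplus>\<^bsub>A\<^esub> r2 \<otimes>\<^bsub>A\<^esub> c2) s = P (b \<oplus>\<^bsub>B\<^esub> b')"
      if "(r1, s1) \<in> P b" "(r2, s2) \<in> P b'" "c1 \<in> S" "c2 \<in> carrier A" "s \<in> S"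
        "s1 \<otimes>\<^bsub>A\<^esub> c1 = s" "s2 \<otimes>\<^bsub>A\<^esub> c2 = s" for r1 s1 r2 s2 c1 c2 s
    proof -
      have 1: "r1 \<in> carrier A" "s1 \<in> S" "r2 \<in> carrier A" "s2 \<in> S" "b = \<iota> r1 s1" "b' = \<iota> r2 s2"
        using that by (auto simp: P_def)
      have "\<iota> (r1 \<otimes>\<^bsub>A\<^esub> c1 \<oplus>\<^bsub>A\<^esub> r2 \<otimes>\<^bsub>A\<^esub> c2) s = \<iota> (r1 \<otimes>\<^bsub>A\<^esub> c1) s \<oplus>\<^bsub>B\<^esub> \<iota> (r2 \<otimes>\<^bsub>A\<^esub> c2) s"
        using 1 that(3,4,5) units[of s] by (simp add: \<iota>_def B.l_distr)
      also have "\<dots> = b \<oplus>\<^bsub>B\<^esub> b'"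
        using 1 that \<iota>_expand[of r1 s1 c1] \<iota>_expand[of r2 s2 c2] by simp
      finally show ?thesis using 1 that by (simp add: fraction)
    qed
    \<comment> \<open>One admissible choice must be exhibited too, since a union over no choices
      would be empty.\<close>
    obtain r1 s1 r2 s2 where rs: "(r1, s1) \<in> P b" "s1 \<in> S" "(r2, s2) \<in> P b'" "s2 \<in> S"
      using P_nonempty[OF b] P_nonempty[OF b'] by auto
    then obtain c1 c2 where c: "c1 \<in> S" "c2 \<in> carrier A" "s1 \<otimes>\<^bsub>A\<^esub> c1 = s2 \<otimes>\<^bsub>A\<^esub> c2"
      using ore[of s1 s2] by auto
    have "fraction A S (r1 \<otimes>\<^bsub>A\<^esub> c1 \<oplus>\<^bsub>A\<^esub> r2 \<otimes>\<^bsub>A\<^esub> c2) (s1 \<otimes>\<^bsub>A\<^esub> c1) \<in> ?X"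
      by (intro CollectI exI conjI) (rule refl rs c c(3)[symmetric] S_mult[OF rs(2) c(1)])+
    then have "\<Union>?X = P (b \<oplus>\<^bsub>B\<^esub> b')"
      by (rule Union_eqI_unique) (elim CollectE exE conjE, simp only: eq)
    then show ?thesis by (simp add: ore_localization_def)
  qed
  have mult: "P (b \<otimes>\<^bsub>B\<^esub> b') = P b \<otimes>\<^bsub>ore_localization A S\<^esub> P b'"
    if b: "b \<in> carrier B" and b': "b' \<in> carrier B" for b b'
  proof -
    let ?X = "{fraction A S (r1 \<otimes>\<^bsub>A\<^esub> r') (s2 \<otimes>\<^bsub>A\<^esub> s') | r1 s1 r2 s2 r' s'.
        (r1, s1) \<in> P b \<and> (r2, s2) \<in> P b' \<and> r' \<in> carrier A \<and> s' \<in> S \<and>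
        r2 \<otimes>\<^bsub>A\<^esub> s' = s1 \<otimes>\<^bsub>A\<^esub> r'}"
    have eq: "fraction A S (r1 \<otimes>\<^bsub>A\<^esub> r') (s2 \<otimes>\<^bsub>A\<^esub> s') = P (b \<otimes>\<^bsub>B\<^esub> b')"
      if "(r1, s1) \<in> P b" "(r2, s2) \<in> P b'" and r': "r' \<in> carrier A" and s': "s' \<in> S"
        and comm: "r2 \<otimes>\<^bsub>A\<^esub> s' = s1 \<otimes>\<^bsub>A\<^esub> r'" for r1 s1 r2 s2 r' s'
    proof -
      have 1: "r1 \<in> carrier A" "s1 \<in> S" "r2 \<in> carrier A" "s2 \<in> S" "b = \<iota> r1 s1" "b' = \<iota> r2 s2"
        using that by (auto simp: P_def)
      note u = units[OF 1(2)] units[OF 1(4)] units[OF s']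
      have "h r2 \<otimes>\<^bsub>B\<^esub> h s' = h s1 \<otimes>\<^bsub>B\<^esub> h r'"
        using 1 r' s' comm by (metis SA h.hom_mult)
      then have "inv\<^bsub>B\<^esub> (h s1) \<otimes>\<^bsub>B\<^esub> (h r2 \<otimes>\<^bsub>B\<^esub> h s') \<otimes>\<^bsub>B\<^esub> inv\<^bsub>B\<^esub> (h s')
          = inv\<^bsub>B\<^esub> (h s1) \<otimes>\<^bsub>B\<^esub> (h s1 \<otimes>\<^bsub>B\<^esub> h r') \<otimes>\<^bsub>B\<^esub> inv\<^bsub>B\<^esub> (h s')"
        by simp
      moreover have "inv\<^bsub>B\<^esub> (h s1) \<otimes>\<^bsub>B\<^esub> (h r2 \<otimes>\<^bsub>B\<^esub> h s') \<otimes>\<^bsub>B\<^esub> inv\<^bsub>B\<^esub> (h s') = inv\<^bsub>B\<^esub> (h s1) \<otimes>\<^bsub>B\<^esub> h r2"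
        using 1 s' u by (simp add: B.m_assoc)
      moreover have "inv\<^bsub>B\<^esub> (h s1) \<otimes>\<^bsub>B\<^esub> (h s1 \<otimes>\<^bsub>B\<^esub> h r') \<otimes>\<^bsub>B\<^esub> inv\<^bsub>B\<^esub> (h s') = h r' \<otimes>\<^bsub>B\<^esub> inv\<^bsub>B\<^esub> (h s')"
        using 1 r' u by (simp flip: B.m_assoc)
      \<comment> \<open>In \<open>B\<close> the auxiliary equation says how a denominator moves past
        a numerator; this is the origin of the product formula.\<close>
      ultimately have swap: "inv\<^bsub>B\<^esub> (h s1) \<otimes>\<^bsub>B\<^esub> h r2 = h r' \<otimes>\<^bsub>B\<^esub> inv\<^bsub>B\<^esub> (h s')"
        by simp
      have "b \<otimes>\<^bsub>B\<^esub> b' = h r1 \<otimes>\<^bsub>B\<^esub> (inv\<^bsub>B\<^esub> (h s1) \<otimes>\<^bsub>B\<^esub> h r2) \<otimes>\<^bsub>B\<^esub> inv\<^bsub>B\<^esub> (h s2)"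
        using 1 u by (simp add: \<iota>_def B.m_assoc)
      also have "\<dots> = \<iota> (r1 \<otimes>\<^bsub>A\<^esub> r') (s2 \<otimes>\<^bsub>A\<^esub> s')"
        unfolding swap using 1 r' s' u by (simp add: \<iota>_def B.m_assoc B.inv_mult_Units)
      finally show ?thesis using 1 r' s' by (simp add: fraction)
    qed
    obtain r1 s1 r2 s2 where rs: "(r1, s1) \<in> P b" "s1 \<in> S" "(r2, s2) \<in> P b'" "r2 \<in> carrier A"
      using P_nonempty[OF b] P_nonempty[OF b'] by auto
    then obtain r' s' where "r' \<in> carrier A" "s' \<in> S" "r2 \<otimes>\<^bsub>A\<^esub> s' = s1 \<otimes>\<^bsub>A\<^esub> r'"
      using ore[of r2 s1] by auto
    then have "fraction A S (r1 \<otimes>\<^bsub>A\<^esub> r') (s2 \<otimes>\<^bsub>A\<^esub> s') \<in> ?X"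
      using rs by blast
    then have "\<Union>?X = P (b \<otimes>\<^bsub>B\<^esub> b')"
      by (rule Union_eqI_unique) (elim CollectE exE conjE, simp only: eq)
    then show ?thesis by (simp add: ore_localization_def)
  qed
  have smult: "P (a \<odot>\<^bsub>B\<^esub> b) = a \<odot>\<^bsub>ore_localization A S\<^esub> P b"
    if a: "a \<in> carrier K" and b: "b \<in> carrier B" for a b
  proof -
    have eq: "fraction A S (a \<odot>\<^bsub>A\<^esub> r) s = P (a \<odot>\<^bsub>B\<^esub> b)" if "(r, s) \<in> P b" for r s
    proof -
      have 1: "r \<in> carrier A" "s \<in> S" "b = \<iota> r s"
        using that by (auto simp: P_def)
      then have "\<iota> (a \<odot>\<^bsub>A\<^esub> r) s = a \<odot>\<^bsub>B\<^esub> b"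
        using a h units[of s] by (simp add: \<iota>_def algebra_morphism_def B.smult_mult_left)
      then show ?thesis using 1 a by (simp add: fraction)
    qed
    obtain r s where "(r, s) \<in> P b"
      using P_nonempty[OF b] by blast
    then have "fraction A S (a \<odot>\<^bsub>A\<^esub> r) s \<in> {fraction A S (a \<odot>\<^bsub>A\<^esub> r) s | r s. (r, s) \<in> P b}"
      by blast
    then have "\<Union>{fraction A S (a \<odot>\<^bsub>A\<^esub> r) s | r s. (r, s) \<in> P b} = P (a \<odot>\<^bsub>B\<^esub> b)"
      by (rule Union_eqI_unique) (elim CollectE exE conjE, simp only: eq)
    then show ?thesis by (simp add: ore_localization_def)
  qed
  have "\<iota> \<one>\<^bsub>A\<^esub> \<one>\<^bsub>A\<^esub> = \<one>\<^bsub>B\<^esub>" "\<iota> \<zero>\<^bsub>A\<^esub> \<one>\<^bsub>A\<^esub> = \<zero>\<^bsub>B\<^esub>"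
    by (simp_all add: \<iota>_def)
  then have one: "P \<one>\<^bsub>B\<^esub> = \<one>\<^bsub>ore_localization A S\<^esub>"
    and zero: "P \<zero>\<^bsub>B\<^esub> = \<zero>\<^bsub>ore_localization A S\<^esub>"
    using fraction[of "\<one>\<^bsub>A\<^esub>" "\<one>\<^bsub>A\<^esub>"] fraction[of "\<zero>\<^bsub>A\<^esub>" "\<one>\<^bsub>A\<^esub>"]
    by (simp_all add: ore_localization_def)
  \<comment> \<open>The transport goes from \<open>B\<close> to the localization because only
    \<open>B\<close> is known to be an algebra at this stage. The inverse of \<open>P\<close> is
    then the wanted isomorphism.\<close>
  have "algebra_morphism K B (ore_localization A S) P"
    by (intro unital_algebra_surjective_image B.unital_algebra_axioms carrier one zero add mult smult)
  then have L: "unital_algebra K (ore_localization A S)"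
    by (simp add: algebra_morphism_def)
  have Q: "inv_into (carrier B) P (P b) = b" if "b \<in> carrier B" for b
    using P_inj that by simp
  have "algebra_morphism K (ore_localization A S) B (inv_into (carrier B) P)" (is "algebra_morphism _ _ _ ?Q")
  proof (rule unital_algebra_surjective_image[OF L])
    show "carrier B = ?Q ` carrier (ore_localization A S)"
      unfolding carrier image_image using Q by simp
    show "?Q \<one>\<^bsub>ore_localization A S\<^esub> = \<one>\<^bsub>B\<^esub>" "?Q \<zero>\<^bsub>ore_localization A S\<^esub> = \<zero>\<^bsub>B\<^esub>"
      unfolding one[symmetric] zero[symmetric] by (simp_all only: Q B.one_closed B.zero_closed)
  next
    fix F G assume "F \<in> carrier (ore_localization A S)" "G \<in> carrier (ore_localization A S)"
    then obtain b b' where b: "b \<in> carrier B" "F = P b" and b': "b' \<in> carrier B" "G = P b'"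
      unfolding carrier by blast
    show "?Q (F \<oplus>\<^bsub>ore_localization A S\<^esub> G) = ?Q F \<oplus>\<^bsub>B\<^esub> ?Q G" "?Q (F \<otimes>\<^bsub>ore_localization A S\<^esub> G) = ?Q F \<otimes>\<^bsub>B\<^esub> ?Q G"
      unfolding b(2) b'(2) add[OF b(1) b'(1), symmetric] mult[OF b(1) b'(1), symmetric]
      by (simp_all only: Q b(1) b'(1) B.a_closed B.m_closed)
  next
    fix a F assume a: "a \<in> carrier K" and "F \<in> carrier (ore_localization A S)"
    then obtain b where b: "b \<in> carrier B" "F = P b"
      unfolding carrier by blast
    show "?Q (a \<odot>\<^bsub>ore_localization A S\<^esub> F) = a \<odot>\<^bsub>B\<^esub> ?Q F"
      unfolding b(2) smult[OF a b(1), symmetric] by (simp only: Q a b(1) B.smult_closed)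
  qed
  moreover have "bij_betw (inv_into (carrier B) P) (carrier (ore_localization A S)) (carrier B)"
    using P_inj carrier by (intro bij_betw_inv_into) (simp add: bij_betw_def)
  ultimately show ?thesis
    by (auto simp: isomorphic_algebras_def)
qed

section \<open>Calculus of smooth functions\<close>

lemma frechet_derivativeI: "(f has_derivative D) (at x) \<Longrightarrow> frechet_derivative f (at x) = D"
  by (rule frechet_derivative_at[symmetric])

lemma continuously_differentiable_on_cong_imp:
  assumes "open S" "\<And>x. x \<in> S \<Longrightarrow> f x = g x" "continuously_differentiable_on k S f"
  shows "continuously_differentiable_on k S g"
  using assms(2,3)
proof (induction k arbitrary: f g)
  case 0
  have "continuous_on S f \<longleftrightarrow> continuous_on S g"
    by (rule continuous_on_cong[OF refl 0(1)])
  then show ?case using 0(2) by simp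
next
  case (Suc k)
  have diff: "(g has_derivative frechet_derivative f (at x)) (at x)" if "x \<in> S" for x
  proof (rule has_derivative_transform_within_open)
    show "(f has_derivative frechet_derivative f (at x)) (at x)"
      using Suc.prems(2) that by (simp flip: frechet_derivative_works)
  qed (fact assms(1) that Suc.prems(1))+
  have "continuously_differentiable_on k S (\<lambda>x. frechet_derivative g (at x) v)" for v
    by (rule Suc.IH[of "\<lambda>x. frechet_derivative f (at x) v"])
      (use Suc.prems(2) in \<open>simp_all add: frechet_derivativeI[OF diff]\<close>)
  moreover have "\<forall>x\<in>S. g differentiable (at x)"
    unfolding differentiable_def using diff by blast
  ultimately show ?case by simp
qed

lemma continuously_differentiable_on_cong:
  assumes "open S" "\<And>x. x \<in> S \<Longrightarrow> f x = g x"
  shows "continuously_differentiable_on k S f \<longleftrightarrow> continuously_differentiable_on k S g"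
proof
  show "continuously_differentiable_on k S f \<Longrightarrow> continuously_differentiable_on k S g"
    by (rule continuously_differentiable_on_cong_imp[OF assms])
  show "continuously_differentiable_on k S g \<Longrightarrow> continuously_differentiable_on k S f"
    by (rule continuously_differentiable_on_cong_imp[OF assms(1) assms(2)[symmetric]])
qed

lemma continuously_differentiable_on_subset:
  "continuously_differentiable_on k S f \<Longrightarrow> T \<subseteq> S \<Longrightarrow> continuously_differentiable_on k T f"
  by (induction k arbitrary: f) (auto intro: continuous_on_subset)

lemma continuously_differentiable_on_local:
  assumes "\<And>x. x \<in> S \<Longrightarrow> \<exists>T. open T \<and> x \<in> T \<and> continuously_differentiable_on k T f"
  shows "continuously_differentiable_on k S f"
  using assms
proof (induction k arbitrary: f)
  case 0
  have "isCont f x" if "x \<in> S" for x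
    using 0[OF that] by (auto simp: continuous_on_eq_continuous_at)
  then show ?case by (simp add: continuous_at_imp_continuous_on)
next
  case (Suc k)
  have "continuously_differentiable_on k S (\<lambda>x. frechet_derivative f (at x) v)" for v
    by (rule Suc.IH) (use Suc.prems in force)
  then show ?case using Suc.prems by force
qed

lemma continuously_differentiable_on_SucD:
  "continuously_differentiable_on (Suc k) S f \<Longrightarrow> continuously_differentiable_on k S f"
proof (induction k arbitrary: f)
  case 0
  then show ?case
    by (auto intro!: continuous_at_imp_continuous_on differentiable_imp_continuous_within)
qed auto

text \<open>Lets inductive steps work with an explicit derivative \<open>D\<close>; at points of the
  open set it coincides with the chosen \<open>frechet_derivative\<close>.\<close>

lemma continuously_differentiable_on_SucI:
  assumes "open S" "\<And>x. x \<in> S \<Longrightarrow> (f has_derivative D x) (at x)"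
    and "\<And>v. continuously_differentiable_on k S (\<lambda>x. D x v)"
  shows "continuously_differentiable_on (Suc k) S f"
proof -
  have "continuously_differentiable_on k S (\<lambda>x. frechet_derivative f (at x) v)" for v
    using assms(3)[of v] frechet_derivativeI[OF assms(2)]
    by (subst continuously_differentiable_on_cong[OF assms(1), where g = "\<lambda>x. D x v"]) auto
  then show ?thesis using assms(2) by (auto simp: differentiable_def)
qed

lemma continuously_differentiable_on_Suc_has_derivative:
  "continuously_differentiable_on (Suc k) S f \<Longrightarrow> x \<in> S \<Longrightarrow>
    (f has_derivative frechet_derivative f (at x)) (at x)"
  by (simp add: frechet_derivative_works)

lemma continuously_differentiable_on_const: "continuously_differentiable_on k S (\<lambda>x. c)"
  by (induction k arbitrary: c) auto

lemma continuously_differentiable_on_ident: "continuously_differentiable_on k S (\<lambda>x. x)"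
  by (cases k) (auto simp: continuously_differentiable_on_const continuous_on_id)

lemma continuously_differentiable_on_bounded_linear:
  assumes "bounded_linear L" "open S" "continuously_differentiable_on k S f"
  shows "continuously_differentiable_on k S (\<lambda>x. L (f x))"
  using assms(3)
proof (induction k arbitrary: f)
  case 0
  then show ?case using assms(1) by (simp add: bounded_linear.continuous_on)
next
  case (Suc k)
  show ?case
  proof (rule continuously_differentiable_on_SucI[OF assms(2)])
    show "((\<lambda>x. L (f x)) has_derivative (\<lambda>v. L (frechet_derivative f (at x) v))) (at x)"
      if "x \<in> S" for x
      using continuously_differentiable_on_Suc_has_derivative[OF Suc.prems that] assms(1)
      by (rule bounded_linear.has_derivative[rotated])
  qed (use Suc in auto)
qed

lemma continuously_differentiable_on_add:
  assumes "open S" "continuously_differentiable_on k S f" "continuously_differentiable_on k S g"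
  shows "continuously_differentiable_on k S (\<lambda>x. f x + g x)"
  using assms(2,3)
proof (induction k arbitrary: f g)
  case 0
  then show ?case by (simp add: continuous_on_add)
next
  case (Suc k)
  show ?case
  proof (rule continuously_differentiable_on_SucI[OF assms(1)])
    show "((\<lambda>x. f x + g x) has_derivative
        (\<lambda>v. frechet_derivative f (at x) v + frechet_derivative g (at x) v)) (at x)"
      if "x \<in> S" for x
      using Suc.prems that
      by (intro has_derivative_add continuously_differentiable_on_Suc_has_derivative)
  qed (use Suc in auto)
qed

lemma continuously_differentiable_on_sum:
  assumes "open S" "\<And>i. i \<in> I \<Longrightarrow> continuously_differentiable_on k S (f i)"
  shows "continuously_differentiable_on k S (\<lambda>x. \<Sum>i\<in>I. f i x)"
  using assms(2)
  by (induction I rule: infinite_finite_induct)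
    (auto intro!: continuously_differentiable_on_add assms(1) continuously_differentiable_on_const)

text \<open>The Leibniz rule expresses the derivative by the same bilinear map applied to functions
  for which one order less is demanded, so the induction runs over all \<open>f\<close> and
  \<open>g\<close>. One proof serves products, scalar multiplication and inner products.\<close>

lemma continuously_differentiable_on_bilinear:
  assumes B: "bounded_bilinear B" and "open S"
    and "continuously_differentiable_on k S f" "continuously_differentiable_on k S g"
  shows "continuously_differentiable_on k S (\<lambda>x. B (f x) (g x))"
  using assms(3,4)
proof (induction k arbitrary: f g)
  case 0
  then show ?case by (simp add: bounded_bilinear.continuous_on[OF B])
next
  case (Suc k)
  show ?case
  proof (rule continuously_differentiable_on_SucI[OF assms(2)])
    show "((\<lambda>x. B (f x) (g x)) has_derivative
        (\<lambda>v. B (f x) (frechet_derivative g (at x) v) + B (frechet_derivative f (at x) v) (g x))) (at x)"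
      if "x \<in> S" for x
      using Suc.prems that
      by (intro bounded_bilinear.FDERIV[OF B] continuously_differentiable_on_Suc_has_derivative)
    show "continuously_differentiable_on k S (\<lambda>x. B (f x) (frechet_derivative g (at x) v) +
        B (frechet_derivative f (at x) v) (g x))" for v
      using Suc.prems continuously_differentiable_on_SucD[OF Suc.prems(1)]
        continuously_differentiable_on_SucD[OF Suc.prems(2)]
      by (intro continuously_differentiable_on_add assms(2) Suc.IH) auto
  qed
qed

text \<open>The derivative of the reciprocal contains the reciprocal again, but with one order less
  demanded of it, so the induction on \<open>k\<close> closes for a fixed \<open>f\<close>.\<close>

lemma continuously_differentiable_on_inverse:
  fixes f :: "'a::real_normed_vector \<Rightarrow> 'b::real_normed_div_algebra"
  assumes "open S" "continuously_differentiable_on k S f" and nz: "\<And>x. x \<in> S \<Longrightarrow> f x \<noteq> 0"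
  shows "continuously_differentiable_on k S (\<lambda>x. inverse (f x))"
  using assms(2)
proof (induction k)
  case 0
  then show ?case using nz continuous_on_inverse[of S f] by simp
next
  case (Suc k)
  show ?case
  proof (rule continuously_differentiable_on_SucI[OF assms(1)])
    show "((\<lambda>x. inverse (f x)) has_derivative
        (\<lambda>v. - (inverse (f x) * frechet_derivative f (at x) v * inverse (f x)))) (at x)"
      if "x \<in> S" for x
      by (rule Deriv.has_derivative_inverse[OF nz[OF that]
            continuously_differentiable_on_Suc_has_derivative[OF Suc.prems that]])
    have inv: "continuously_differentiable_on k S (\<lambda>x. inverse (f x))"
      by (rule Suc.IH[OF continuously_differentiable_on_SucD[OF Suc.prems]])
    show "continuously_differentiable_on k S
        (\<lambda>x. - (inverse (f x) * frechet_derivative f (at x) v * inverse (f x)))" for v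
      using Suc.prems inv
      by (intro continuously_differentiable_on_bounded_linear[OF bounded_linear_minus[OF bounded_linear_ident]]
          continuously_differentiable_on_bilinear[OF bounded_bilinear_mult] assms(1)) auto
  qed
qed

text \<open>\<open>continuously_differentiable_on\<close> controls derivatives only in directions
  independent of the point, whereas the chain rule differentiates \<open>g\<close> in the moving
  direction \<open>frechet_derivative f (at x) v\<close>. Expanding this direction in the frame
  \<open>b\<close> leaves coefficients that depend on \<open>x\<close> and fixed directions
  \<open>b i\<close>.\<close>

lemma continuously_differentiable_on_compose:
  fixes f :: "'a::real_normed_vector \<Rightarrow> 'b::real_inner" and b :: "'i \<Rightarrow> 'b"
  assumes frame: "\<And>y. (\<Sum>i\<in>I. (y \<bullet> b i) *\<^sub>R b i) = y"
    and S: "open S" and "f ` S \<subseteq> T"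
    and "continuously_differentiable_on k S f" "continuously_differentiable_on k T g"
  shows "continuously_differentiable_on k S (\<lambda>x. g (f x))"
  using assms(4,5)
proof (induction k arbitrary: g)
  case 0
  then show ?case using assms(3) by (auto intro: continuous_on_compose2)
next
  case (Suc k)
  have fT: "f x \<in> T" if "x \<in> S" for x using assms(3) that by auto
  show ?case
  proof (rule continuously_differentiable_on_SucI[OF S])
    show "((\<lambda>x. g (f x)) has_derivative
        (\<lambda>v. \<Sum>i\<in>I. (frechet_derivative f (at x) v \<bullet> b i) *\<^sub>R frechet_derivative g (at (f x)) (b i))) (at x)"
      if x: "x \<in> S" for x
    proof -
      have g: "(g has_derivative frechet_derivative g (at (f x))) (at (f x))"
        using Suc.prems(2) fT[OF x] by (rule continuously_differentiable_on_Suc_has_derivative)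
      then interpret g: bounded_linear "frechet_derivative g (at (f x))"
        by (rule has_derivative_bounded_linear)
      have eq: "frechet_derivative g (at (f x)) w = (\<Sum>i\<in>I. (w \<bullet> b i) *\<^sub>R frechet_derivative g (at (f x)) (b i))" for w
      proof -
        have "frechet_derivative g (at (f x)) (\<Sum>i\<in>I. (w \<bullet> b i) *\<^sub>R b i) =
            (\<Sum>i\<in>I. (w \<bullet> b i) *\<^sub>R frechet_derivative g (at (f x)) (b i))"
          by (simp add: g.sum g.scaleR)
        then show ?thesis by (simp only: frame)
      qed
      show ?thesis
        by (rule has_derivative_eq_rhs[OF has_derivative_compose[OF
                continuously_differentiable_on_Suc_has_derivative[OF Suc.prems(1) x] g]])
          (rule ext, rule eq)
    qed
    show "continuously_differentiable_on k S
        (\<lambda>x. \<Sum>i\<in>I. (frechet_derivative f (at x) v \<bullet> b i) *\<^sub>R frechet_derivative g (at (f x)) (b i))" for v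
    proof (intro continuously_differentiable_on_sum S
        continuously_differentiable_on_bilinear[OF bounded_bilinear_scaleR])
      show "continuously_differentiable_on k S (\<lambda>x. frechet_derivative f (at x) v \<bullet> b i)" for i
        using Suc.prems(1) S
        by (intro continuously_differentiable_on_bounded_linear[OF bounded_linear_inner_left]) auto
      \<comment> \<open>The outer function changes to the derivative of \<open>g\<close> in
        direction \<open>b i\<close>, while \<open>f\<close> stays the same; this is why the
        induction generalises \<open>g\<close> alone.\<close>
      show "continuously_differentiable_on k S (\<lambda>x. frechet_derivative g (at (f x)) (b i))" for i
        by (rule Suc.IH[OF continuously_differentiable_on_SucD[OF Suc.prems(1)],
              where g = "\<lambda>y. frechet_derivative g (at y) (b i)"]) (use Suc.prems(2) in auto)
    qed
  qed
qed

section \<open>Smooth functions between normed spaces\<close>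

lemma smooth_on_cong:
  "open S \<Longrightarrow> (\<And>x. x \<in> S \<Longrightarrow> f x = g x) \<Longrightarrow> smooth_on S f \<longleftrightarrow> smooth_on S g"
  unfolding smooth_on_def using continuously_differentiable_on_cong by blast

lemma smooth_on_subset: "smooth_on S f \<Longrightarrow> T \<subseteq> S \<Longrightarrow> smooth_on T f"
  unfolding smooth_on_def using continuously_differentiable_on_subset by blast

lemma smooth_on_local:
  assumes "\<And>x. x \<in> S \<Longrightarrow> \<exists>T. open T \<and> x \<in> T \<and> smooth_on T f"
  shows "smooth_on S f"
  unfolding smooth_on_def
proof
  show "continuously_differentiable_on k S f" for k
    by (rule continuously_differentiable_on_local) (use assms in \<open>force simp: smooth_on_def\<close>)
qed

lemma smooth_on_continuous: "smooth_on S f \<Longrightarrow> continuous_on S f"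
  unfolding smooth_on_def using continuously_differentiable_on.simps(1) by blast

lemma smooth_on_const: "smooth_on S (\<lambda>x. c)"
  by (simp add: smooth_on_def continuously_differentiable_on_const)

lemma smooth_on_ident: "smooth_on S (\<lambda>x. x)"
  by (simp add: smooth_on_def continuously_differentiable_on_ident)

lemma smooth_on_bounded_linear:
  "bounded_linear L \<Longrightarrow> open S \<Longrightarrow> smooth_on S f \<Longrightarrow> smooth_on S (\<lambda>x. L (f x))"
  by (simp add: smooth_on_def continuously_differentiable_on_bounded_linear)

lemma smooth_on_add:
  "open S \<Longrightarrow> smooth_on S f \<Longrightarrow> smooth_on S g \<Longrightarrow> smooth_on S (\<lambda>x. f x + g x)"
  by (simp add: smooth_on_def continuously_differentiable_on_add)

lemma smooth_on_bilinear:
  "bounded_bilinear B \<Longrightarrow> open S \<Longrightarrow> smooth_on S f \<Longrightarrow> smooth_on S g \<Longrightarrow>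
    smooth_on S (\<lambda>x. B (f x) (g x))"
  by (simp add: smooth_on_def continuously_differentiable_on_bilinear)

lemma smooth_on_inverse:
  fixes f :: "'a::real_normed_vector \<Rightarrow> 'b::real_normed_div_algebra"
  shows "open S \<Longrightarrow> smooth_on S f \<Longrightarrow> (\<And>x. x \<in> S \<Longrightarrow> f x \<noteq> 0) \<Longrightarrow> smooth_on S (\<lambda>x. inverse (f x))"
  by (simp add: smooth_on_def continuously_differentiable_on_inverse)

lemma smooth_on_compose:
  fixes f :: "'a::real_normed_vector \<Rightarrow> 'b::real_inner" and b :: "'i \<Rightarrow> 'b"
  assumes "\<And>y. (\<Sum>i\<in>I. (y \<bullet> b i) *\<^sub>R b i) = y"
    and "open S" "f ` S \<subseteq> T" "smooth_on S f" "smooth_on T g"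
  shows "smooth_on S (\<lambda>x. g (f x))"
  using assms(4,5) continuously_differentiable_on_compose[OF assms(1-3)] unfolding smooth_on_def by blast

lemma smooth_on_compose_real:
  fixes f :: "'a::real_normed_vector \<Rightarrow> real"
  assumes "open S" "smooth_on S f" "smooth_on UNIV g"
  shows "smooth_on S (\<lambda>x. g (f x))"
  by (rule smooth_on_compose[where I = "{0::nat}" and b = "\<lambda>_. 1" and T = UNIV]) (use assms in auto)

text \<open>The functions $t^{-m} e^{-1/t}$, extended by $0$ to $t \le 0$: their span is closed under
  differentiation, hence the induction over all \<open>m\<close> at once in \<open>smooth_on_flat\<close>.\<close>

definition flat :: "nat \<Rightarrow> real \<Rightarrow> real" where
  "flat m t = (if t \<le> 0 then 0 else inverse t ^ m * exp (- inverse t))"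

text \<open>From the right, with \<open>s = 1 / t\<close>, this is the decay of
  \<open>s ^ m * exp (- s)\<close> at infinity; from the left the function is constantly 0.\<close>

lemma flat_tendsto_0: "(flat m \<longlongrightarrow> 0) (at 0)"
proof -
  have "((\<lambda>t. inverse t ^ m / exp (inverse t)) \<longlongrightarrow> 0) (at_right (0::real))"
    by (rule filterlim_compose[OF tendsto_power_div_exp_0 filterlim_inverse_at_top_right])
  then have "(flat m \<longlongrightarrow> 0) (at_right 0)"
    by (rule Lim_transform_eventually) (auto simp: flat_def eventually_at_filter exp_minus divide_inverse)
  moreover have "(flat m \<longlongrightarrow> 0) (at_left 0)"
    by (rule Lim_transform_eventually[OF tendsto_const]) (auto simp: flat_def eventually_at_filter)
  ultimately show ?thesis by (simp add: filterlim_split_at)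
qed

lemma flat_has_derivative:
  "(flat m has_real_derivative flat (m + 2) t - real m * flat (m + 1) t) (at t)"
proof -
  consider "t < 0" | "t = 0" | "t > 0" by linarith
  then show ?thesis
  proof cases
    case 1
    have "((\<lambda>t. 0) has_real_derivative 0) (at t)" by simp
    then have "(flat m has_real_derivative 0) (at t)"
      by (rule has_field_derivative_transform_within_open[of _ _ _ "{..<0}"])
        (use 1 in \<open>auto simp: flat_def\<close>)
    then show ?thesis using 1 by (simp add: flat_def)
  next
    case 2
    \<comment> \<open>For \<open>h \<noteq> 0\<close> the difference quotient at 0 is
      \<open>flat (Suc m) h\<close>, so the same limit for the next index gives the
      derivative.\<close>
    have "((\<lambda>h. (flat m (0 + h) - flat m 0) / h) \<longlongrightarrow> 0) (at 0)"
      by (rule Lim_transform_eventually[OF flat_tendsto_0[of "Suc m"]])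
        (auto simp: flat_def eventually_at_filter field_simps)
    then show ?thesis using 2 by (simp add: DERIV_def flat_def)
  next
    case 3
    have "(inverse has_real_derivative - (inverse t)\<^sup>2) (at t)"
      using 3 DERIV_inverse[of t] by (simp add: power2_eq_square)
    from DERIV_power[OF this, of m]
    have power: "((\<lambda>t. inverse t ^ m) has_real_derivative - (real m * inverse t ^ (m + 1))) (at t)"
      by (rule DERIV_cong) (cases m, simp_all add: power2_eq_square)
    have "((\<lambda>t. exp (- inverse t)) has_real_derivative exp (- inverse t) * (inverse t)\<^sup>2) (at t)"
      using 3 by (auto intro!: derivative_eq_intros simp: power2_eq_square)
    from DERIV_mult[OF power this]
    have "((\<lambda>t. inverse t ^ m * exp (- inverse t)) has_real_derivative
        flat (m + 2) t - real m * flat (m + 1) t) (at t)"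
      by (rule DERIV_cong) (use 3 in \<open>simp add: flat_def algebra_simps power2_eq_square\<close>)
    then show ?thesis
      by (rule has_field_derivative_transform_within_open[of _ _ _ "{0<..}"])
        (use 3 in \<open>auto simp: flat_def\<close>)
  qed
qed

lemma smooth_on_flat: "smooth_on UNIV (flat m)"
proof -
  have "continuously_differentiable_on k UNIV (flat m)" for k
  proof (induction k arbitrary: m)
    case 0
    then show ?case
      using flat_has_derivative[of m] by (auto intro!: continuous_at_imp_continuous_on DERIV_isCont)
  next
    case (Suc k)
    have "(flat m has_derivative (\<lambda>v. flat (m + 2) t * v + (- real m * v) * flat (m + 1) t)) (at t)" for t
      using flat_has_derivative[of m t] unfolding has_field_derivative_def
      by (rule has_derivative_eq_rhs) (auto simp: algebra_simps)
    then show ?case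
      by (rule continuously_differentiable_on_SucI[OF open_UNIV])
        (intro continuously_differentiable_on_add open_UNIV Suc.IH continuously_differentiable_on_const
          continuously_differentiable_on_bilinear[OF bounded_bilinear_mult])
  qed
  then show ?thesis by (simp add: smooth_on_def)
qed

text \<open>The quotient \<open>a / (a + b)\<close> with \<open>a = flat 0 (4 * r^2 - d)\<close> and
  \<open>b = flat 0 (d - r^2)\<close>. The squared distance \<open>d\<close> from \<open>p\<close>
  is used because it is smooth everywhere, being an inner product. Up to distance \<open>r\<close>
  the term \<open>b\<close> vanishes, from distance \<open>2 * r\<close> on \<open>a\<close> does,
  and the denominator is always positive because \<open>r^2 < 4 * r^2\<close>.\<close>

lemma smooth_bump_exists:
  fixes p :: "'e::real_inner"
  assumes "r > 0"
  shows "\<exists>\<psi>::'e \<Rightarrow> real. smooth_on UNIV \<psi> \<and> (\<forall>y. dist y p \<le> r \<longrightarrow> \<psi> y = 1) \<and>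
    (\<forall>y. dist y p \<ge> 2 * r \<longrightarrow> \<psi> y = 0)"
proof -
  define d where "d y = (y - p) \<bullet> (y - p)" for y
  have d: "d y = (dist y p)\<^sup>2" for y
    by (simp add: d_def dist_norm power2_norm_eq_inner)
  have "smooth_on UNIV (\<lambda>y. y + - p)"
    by (intro smooth_on_add smooth_on_ident smooth_on_const open_UNIV)
  then have smooth_d: "smooth_on UNIV d"
    unfolding d_def by (intro smooth_on_bilinear[OF bounded_bilinear_inner] open_UNIV) simp_all
  have "smooth_on UNIV (\<lambda>y. - d y)"
    by (rule smooth_on_bounded_linear[OF bounded_linear_minus[OF bounded_linear_ident] open_UNIV smooth_d])
  then have "smooth_on UNIV (\<lambda>y. 4 * r\<^sup>2 + - d y)"
    by (rule smooth_on_add[OF open_UNIV smooth_on_const])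
  then have a: "smooth_on UNIV (\<lambda>y. flat 0 (4 * r\<^sup>2 + - d y))"
    by (rule smooth_on_compose_real[OF open_UNIV _ smooth_on_flat])
  have b: "smooth_on UNIV (\<lambda>y. flat 0 (d y + - r\<^sup>2))"
    by (rule smooth_on_compose_real[OF open_UNIV smooth_on_add[OF open_UNIV smooth_d smooth_on_const]
          smooth_on_flat])
  define \<psi> where "\<psi> y = flat 0 (4 * r\<^sup>2 + - d y) *
    inverse (flat 0 (4 * r\<^sup>2 + - d y) + flat 0 (d y + - r\<^sup>2))" for y
  have pos: "flat 0 (4 * r\<^sup>2 + - d y) + flat 0 (d y + - r\<^sup>2) > 0" for y
  proof -
    have nonneg: "flat 0 t \<ge> 0" and pos: "t > 0 \<Longrightarrow> flat 0 t > 0" for t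
      by (simp_all add: flat_def)
    have "r\<^sup>2 > 0" using assms by simp
    then have "4 * r\<^sup>2 + - d y > 0 \<or> d y + - r\<^sup>2 > 0" by linarith
    then show ?thesis
      using nonneg pos add_pos_nonneg add_nonneg_pos by blast
  qed
  have "smooth_on UNIV \<psi>"
    unfolding \<psi>_def
  proof (rule smooth_on_bilinear[OF bounded_bilinear_mult open_UNIV a])
    show "smooth_on UNIV (\<lambda>y. inverse (flat 0 (4 * r\<^sup>2 + - d y) + flat 0 (d y + - r\<^sup>2)))"
      by (rule smooth_on_inverse[OF open_UNIV smooth_on_add[OF open_UNIV a b]])
        (rule less_imp_neq[OF pos, symmetric])
  qed
  moreover have "\<psi> y = 1" if "dist y p \<le> r" for y
  proof -
    have "d y \<le> r\<^sup>2" unfolding d using that by (intro power_mono) auto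
    then have "flat 0 (d y + - r\<^sup>2) = 0" by (simp add: flat_def)
    then show ?thesis using pos[of y] by (simp add: \<psi>_def)
  qed
  moreover have "\<psi> y = 0" if "dist y p \<ge> 2 * r" for y
  proof -
    have "(2 * r)\<^sup>2 \<le> d y" unfolding d using that assms by (intro power_mono) auto
    then show ?thesis by (simp add: \<psi>_def flat_def power_mult_distrib)
  qed
  ultimately show ?thesis by blast
qed

section \<open>Smooth functions on a manifold\<close>

lemma frechet_derivative_cong:
  assumes "open S" "x \<in> S" "\<And>y. y \<in> S \<Longrightarrow> f y = g y"
  shows "frechet_derivative f (at x) = frechet_derivative g (at x)"
proof -
  have "(f has_derivative D) (at x) \<longleftrightarrow> (g has_derivative D) (at x)" for D
  proof
    show "(f has_derivative D) (at x) \<Longrightarrow> (g has_derivative D) (at x)"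
      by (rule has_derivative_transform_within_open[OF _ assms])
    show "(g has_derivative D) (at x) \<Longrightarrow> (f has_derivative D) (at x)"
      by (rule has_derivative_transform_within_open[OF _ assms(1,2) assms(3)[symmetric]])
  qed
  then show ?thesis by (simp only: frechet_derivative_def)
qed

lemma directional_derivative_apply:
  "directional_derivative v F y = frechet_derivative F (at y) v"
  by (simp add: directional_derivative_def)

text \<open>Agreement at the single point \<open>y\<close> would not survive one differentiation;
  agreement on the open set \<open>S\<close> survives all of them and is the invariant of both
  inductions.\<close>

lemma fold_directional_derivative_cong:
  assumes "open S" "\<And>y. y \<in> S \<Longrightarrow> F y = G y" "y \<in> S"
  shows "fold (\<lambda>i. directional_derivative (b i) ^^ \<alpha> i) is F y =
    fold (\<lambda>i. directional_derivative (b i) ^^ \<alpha> i) is G y"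
proof -
  have funpow: "(directional_derivative v ^^ n) F y = (directional_derivative v ^^ n) G y"
    if "\<And>y. y \<in> S \<Longrightarrow> F y = G y" "y \<in> S" for v n y and F G :: "'a \<Rightarrow> 'b"
    using that(2)
  proof (induction n arbitrary: y)
    case 0
    then show ?case by (simp add: that(1))
  next
    case (Suc n)
    have "frechet_derivative ((directional_derivative v ^^ n) F) (at y) =
        frechet_derivative ((directional_derivative v ^^ n) G) (at y)"
      by (rule frechet_derivative_cong[OF assms(1) Suc.prems Suc.IH])
    then show ?case
      by (simp only: funpow.simps o_apply
          directional_derivative_apply[of v "(directional_derivative v ^^ n) F" y]
          directional_derivative_apply[of v "(directional_derivative v ^^ n) G" y])
  qed
  show ?thesis
    using assms(2,3)
  proof (induction "is" arbitrary: F G)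
    case Nil
    then show ?case by simp
  next
    case (Cons i "is")
    show ?case
      using Cons.IH[OF funpow Cons.prems(2), OF Cons.prems(1)] by simp
  qed
qed

text \<open>The model space is merely an inner product space, so compact sets are built by hand: a
  sum of \<open>n\<close> compact segments, added one at a time.\<close>

lemma compact_bounded_combinations:
  fixes b :: "nat \<Rightarrow> 'e::real_normed_vector"
  shows "\<exists>K. compact K \<and> (\<forall>t. (\<forall>i<n. \<bar>t i\<bar> \<le> r) \<longrightarrow> (\<Sum>i<n. t i *\<^sub>R b i) \<in> K)"
proof (induction n)
  case 0
  have "compact {0::'e}" by simp
  then show ?case by auto
next
  case (Suc n)
  then obtain K where K: "compact K" "\<And>t. (\<forall>i<n. \<bar>t i\<bar> \<le> r) \<Longrightarrow> (\<Sum>i<n. t i *\<^sub>R b i) \<in> K"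
    by blast
  have "compact ((\<lambda>s. s *\<^sub>R b n) ` {- r..r})"
    by (intro compact_continuous_image continuous_intros compact_Icc)
  from compact_sums[OF K(1) this]
  have "compact {x + y | x y. x \<in> K \<and> y \<in> (\<lambda>s. s *\<^sub>R b n) ` {- r..r}}" .
  moreover have "(\<Sum>i<Suc n. t i *\<^sub>R b i) \<in> {x + y | x y. x \<in> K \<and> y \<in> (\<lambda>s. s *\<^sub>R b n) ` {- r..r}}"
    if t: "\<forall>i<Suc n. \<bar>t i\<bar> \<le> r" for t
  proof -
    have "(\<Sum>i<n. t i *\<^sub>R b i) \<in> K" using t by (intro K(2)) auto
    moreover have "t n *\<^sub>R b n \<in> (\<lambda>s. s *\<^sub>R b n) ` {- r..r}"
      using t by (intro imageI) (auto simp: abs_le_iff minus_le_iff)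
    ultimately show ?thesis by auto
  qed
  ultimately show ?case by blast
qed

locale manifold_setting =
  fixes M :: "('x::{t2_space,second_countable_topology}, 'e::real_inner) manifold"
  assumes M: "smooth_manifold M"
begin

text \<open>Both sides are linear in \<open>y\<close> and agree on the frame, which spans. In this
  form the frame enters the chain rule and the compactness of balls.\<close>

lemma frame_expansion: "(\<Sum>i<mdim M. (y \<bullet> frame M i) *\<^sub>R frame M i) = y"
proof -
  have orth: "frame M i \<bullet> frame M j = (if i = j then 1 else 0)" if "i < mdim M" "j < mdim M" for i j
    using M that unfolding smooth_manifold_def by blast
  have "y \<in> span (frame M ` {..<mdim M})"
    using M unfolding smooth_manifold_def by blast
  then show ?thesis
  proof (induction rule: span_induct_alt)
    case base
    then show ?case by simp
  next
    case (step c x y)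
    then obtain j where j: "j < mdim M" "x = frame M j" by auto
    have "(\<Sum>i<mdim M. (x \<bullet> frame M i) *\<^sub>R frame M i) = (\<Sum>i<mdim M. if i = j then frame M i else 0)"
      using j orth by (intro sum.cong) auto
    also have "\<dots> = x" using j by simp
    finally have "(\<Sum>i<mdim M. (x \<bullet> frame M i) *\<^sub>R frame M i) = x" .
    then show ?case
      using step.IH by (simp add: inner_add_left scaleR_add_left sum.distrib
          flip: scaleR_scaleR scaleR_sum_right)
  qed
qed

text \<open>By Cauchy-Schwarz the frame coordinates of a point in the ball around 0 are bounded by
  \<open>r\<close>, so this ball is a closed subset of a compact set. It is needed to make the
  region outside which a bump function vanishes compact.\<close>

lemma compact_cball_model: "compact (cball (p::'e) r)"
proof -
  obtain K where K: "compact K"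
    "\<And>t. (\<forall>i<mdim M. \<bar>t i\<bar> \<le> r) \<Longrightarrow> (\<Sum>i<mdim M. t i *\<^sub>R frame M i) \<in> K"
    using compact_bounded_combinations[of "mdim M" r "frame M"] by blast
  have "cball 0 r \<subseteq> K"
  proof
    fix y :: 'e assume y: "y \<in> cball 0 r"
    have "\<bar>y \<bullet> frame M i\<bar> \<le> r" if "i < mdim M" for i
    proof -
      have "frame M i \<bullet> frame M i = 1" using M that unfolding smooth_manifold_def by simp
      then have "norm (frame M i) = 1" by (simp add: norm_eq_sqrt_inner)
      then show ?thesis using Cauchy_Schwarz_ineq2[of y "frame M i"] y by (simp add: dist_norm)
    qed
    then have "(\<Sum>i<mdim M. (y \<bullet> frame M i) *\<^sub>R frame M i) \<in> K" by (intro K(2)) blast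
    then show "y \<in> K" by (simp only: frame_expansion)
  qed
  then have "cball 0 r = K \<inter> cball 0 r" by blast
  then have "compact (cball (0::'e) r)"
    using compact_Int_closed[OF K(1) closed_cball] by metis
  then have "compact ((+) p ` cball 0 r)" by (rule compact_translation)
  then show ?thesis by simp
qed

lemma atlas_chart:
  assumes "c \<in> atlas M"
  shows "open (fst c)" "open (snd c ` fst c)"
    "homeomorphism (fst c) (snd c ` fst c) (snd c) (inv_into (fst c) (snd c))"
proof -
  have "chart c" using M assms unfolding smooth_manifold_def by blast
  then show "open (fst c)" "open (snd c ` fst c)"
    "homeomorphism (fst c) (snd c ` fst c) (snd c) (inv_into (fst c) (snd c))"
    by (simp_all add: chart_def split_beta)
qed

lemma inv_into_chart:
  "c \<in> atlas M \<Longrightarrow> x \<in> fst c \<Longrightarrow> inv_into (fst c) (snd c) (snd c x) = x"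
  using atlas_chart(3) by (auto simp: homeomorphism_def)

lemma in_chart_apply: "c \<in> atlas M \<Longrightarrow> x \<in> fst c \<Longrightarrow> in_chart c f (snd c x) = f x"
  by (simp add: in_chart_def inv_into_chart)

section \<open>Shrinking charts to open subsets\<close>

lemma open_chart_image:
  assumes "c \<in> atlas M" "open V"
  shows "open (snd c ` (fst c \<inter> V))"
proof -
  have "openin (top_of_set (fst c)) (fst c \<inter> V)"
    using assms(2) by (rule openin_open_Int)
  then have "openin (top_of_set (snd c ` fst c)) (snd c ` (fst c \<inter> V))"
    by (rule homeomorphism_imp_open_map[OF atlas_chart(3)[OF assms(1)]])
  then show ?thesis
    using openin_open_trans atlas_chart(2)[OF assms(1)] by blast
qed

lemma atlas_compatible: "c \<in> atlas M \<Longrightarrow> d \<in> atlas M \<Longrightarrow> compatible c d"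
  using M unfolding smooth_manifold_def by blast

text \<open>\<open>inv_into\<close> depends on the domain, so shrinking a chart may change the local
  representative as a function; on the image of the smaller domain nothing changes.\<close>

lemma in_chart_restrict_chart:
  assumes "c \<in> atlas M" "y \<in> snd c ` (fst c \<inter> V)"
  shows "in_chart (fst c \<inter> V, snd c) f y = in_chart c f y"
proof -
  obtain x where x: "x \<in> fst c" "x \<in> V" "y = snd c x" using assms(2) by blast
  have "inj_on (snd c) (fst c \<inter> V)"
    using inv_into_chart[OF assms(1)] by (metis IntD1 inj_onI)
  then have "inv_into (fst c \<inter> V) (snd c) y = x"
    using x by simp
  then show ?thesis using assms(1) x by (simp add: in_chart_def inv_into_chart)
qed

text \<open>The shrunk chart is still compatible with every chart, so maximality of the atlas admits
  it. Thus every open set is covered by the charts inside it, and smoothness there is a real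
  condition at each point.\<close>

lemma restrict_chart_atlas:
  assumes c: "c \<in> atlas M" and V: "open V"
  shows "(fst c \<inter> V, snd c) \<in> atlas M"
proof -
  let ?c = "(fst c \<inter> V, snd c)"
  have inv_eq: "inv_into (fst c \<inter> V) (snd c) y = inv_into (fst c) (snd c) y"
    if "y \<in> snd c ` (fst c \<inter> V)" for y
    using in_chart_restrict_chart[OF c that, of "\<lambda>x. x"] by (simp add: in_chart_def)
  have "homeomorphism (fst c \<inter> V) (snd c ` (fst c \<inter> V)) (snd c) (inv_into (fst c) (snd c))"
    by (rule homeomorphism_of_subsets[OF atlas_chart(3)[OF c], where T'' = "snd c ` (fst c \<inter> V)"]) auto
  then have "homeomorphism (fst c \<inter> V) (snd c ` (fst c \<inter> V)) (snd c) (inv_into (fst c \<inter> V) (snd c))"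
    by (rule homeomorphism_cong) (use inv_eq in auto)
  then have "chart ?c"
    using open_chart_image[OF c V] atlas_chart(1)[OF c] V by (simp add: chart_def open_Int)
  moreover have "compatible ?c d" if d: "d \<in> atlas M" for d
  proof -
    have 1: "smooth_on (snd c ` (fst c \<inter> fst d)) (in_chart c (snd d))"
      and 2: "smooth_on (snd d ` (fst c \<inter> fst d)) (in_chart d (snd c))"
      using atlas_compatible[OF c d] by (simp_all add: compatible_def)
    have "open (snd c ` (fst c \<inter> (V \<inter> fst d)))"
      using V atlas_chart(1)[OF d] by (intro open_chart_image c open_Int)
    then have op: "open (snd c ` (fst c \<inter> V \<inter> fst d))" by (simp add: Int_assoc)
    have "smooth_on (snd c ` (fst c \<inter> V \<inter> fst d)) (in_chart c (snd d))"
      by (rule smooth_on_subset[OF 1]) auto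
    then have "smooth_on (snd c ` (fst c \<inter> V \<inter> fst d)) (in_chart ?c (snd d))"
      by (subst smooth_on_cong[OF op in_chart_restrict_chart[OF c]]) auto
    moreover have "smooth_on (snd d ` (fst c \<inter> V \<inter> fst d)) (in_chart d (snd c))"
      by (rule smooth_on_subset[OF 2]) auto
    ultimately show ?thesis by (simp add: compatible_def)
  qed
  moreover have "\<And>c. chart c \<and> (\<forall>d\<in>atlas M. compatible c d) \<Longrightarrow> c \<in> atlas M"
    using M unfolding smooth_manifold_def by blast
  ultimately show ?thesis by blast
qed

lemma charts_inD: "c \<in> charts_in M U \<Longrightarrow> c \<in> atlas M" "c \<in> charts_in M U \<Longrightarrow> fst c \<subseteq> U"
  by (simp_all add: charts_in_def)

lemma restrict_chart_charts_in:
  "c \<in> atlas M \<Longrightarrow> open V \<Longrightarrow> (fst c \<inter> V, snd c) \<in> charts_in M V"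
  by (simp add: charts_in_def restrict_chart_atlas)

lemma chart_at:
  assumes "open U" "x \<in> U"
  obtains c where "c \<in> charts_in M U" "x \<in> fst c"
proof -
  have "(\<Union>c\<in>atlas M. fst c) = UNIV" using M unfolding smooth_manifold_def by blast
  then obtain c where "c \<in> atlas M" "x \<in> fst c" by blast
  then show ?thesis
    using that[of "(fst c \<inter> U, snd c)"] restrict_chart_charts_in assms by simp
qed

lemma open_charts_in_image: "c \<in> charts_in M U \<Longrightarrow> open (snd c ` fst c)"
  using atlas_chart(2) charts_inD(1) by blast

section \<open>Gluing and pointwise operations\<close>

lemma smooth_functions_in_chart:
  "f \<in> smooth_functions M U \<Longrightarrow> c \<in> charts_in M U \<Longrightarrow> smooth_on (snd c ` fst c) (in_chart c f)"
  by (simp add: smooth_functions_def)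

text \<open>The gluing half of the sheaf property, with \<open>g\<close> allowed to vary with the
  point. It certifies functions that are defined by cases or by choices made separately at each
  point.\<close>

lemma smooth_functionsI_local:
  assumes ext: "f \<in> extensional U"
    and loc: "\<And>x. x \<in> U \<Longrightarrow> \<exists>V. open V \<and> x \<in> V \<and> (\<exists>g\<in>smooth_functions M V. \<forall>y\<in>U \<inter> V. f y = g y)"
  shows "f \<in> smooth_functions M U"
  unfolding smooth_functions_def
proof (intro CollectI conjI ext ballI smooth_on_local)
  fix c y assume c: "c \<in> charts_in M U" and "y \<in> snd c ` fst c"
  then obtain x where x: "x \<in> fst c" "y = snd c x" by blast
  note cM = charts_inD(1)[OF c]
  have "x \<in> U" using charts_inD(2)[OF c] x(1) by blast
  from loc[OF this] obtain V g where V: "open V" "x \<in> V"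
    and g: "g \<in> smooth_functions M V" "\<forall>y\<in>U \<inter> V. f y = g y"
    by (elim exE conjE bexE)
  have eq: "in_chart (fst c \<inter> V, snd c) g z = in_chart c f z" if z: "z \<in> snd c ` (fst c \<inter> V)" for z
  proof -
    obtain w where w: "w \<in> fst c" "w \<in> V" "z = snd c w" using z by blast
    then have "f w = g w" using charts_inD(2)[OF c] g(2) by blast
    then show ?thesis
      unfolding in_chart_restrict_chart[OF cM z] by (simp add: w in_chart_apply cM)
  qed
  have "smooth_on (snd c ` (fst c \<inter> V)) (in_chart (fst c \<inter> V, snd c) g)"
    using smooth_functions_in_chart[OF g(1) restrict_chart_charts_in[OF cM V(1)]] by simp
  moreover have "smooth_on (snd c ` (fst c \<inter> V)) (in_chart (fst c \<inter> V, snd c) g) \<longleftrightarrow>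
      smooth_on (snd c ` (fst c \<inter> V)) (in_chart c f)"
    by (rule smooth_on_cong[OF open_chart_image[OF cM V(1)] eq])
  ultimately have "smooth_on (snd c ` (fst c \<inter> V)) (in_chart c f)"
    by (simp only:)
  then show "\<exists>T. open T \<and> y \<in> T \<and> smooth_on T (in_chart c f)"
    using open_chart_image[OF cM V(1)] x V(2) by blast
qed

lemma smooth_functions_extensional: "f \<in> smooth_functions M U \<Longrightarrow> f \<in> extensional U"
  by (simp add: smooth_functions_def)

text \<open>Any smooth expression \<open>F\<close> in the coordinates may be offered, so the closure
  proofs below need not compute \<open>in_chart\<close> of a restricted function.\<close>

lemma smooth_functionsI:
  assumes "\<And>c. c \<in> charts_in M U \<Longrightarrow> \<exists>F. smooth_on (snd c ` fst c) F \<and> (\<forall>x\<in>fst c. F (snd c x) = f x)"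
  shows "restrict f U \<in> smooth_functions M U"
  unfolding smooth_functions_def
proof (intro CollectI conjI restrict_extensional ballI)
  fix c assume c: "c \<in> charts_in M U"
  then obtain F where F: "smooth_on (snd c ` fst c) F" "\<forall>x\<in>fst c. F (snd c x) = f x"
    using assms by blast
  have "in_chart c (restrict f U) y = F y" if "y \<in> snd c ` fst c" for y
    using that F(2) charts_inD[OF c] by (auto simp: in_chart_apply)
  then show "smooth_on (snd c ` fst c) (in_chart c (restrict f U))"
    using F(1) smooth_on_cong[OF open_charts_in_image[OF c]] by blast
qed

lemma smooth_functions_restrict:
  assumes "f \<in> smooth_functions M U" "V \<subseteq> U"
  shows "restrict f V \<in> smooth_functions M V"
proof (rule smooth_functionsI)
  fix c assume "c \<in> charts_in M V"
  then have "c \<in> charts_in M U" using assms(2) by (auto simp: charts_in_def)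
  then show "\<exists>F. smooth_on (snd c ` fst c) F \<and> (\<forall>x\<in>fst c. F (snd c x) = f x)"
    using smooth_functions_in_chart[OF assms(1)] charts_inD(1) in_chart_apply by blast
qed

lemma smooth_functions_const: "(\<lambda>x\<in>U. a) \<in> smooth_functions M U"
  by (rule smooth_functionsI) (use smooth_on_const in blast)

lemma smooth_functions_add:
  assumes "f \<in> smooth_functions M U" "g \<in> smooth_functions M U"
  shows "(\<lambda>x\<in>U. f x + g x) \<in> smooth_functions M U"
proof (rule smooth_functionsI)
  fix c assume c: "c \<in> charts_in M U"
  show "\<exists>F. smooth_on (snd c ` fst c) F \<and> (\<forall>x\<in>fst c. F (snd c x) = f x + g x)"
    by (rule exI[of _ "\<lambda>y. in_chart c f y + in_chart c g y"])
      (simp add: smooth_on_add open_charts_in_image[OF c] smooth_functions_in_chart[OF _ c] assms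
        in_chart_apply charts_inD(1)[OF c])
qed

lemma smooth_functions_mult:
  fixes f g :: "'x \<Rightarrow> 'b::real_normed_algebra"
  assumes "f \<in> smooth_functions M U" "g \<in> smooth_functions M U"
  shows "(\<lambda>x\<in>U. f x * g x) \<in> smooth_functions M U"
proof (rule smooth_functionsI)
  fix c assume c: "c \<in> charts_in M U"
  show "\<exists>F. smooth_on (snd c ` fst c) F \<and> (\<forall>x\<in>fst c. F (snd c x) = f x * g x)"
    by (rule exI[of _ "\<lambda>y. in_chart c f y * in_chart c g y"])
      (simp add: smooth_on_bilinear[OF bounded_bilinear_mult] open_charts_in_image[OF c]
        smooth_functions_in_chart[OF _ c] assms in_chart_apply charts_inD(1)[OF c])
qed

lemma smooth_functions_inverse:
  fixes f :: "'x \<Rightarrow> 'b::real_normed_div_algebra"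
  assumes "f \<in> smooth_functions M U" and nz: "\<And>x. x \<in> U \<Longrightarrow> f x \<noteq> 0"
  shows "(\<lambda>x\<in>U. inverse (f x)) \<in> smooth_functions M U"
proof (rule smooth_functionsI)
  fix c assume c: "c \<in> charts_in M U"
  have "in_chart c f y \<noteq> 0" if "y \<in> snd c ` fst c" for y
    using that nz charts_inD[OF c] by (auto simp: in_chart_apply)
  then show "\<exists>F. smooth_on (snd c ` fst c) F \<and> (\<forall>x\<in>fst c. F (snd c x) = inverse (f x))"
    by (intro exI[of _ "\<lambda>y. inverse (in_chart c f y)"])
      (simp add: smooth_on_inverse open_charts_in_image[OF c]
        smooth_functions_in_chart[OF _ c] assms in_chart_apply charts_inD(1)[OF c])
qed

lemma smooth_functions_sum:
  assumes "\<And>i. i \<in> I \<Longrightarrow> f i \<in> smooth_functions M U"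
  shows "(\<lambda>x\<in>U. \<Sum>i\<in>I. f i x) \<in> smooth_functions M U"
  using assms
proof (induction I rule: infinite_finite_induct)
  case (insert i I)
  then have "(\<lambda>x\<in>U. f i x + (\<lambda>x\<in>U. \<Sum>i\<in>I. f i x) x) \<in> smooth_functions M U"
    by (intro smooth_functions_add) auto
  moreover have "(\<lambda>x\<in>U. f i x + (\<lambda>x\<in>U. \<Sum>i\<in>I. f i x) x) = (\<lambda>x\<in>U. \<Sum>i\<in>insert i I. f i x)"
    using insert by (intro restrict_ext) simp
  ultimately show ?case by (simp only:)
qed (simp_all add: smooth_functions_const)

lemma smooth_functions_continuous:
  assumes f: "f \<in> smooth_functions M U" and "open U"
  shows "continuous_on U f"
proof (rule continuous_at_imp_continuous_on, rule ballI)
  fix x assume "x \<in> U"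
  then obtain c where c: "c \<in> charts_in M U" "x \<in> fst c" using chart_at assms(2) by blast
  note cM = charts_inD(1)[OF c(1)]
  have "continuous_on (fst c) (\<lambda>z. in_chart c f (snd c z))"
    by (rule continuous_on_compose2[OF smooth_on_continuous[OF smooth_functions_in_chart[OF f c(1)]]])
      (use atlas_chart(3)[OF cM] in \<open>auto simp: homeomorphism_def\<close>)
  then have "continuous_on (fst c) f"
    by (rule continuous_on_eq) (simp add: in_chart_apply cM)
  then show "isCont f x"
    using atlas_chart(1)[OF cM] c(2) by (simp add: continuous_on_eq_continuous_at)
qed

section \<open>Locality of derivatives, bump functions and extension\<close>

lemma chart_derivative_cong:
  assumes c: "c \<in> atlas M" "x \<in> fst c" and V: "open V" "x \<in> V" and eq: "\<And>y. y \<in> V \<Longrightarrow> f y = g y"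
  shows "chart_derivative M c \<alpha> f x = chart_derivative M c \<alpha> g x"
  unfolding chart_derivative_def
  by (rule fold_directional_derivative_cong[OF open_chart_image[OF c(1) V(1)]])
    (use assms in \<open>auto simp: in_chart_apply\<close>)

text \<open>The bump function of the model space is pulled back through a chart inside
  \<open>W\<close>. It vanishes off the compact set \<open>K\<close>, which is closed because the
  space is Hausdorff, so extension by zero is smooth. \<open>A\<close> is the complement of
  \<open>K\<close>; later arguments by cases rely on \<open>A\<close> and \<open>W\<close> being
  open and covering everything.\<close>

lemma bump_function:
  assumes W: "open W" "x0 \<in> W"
  obtains h :: "'x \<Rightarrow> 'b::real_normed_algebra_1" and A V where
    "(h :: 'x \<Rightarrow> 'b) \<in> smooth_functions M UNIV" "open A" "A \<union> W = UNIV" "\<And>x. x \<in> A \<Longrightarrow> h x = 0"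
    "open V" "x0 \<in> V" "V \<subseteq> W" "\<And>x. x \<in> V \<Longrightarrow> h x = 1"
proof -
  obtain c where c: "c \<in> charts_in M W" "x0 \<in> fst c" using chart_at[OF W] by blast
  note cM = charts_inD(1)[OF c(1)]
  let ?U = "fst c" and ?\<phi> = "snd c" and ?\<phi>' = "inv_into (fst c) (snd c)"
  have U: "open ?U" and hom: "homeomorphism ?U (?\<phi> ` ?U) ?\<phi> ?\<phi>'"
    using atlas_chart cM by blast+
  obtain \<epsilon> where \<epsilon>: "\<epsilon> > 0" "ball (?\<phi> x0) \<epsilon> \<subseteq> ?\<phi> ` ?U"
    using atlas_chart(2)[OF cM] c(2) openE by blast
  \<comment> \<open>A third of \<open>\<epsilon>\<close> leaves \<open>2 * r < \<epsilon>\<close>,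
    so the closed ball of radius \<open>2 * r\<close> still lies in the chart image.\<close>
  define r where "r = \<epsilon> / 3"
  have r: "r > 0" "2 * r < \<epsilon>" using \<epsilon>(1) by (simp_all add: r_def)
  have sub: "cball (?\<phi> x0) (2 * r) \<subseteq> ?\<phi> ` ?U"
    using r(2) \<epsilon>(2) by (auto simp: subset_iff)
  obtain \<psi> :: "'e \<Rightarrow> real" where \<psi>: "smooth_on UNIV \<psi>" "\<And>y. dist y (?\<phi> x0) \<le> r \<Longrightarrow> \<psi> y = 1"
    "\<And>y. dist y (?\<phi> x0) \<ge> 2 * r \<Longrightarrow> \<psi> y = 0"
    using smooth_bump_exists[OF r(1), of "?\<phi> x0"] by blast
  define h :: "'x \<Rightarrow> 'b" where "h x = (if x \<in> ?U then of_real (\<psi> (?\<phi> x)) else 0)" for x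
  define K where "K = ?\<phi>' ` cball (?\<phi> x0) (2 * r)"
  define V where "V = ?U \<inter> ?\<phi> -` ball (?\<phi> x0) r"
  have "compact K"
    unfolding K_def using hom sub
    by (intro compact_continuous_image compact_cball_model)
      (auto simp: homeomorphism_def intro: continuous_on_subset)
  then have A: "open (- K)" by (simp add: compact_imp_closed open_Compl)
  have "K \<subseteq> ?U" using sub hom by (auto simp: K_def homeomorphism_def)
  then have KW: "- K \<union> W = UNIV" using charts_inD(2)[OF c(1)] by blast
  have zero: "h x = 0" if "x \<in> - K" for x
  proof (cases "x \<in> ?U")
    case True
    have "?\<phi> x \<notin> cball (?\<phi> x0) (2 * r)"
      using that True inv_into_chart[OF cM True] unfolding K_def by (metis ComplD image_eqI)
    then have "\<psi> (?\<phi> x) = 0" by (intro \<psi>(3)) (simp add: dist_commute)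
    then show ?thesis by (simp add: h_def)
  qed (simp add: h_def)
  have V: "open V" unfolding V_def
    using hom U by (intro continuous_open_preimage) (auto simp: homeomorphism_def)
  have one: "h x = 1" if "x \<in> V" for x
    using that \<psi>(2)[of "?\<phi> x"] by (simp add: h_def V_def dist_commute)
  have local: "(\<lambda>x\<in>?U. of_real (\<psi> (?\<phi> x)) :: 'b) \<in> smooth_functions M ?U"
  proof (rule smooth_functionsI)
    fix d assume d: "d \<in> charts_in M ?U"
    note dM = charts_inD(1)[OF d]
    have op: "open (snd d ` fst d)" by (rule open_charts_in_image[OF d])
    \<comment> \<open>In another chart \<open>d\<close> the function is \<open>\<psi>\<close> after
      the transition map, so compatibility and the chain rule apply.\<close>
    have "smooth_on (snd d ` (fst d \<inter> ?U)) (in_chart d ?\<phi>)"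
      using atlas_compatible[OF dM cM] by (simp add: compatible_def)
    then have "smooth_on (snd d ` fst d) (in_chart d ?\<phi>)"
      using charts_inD(2)[OF d] by (simp add: Int_absorb2)
    then have "smooth_on (snd d ` fst d) (\<lambda>y. \<psi> (in_chart d ?\<phi> y))"
      by (rule smooth_on_compose[OF frame_expansion op subset_UNIV _ \<psi>(1)])
    then have "smooth_on (snd d ` fst d) (\<lambda>y. of_real (\<psi> (in_chart d ?\<phi> y)) :: 'b)"
      by (rule smooth_on_bounded_linear[OF bounded_linear_of_real op])
    then show "\<exists>F. smooth_on (snd d ` fst d) F \<and> (\<forall>x\<in>fst d. F (snd d x) = (of_real (\<psi> (?\<phi> x)) :: 'b))"
      by (intro exI[of _ "\<lambda>y. of_real (\<psi> (in_chart d ?\<phi> y))"] conjI)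
        (simp_all add: in_chart_apply dM)
  qed
  have "h \<in> smooth_functions M UNIV"
  proof (rule smooth_functionsI_local)
    fix x :: 'x
    show "\<exists>V. open V \<and> x \<in> V \<and> (\<exists>g\<in>smooth_functions M V. \<forall>y\<in>UNIV \<inter> V. h y = g y)"
    proof (cases "x \<in> ?U")
      case True
      have "\<forall>y\<in>UNIV \<inter> ?U. h y = (\<lambda>x\<in>?U. of_real (\<psi> (?\<phi> x))) y" by (simp add: h_def)
      then show ?thesis using U local True by blast
    next
      case False
      have "\<forall>y\<in>UNIV \<inter> - K. h y = (\<lambda>x\<in>- K. 0) y" using zero by simp
      then show ?thesis using A smooth_functions_const False \<open>K \<subseteq> ?U\<close> by blast
    qed
  qed simp
  moreover have "x0 \<in> V" using c(2) r(1) by (simp add: V_def)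
  moreover have "V \<subseteq> W" using charts_inD(2)[OF c(1)] by (auto simp: V_def)
  ultimately show ?thesis using that A KW zero V one by blast
qed

text \<open>One bump function multiplies all the \<open>f i\<close>, which makes \<open>V\<close>
  independent of \<open>i\<close>. For a formal series \<open>i\<close> is the order in \<lambda>,
  and equality of germs demands one neighbourhood for all orders.\<close>

lemma smooth_extension:
  fixes f :: "'i \<Rightarrow> 'x \<Rightarrow> 'b::real_normed_algebra_1"
  assumes U: "open U" "x0 \<in> U" and f: "\<And>i. f i \<in> smooth_functions M U"
  obtains F V where "\<And>i. F i \<in> smooth_functions M UNIV" "open V" "x0 \<in> V" "V \<subseteq> U"
    "\<And>i x. x \<in> V \<Longrightarrow> F i x = f i x"
proof -
  obtain h :: "'x \<Rightarrow> 'b" and A V where h: "h \<in> smooth_functions M UNIV" and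
    A: "open A" "A \<union> U = UNIV" "\<And>x. x \<in> A \<Longrightarrow> h x = 0" and
    V: "open V" "x0 \<in> V" "V \<subseteq> U" "\<And>x. x \<in> V \<Longrightarrow> h x = 1"
    using bump_function[OF U] by blast
  define F where "F i x = (if x \<in> U then h x * f i x else 0)" for i x
  have "F i \<in> smooth_functions M UNIV" for i
  proof (rule smooth_functionsI_local)
    fix x :: 'x
    show "\<exists>V. open V \<and> x \<in> V \<and> (\<exists>g\<in>smooth_functions M V. \<forall>y\<in>UNIV \<inter> V. F i y = g y)"
    proof (cases "x \<in> U")
      case True
      have "(\<lambda>x\<in>U. restrict h U x * f i x) \<in> smooth_functions M U"
        by (intro smooth_functions_mult smooth_functions_restrict[OF h] f subset_UNIV)
      moreover have "\<forall>y\<in>UNIV \<inter> U. F i y = (\<lambda>x\<in>U. restrict h U x * f i x) y" by (simp add: F_def)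
      ultimately show ?thesis using U True by blast
    next
      case False
      then have "x \<in> A" using A(2) by blast
      moreover have "\<forall>y\<in>UNIV \<inter> A. F i y = (\<lambda>x\<in>A. 0) y" using A(3) by (simp add: F_def)
      ultimately show ?thesis using A(1) smooth_functions_const by blast
    qed
  qed simp
  moreover have "F i x = f i x" if "x \<in> V" for i x
    using that V(3,4) by (auto simp: F_def)
  ultimately show ?thesis by (rule that[OF _ V(1-3)])
qed

end

section \<open>Localization of bidifferential operators\<close>

definition triples :: "nat \<Rightarrow> (nat \<times> nat \<times> nat) set" where
  "triples n = {(l, p, q). l + p + q = n}"

lemma finite_triples [simp]: "finite (triples n)"
  by (rule finite_subset[of _ "{..n} \<times> {..n} \<times> {..n}"]) (auto simp: triples_def)

lemma triples_0: "triples 0 = {(0, 0, 0)}"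
  by (auto simp: triples_def)

lemma sum_triples_swap:
  "(\<Sum>(l, p, q)\<in>triples n. h l p q) = (\<Sum>(l, p, q)\<in>triples n. h l q p)"
  by (rule sum.reindex_bij_witness[of _ "\<lambda>(l, p, q). (l, q, p)" "\<lambda>(l, p, q). (l, q, p)"])
    (auto simp: triples_def)

text \<open>Replacing \<open>p - i\<close> by \<open>p\<close> moves the shift by \<open>i\<close>
  from the middle index to the total degree. This is the bookkeeping behind \<lambda>-linearity of
  the product in its first argument.\<close>

lemma sum_triples_shift_left:
  fixes a :: "nat \<Rightarrow> 'a::comm_semiring_0"
  shows "(\<Sum>(l, p, q)\<in>triples n. \<Sum>i\<le>p. a i * h l (p - i) q) =
    (\<Sum>i\<le>n. a i * (\<Sum>(l, p, q)\<in>triples (n - i). h l p q))"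
proof -
  have "(\<Sum>(l, p, q)\<in>triples n. \<Sum>i\<le>p. a i * h l (p - i) q) =
      (\<Sum>(t, i)\<in>Sigma (triples n) (\<lambda>(l, p, q). {..p}). a i * h (fst t) (fst (snd t) - i) (snd (snd t)))"
    by (subst sum.Sigma[symmetric]) (auto simp: split_beta)
  also have "\<dots> = (\<Sum>(i, t)\<in>Sigma {..n} (\<lambda>i. triples (n - i)). a i * h (fst t) (fst (snd t)) (snd (snd t)))"
    by (rule sum.reindex_bij_witness[of _ "\<lambda>(i, (l, p, q)). ((l, p + i, q), i)"
          "\<lambda>((l, p, q), i). (i, (l, p - i, q))"]) (auto simp: triples_def)
  also have "\<dots> = (\<Sum>i\<le>n. a i * (\<Sum>(l, p, q)\<in>triples (n - i). h l p q))"
    by (subst sum.Sigma[symmetric]) (auto simp: split_beta sum_distrib_left)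
  finally show ?thesis .
qed

lemma sum_triples_shift_right:
  fixes a :: "nat \<Rightarrow> 'a::comm_semiring_0"
  shows "(\<Sum>(l, p, q)\<in>triples n. \<Sum>i\<le>q. a i * h l p (q - i)) =
    (\<Sum>i\<le>n. a i * (\<Sum>(l, p, q)\<in>triples (n - i). h l p q))"
proof -
  have "(\<Sum>(l, p, q)\<in>triples n. \<Sum>i\<le>q. a i * h l p (q - i)) =
      (\<Sum>(l, p, q)\<in>triples n. \<Sum>i\<le>p. a i * h l q (p - i))"
    by (rule sum_triples_swap)
  also have "\<dots> = (\<Sum>i\<le>n. a i * (\<Sum>(l, p, q)\<in>triples (n - i). h l q p))"
    by (rule sum_triples_shift_left[of a "\<lambda>l p q. h l q p"])
  also have "\<dots> = (\<Sum>i\<le>n. a i * (\<Sum>(l, p, q)\<in>triples (n - i). h l p q))"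
    by (subst sum_triples_swap) (rule refl)
  finally show ?thesis .
qed

lemma star_apply:
  "x \<in> U \<Longrightarrow> star U D f g n x = (\<Sum>(l, p, q)\<in>triples n. D l (f p) (g q) x)"
  by (simp add: star_def triples_def)

text \<open>Well-founded recursion hands \<open>\<Phi> n\<close> a sequence cut off from
  \<open>n\<close> on; the hypothesis says that \<open>\<Phi> n\<close> does not see the
  difference.\<close>

lemma course_of_values_recursion:
  fixes \<Phi> :: "nat \<Rightarrow> (nat \<Rightarrow> 'a) \<Rightarrow> 'a"
  assumes "\<And>n t t'. (\<And>q. q < n \<Longrightarrow> t q = t' q) \<Longrightarrow> \<Phi> n t = \<Phi> n t'"
  shows "\<exists>t. \<forall>n. t n = \<Phi> n t"
proof (intro exI allI)
  define t where "t = wfrec less_than (\<lambda>t n. \<Phi> n t)"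
  fix n
  have "t n = \<Phi> n (cut t less_than n)"
    unfolding t_def by (rule wfrec[OF wf_less_than])
  also have "\<dots> = \<Phi> n t" by (rule assms) (simp add: cut_apply)
  finally show "t n = \<Phi> n t" .
qed

lemma restrict_series_eq_iff:
  "restrict_series f W = restrict_series g W \<longleftrightarrow> (\<forall>n. \<forall>x\<in>W. f n x = g n x)"
  by (auto simp: restrict_series_def fun_eq_iff restrict_def)

context manifold_setting
begin

section \<open>Locality of bidifferential operators and existence of localizations\<close>

lemma bidifferential_operator_closed:
  "bidifferential_operator M U D \<Longrightarrow> f \<in> smooth_functions M U \<Longrightarrow> g \<in> smooth_functions M U \<Longrightarrow>
    D f g \<in> smooth_functions M U"
  by (simp add: bidifferential_operator_def)

lemma bidifferential_operator_lincomb: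
  assumes D: "bidifferential_operator M U D"
    and fgh: "f \<in> smooth_functions M U" "g \<in> smooth_functions M U" "h \<in> smooth_functions M U"
  shows "D (\<lambda>x\<in>U. a * f x + g x) h = (\<lambda>x\<in>U. a * D f h x + D g h x)"
    "D h (\<lambda>x\<in>U. a * f x + g x) = (\<lambda>x\<in>U. a * D h f x + D h g x)"
proof -
  have "\<forall>f\<in>smooth_functions M U. \<forall>g\<in>smooth_functions M U. \<forall>h\<in>smooth_functions M U. \<forall>a.
        D (\<lambda>x\<in>U. a * f x + g x) h = (\<lambda>x\<in>U. a * D f h x + D g h x) \<and>
        D h (\<lambda>x\<in>U. a * f x + g x) = (\<lambda>x\<in>U. a * D h f x + D h g x)"
    using D unfolding bidifferential_operator_def by (elim conjE)
  from spec[OF bspec[OF bspec[OF bspec[OF this fgh(1)] fgh(2)] fgh(3)], of a]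
  show "D (\<lambda>x\<in>U. a * f x + g x) h = (\<lambda>x\<in>U. a * D f h x + D g h x)"
    "D h (\<lambda>x\<in>U. a * f x + g x) = (\<lambda>x\<in>U. a * D h f x + D h g x)"
    by (rule conjunct1, rule conjunct2)
qed

text \<open>In a chart around \<open>x\<close> the value is a combination of chart derivatives at
  \<open>x\<close>, and these see the functions only near \<open>x\<close>. Localization and the
  vanishing of products both rest on this.\<close>

lemma bidifferential_operator_local:
  assumes D: "bidifferential_operator M U D" and U: "open U" "x \<in> U"
    and f: "f \<in> smooth_functions M U" "f' \<in> smooth_functions M U"
    and g: "g \<in> smooth_functions M U" "g' \<in> smooth_functions M U"
    and V: "open V" "x \<in> V"
    and f_eq: "\<And>y. y \<in> V \<Longrightarrow> f y = f' y" and g_eq: "\<And>y. y \<in> V \<Longrightarrow> g y = g' y"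
  shows "D f g x = D f' g' x"
proof -
  obtain c where c: "c \<in> charts_in M U" "x \<in> fst c" using chart_at[OF U] by blast
  have "\<exists>l. \<forall>c\<in>charts_in M U. \<exists>coeff.
        (\<forall>\<alpha>\<in>multi_indices (mdim M) l. \<forall>\<beta>\<in>multi_indices (mdim M) l.
           coeff \<alpha> \<beta> \<in> smooth_functions M (fst c)) \<and>
        (\<forall>f\<in>smooth_functions M U. \<forall>g\<in>smooth_functions M U. \<forall>x\<in>fst c.
           D f g x = (\<Sum>\<alpha>\<in>multi_indices (mdim M) l. \<Sum>\<beta>\<in>multi_indices (mdim M) l.
             coeff \<alpha> \<beta> x * chart_derivative M c \<alpha> f x * chart_derivative M c \<beta> g x))"
    using D unfolding bidifferential_operator_def by (elim conjE)
  then obtain l coeff where eq: "\<forall>f\<in>smooth_functions M U. \<forall>g\<in>smooth_functions M U. \<forall>x\<in>fst c.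
      D f g x = (\<Sum>\<alpha>\<in>multi_indices (mdim M) l. \<Sum>\<beta>\<in>multi_indices (mdim M) l.
        coeff \<alpha> \<beta> x * chart_derivative M c \<alpha> f x * chart_derivative M c \<beta> g x)"
    using c(1) by meson
  have "chart_derivative M c \<alpha> f x = chart_derivative M c \<alpha> f' x"
    "chart_derivative M c \<alpha> g x = chart_derivative M c \<alpha> g' x" for \<alpha>
    by (rule chart_derivative_cong[OF charts_inD(1)[OF c(1)] c(2) V]; fact f_eq g_eq)+
  then show ?thesis
    using bspec[OF bspec[OF bspec[OF eq f(1)] g(1)] c(2)] bspec[OF bspec[OF bspec[OF eq f(2)] g(2)] c(2)]
    by (simp only:)
qed

lemma smooth_functions_lincomb:
  fixes f g :: "'x \<Rightarrow> 'b::real_normed_algebra"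
  assumes "f \<in> smooth_functions M U" "g \<in> smooth_functions M U"
  shows "(\<lambda>x\<in>U. a * f x + g x) \<in> smooth_functions M U"
proof -
  have "(\<lambda>x\<in>U. (\<lambda>x\<in>U. (\<lambda>x\<in>U. a) x * f x) x + g x) \<in> smooth_functions M U"
    by (intro smooth_functions_add smooth_functions_mult smooth_functions_const assms)
  moreover have "(\<lambda>x\<in>U. (\<lambda>x\<in>U. (\<lambda>x\<in>U. a) x * f x) x + g x) = (\<lambda>x\<in>U. a * f x + g x)"
    by (rule restrict_ext) simp
  ultimately show ?thesis by (simp only:)
qed

text \<open>The three functions are treated as one family, so a single \<open>V\<close> serves all
  of them. Bilinearity involves three functions; where fewer occur, an argument is repeated.\<close>

lemma smooth_extension3:
  fixes f g h :: "'x \<Rightarrow> 'b::real_normed_algebra_1"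
  assumes U: "open U" "x \<in> U"
    and "f \<in> smooth_functions M U" "g \<in> smooth_functions M U" "h \<in> smooth_functions M U"
  obtains F G H V where "F \<in> smooth_functions M UNIV" "G \<in> smooth_functions M UNIV"
    "H \<in> smooth_functions M UNIV" "open V" "x \<in> V" "V \<subseteq> U"
    "\<forall>y\<in>V. F y = f y" "\<forall>y\<in>V. G y = g y" "\<forall>y\<in>V. H y = h y"
proof -
  define e where "e i = (if i = 0 then f else if i = 1 then g else h)" for i :: nat
  have e: "e i \<in> smooth_functions M U" for i
    using assms by (simp add: e_def)
  obtain E V where E: "\<And>i::nat. E i \<in> smooth_functions M UNIV" and V: "open V" "x \<in> V" "V \<subseteq> U"
    and eq: "\<And>i y. y \<in> V \<Longrightarrow> E i y = e i y"
    by (rule smooth_extension[OF U e]) (rule that)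
  show ?thesis
    using eq[where i = 0] eq[where i = 1] eq[where i = 2]
    by (intro that[OF E[of 0] E[of 1] E[of 2] V]) (simp_all add: e_def)
qed

text \<open>The value at \<open>x\<close> is \<open>B\<close> of global extensions of the germs of
  \<open>f\<close> and \<open>g\<close> at \<open>x\<close>. The chosen extensions depend on
  \<open>x\<close> in no controlled way, but locality makes the value independent of them, and each
  required property is checked near one point with fixed extensions.\<close>

lemma localization_exists:
  fixes B :: "('x \<Rightarrow> 'k::real_or_complex) \<Rightarrow> ('x \<Rightarrow> 'k) \<Rightarrow> 'x \<Rightarrow> 'k"
  assumes B: "bidifferential_operator M UNIV B" and U: "open U"
  shows "\<exists>D. bidifferential_operator M U D \<and>
     (\<forall>f\<in>smooth_functions M UNIV. \<forall>g\<in>smooth_functions M UNIV.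
        restrict (B f g) U = D (restrict f U) (restrict g U))"
proof -
  define is_ext where "is_ext f x F \<longleftrightarrow> F \<in> smooth_functions M UNIV \<and>
    (\<exists>V. open V \<and> x \<in> V \<and> V \<subseteq> U \<and> (\<forall>y\<in>V. F y = f y))" for f F :: "'x \<Rightarrow> 'k" and x
  define ext where "ext f x = (SOME F. is_ext f x F)" for f :: "'x \<Rightarrow> 'k" and x
  define D where "D f g = (\<lambda>x\<in>U. B (ext f x) (ext g x) x)" for f g
  have ext: "is_ext f x (ext f x)" if f: "f \<in> smooth_functions M U" and x: "x \<in> U" for f x
  proof -
    have "\<exists>F. is_ext f x F"
      using smooth_extension3[OF U x f f f] unfolding is_ext_def by metis
    then show ?thesis unfolding ext_def by (rule someI_ex)
  qed
  \<comment> \<open>This frees \<open>D\<close> from the choice: any global functions that agree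
    with \<open>f\<close> and \<open>g\<close> near \<open>x\<close> compute the value.\<close>
  have D_eq: "D f g x = B F G x"
    if f: "f \<in> smooth_functions M U" and g: "g \<in> smooth_functions M U"
      and F: "F \<in> smooth_functions M UNIV" and G: "G \<in> smooth_functions M UNIV"
      and V: "open V" "x \<in> V" "V \<subseteq> U"
      and eq: "\<forall>y\<in>V. F y = f y" "\<forall>y\<in>V. G y = g y" for f g F G V x
  proof -
    have x: "x \<in> U" using V by blast
    obtain V1 where V1: "ext f x \<in> smooth_functions M UNIV" "open V1" "x \<in> V1"
      "\<And>y. y \<in> V1 \<Longrightarrow> ext f x y = f y"
      using ext[OF f x] unfolding is_ext_def by blast
    obtain V2 where V2: "ext g x \<in> smooth_functions M UNIV" "open V2" "x \<in> V2"
      "\<And>y. y \<in> V2 \<Longrightarrow> ext g x y = g y"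
      using ext[OF g x] unfolding is_ext_def by blast
    have "open (V \<inter> (V1 \<inter> V2))" "x \<in> V \<inter> (V1 \<inter> V2)"
      using V V1 V2 by (auto intro: open_Int)
    then have "B (ext f x) (ext g x) x = B F G x"
      by (rule bidifferential_operator_local[OF B open_UNIV UNIV_I V1(1) F V2(1) G])
        (use V1(4) V2(4) eq in auto)
    then show ?thesis using x by (simp add: D_def)
  qed
  have closed: "D f g \<in> smooth_functions M U"
    if f: "f \<in> smooth_functions M U" and g: "g \<in> smooth_functions M U" for f g
  proof (rule smooth_functionsI_local)
    show "D f g \<in> extensional U" by (simp add: D_def)
    fix x assume x: "x \<in> U"
    obtain F G H V where E: "F \<in> smooth_functions M UNIV" "G \<in> smooth_functions M UNIV"
      "open V" "x \<in> V" "V \<subseteq> U" "\<forall>y\<in>V. F y = f y" "\<forall>y\<in>V. G y = g y"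
      using smooth_extension3[OF U x f g g] by metis
    \<comment> \<open>One pair \<open>F\<close>, \<open>G\<close> works at all points of
      \<open>V\<close>, not only at \<open>x\<close>, so \<open>D f g\<close> coincides there with a
      smooth function.\<close>
    have "D f g y = B F G y" if "y \<in> V" for y
      by (rule D_eq[OF f g E(1,2,3) that E(5,6,7)])
    then have "\<forall>y\<in>U \<inter> V. D f g y = restrict (B F G) V y" by simp
    moreover have "restrict (B F G) V \<in> smooth_functions M V"
      by (rule smooth_functions_restrict[OF bidifferential_operator_closed[OF B E(1,2)] subset_UNIV])
    ultimately show "\<exists>V. open V \<and> x \<in> V \<and> (\<exists>g'\<in>smooth_functions M V. \<forall>y\<in>U \<inter> V. D f g y = g' y)"
      using E(3,4) by (intro exI[of _ V] conjI bexI[of _ "restrict (B F G) V"])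
  qed
  have bilinear: "D (\<lambda>x\<in>U. a * f x + g x) h = (\<lambda>x\<in>U. a * D f h x + D g h x) \<and>
      D h (\<lambda>x\<in>U. a * f x + g x) = (\<lambda>x\<in>U. a * D h f x + D h g x)"
    if f: "f \<in> smooth_functions M U" and g: "g \<in> smooth_functions M U"
      and h: "h \<in> smooth_functions M U" for f g h a
  proof -
    have "D (\<lambda>x\<in>U. a * f x + g x) h x = a * D f h x + D g h x \<and>
        D h (\<lambda>x\<in>U. a * f x + g x) x = a * D h f x + D h g x" if x: "x \<in> U" for x
    proof -
      obtain F G H V where E: "F \<in> smooth_functions M UNIV" "G \<in> smooth_functions M UNIV"
        "H \<in> smooth_functions M UNIV" and V: "open V" "x \<in> V" "V \<subseteq> U"
        and F: "\<forall>y\<in>V. F y = f y" and G: "\<forall>y\<in>V. G y = g y"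
        and H: "\<forall>y\<in>V. H y = h y"
        by (rule smooth_extension3[OF U x f g h]) (rule that)
      let ?F = "\<lambda>x\<in>UNIV. a * F x + G x" and ?f = "\<lambda>x\<in>U. a * f x + g x"
      have lin: "?F \<in> smooth_functions M UNIV" "?f \<in> smooth_functions M U"
        by (intro smooth_functions_lincomb E f g)+
      have eq: "\<forall>y\<in>V. ?F y = ?f y"
        using V(3) F G by auto
      have "B ?F H = (\<lambda>x\<in>UNIV. a * B F H x + B G H x) \<and> B H ?F = (\<lambda>x\<in>UNIV. a * B H F x + B H G x)"
        using bidifferential_operator_lincomb[OF B E] by blast
      then have "B ?F H x = a * B F H x + B G H x" "B H ?F x = a * B H F x + B H G x"
        by simp_all
      then show ?thesis
        unfolding D_eq[OF lin(2) h lin(1) E(3) V eq H] D_eq[OF h lin(2) E(3) lin(1) V H eq]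
          D_eq[OF f h E(1,3) V F H] D_eq[OF g h E(2,3) V G H]
          D_eq[OF h f E(3,1) V H F] D_eq[OF h g E(3,2) V H G] by blast
    qed
    then show ?thesis
      using closed[OF smooth_functions_lincomb[OF f g] h] closed[OF h smooth_functions_lincomb[OF f g]]
      by (intro conjI extensionalityI[of _ U] smooth_functions_extensional restrict_extensional) auto
  qed
  have "\<exists>l. \<forall>c\<in>charts_in M UNIV. \<exists>coeff.
        (\<forall>\<alpha>\<in>multi_indices (mdim M) l. \<forall>\<beta>\<in>multi_indices (mdim M) l.
           coeff \<alpha> \<beta> \<in> smooth_functions M (fst c)) \<and>
        (\<forall>f\<in>smooth_functions M UNIV. \<forall>g\<in>smooth_functions M UNIV. \<forall>x\<in>fst c.
           B f g x = (\<Sum>\<alpha>\<in>multi_indices (mdim M) l. \<Sum>\<beta>\<in>multi_indices (mdim M) l.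
             coeff \<alpha> \<beta> x * chart_derivative M c \<alpha> f x * chart_derivative M c \<beta> g x))"
    using B unfolding bidifferential_operator_def by (elim conjE)
  then obtain l where l: "\<And>c. c \<in> charts_in M UNIV \<Longrightarrow> \<exists>coeff.
        (\<forall>\<alpha>\<in>multi_indices (mdim M) l. \<forall>\<beta>\<in>multi_indices (mdim M) l.
           coeff \<alpha> \<beta> \<in> smooth_functions M (fst c)) \<and>
        (\<forall>f\<in>smooth_functions M UNIV. \<forall>g\<in>smooth_functions M UNIV. \<forall>x\<in>fst c.
           B f g x = (\<Sum>\<alpha>\<in>multi_indices (mdim M) l. \<Sum>\<beta>\<in>multi_indices (mdim M) l.
             coeff \<alpha> \<beta> x * chart_derivative M c \<alpha> f x * chart_derivative M c \<beta> g x))"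
    by blast
  have local_form: "\<exists>coeff.
        (\<forall>\<alpha>\<in>multi_indices (mdim M) l. \<forall>\<beta>\<in>multi_indices (mdim M) l.
           coeff \<alpha> \<beta> \<in> smooth_functions M (fst c)) \<and>
        (\<forall>f\<in>smooth_functions M U. \<forall>g\<in>smooth_functions M U. \<forall>x\<in>fst c.
           D f g x = (\<Sum>\<alpha>\<in>multi_indices (mdim M) l. \<Sum>\<beta>\<in>multi_indices (mdim M) l.
             coeff \<alpha> \<beta> x * chart_derivative M c \<alpha> f x * chart_derivative M c \<beta> g x))"
    if c: "c \<in> charts_in M U" for c
  proof -
    \<comment> \<open>A chart of \<open>U\<close> is a chart of the whole manifold, so
      \<open>D\<close> inherits the order \<open>l\<close> and the very coefficients of
      \<open>B\<close>.\<close>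
    have "c \<in> charts_in M UNIV" using c by (simp add: charts_in_def)
    from l[OF this] obtain coeff where
      coeff: "\<forall>\<alpha>\<in>multi_indices (mdim M) l. \<forall>\<beta>\<in>multi_indices (mdim M) l.
           coeff \<alpha> \<beta> \<in> smooth_functions M (fst c)"
      and B_eq: "\<forall>f\<in>smooth_functions M UNIV. \<forall>g\<in>smooth_functions M UNIV. \<forall>x\<in>fst c.
           B f g x = (\<Sum>\<alpha>\<in>multi_indices (mdim M) l. \<Sum>\<beta>\<in>multi_indices (mdim M) l.
             coeff \<alpha> \<beta> x * chart_derivative M c \<alpha> f x * chart_derivative M c \<beta> g x)"
      by (elim exE conjE)
    have "D f g x = (\<Sum>\<alpha>\<in>multi_indices (mdim M) l. \<Sum>\<beta>\<in>multi_indices (mdim M) l.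
             coeff \<alpha> \<beta> x * chart_derivative M c \<alpha> f x * chart_derivative M c \<beta> g x)"
      if f: "f \<in> smooth_functions M U" and g: "g \<in> smooth_functions M U" and x: "x \<in> fst c" for f g x
    proof -
      have xU: "x \<in> U" using x charts_inD(2)[OF c] by blast
      obtain F G H V where E: "F \<in> smooth_functions M UNIV" "G \<in> smooth_functions M UNIV"
        and V: "open V" "x \<in> V" "V \<subseteq> U"
        and F: "\<forall>y\<in>V. F y = f y" and G: "\<forall>y\<in>V. G y = g y"
        using smooth_extension3[OF U xU f g g] by metis
      have "chart_derivative M c \<alpha> F x = chart_derivative M c \<alpha> f x"
        "chart_derivative M c \<alpha> G x = chart_derivative M c \<alpha> g x" for \<alpha>
        by (rule chart_derivative_cong[OF charts_inD(1)[OF c] x V(1,2)]; simp add: F G)+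
      then show ?thesis
        unfolding D_eq[OF f g E V F G] bspec[OF bspec[OF bspec[OF B_eq E(1)] E(2)] x]
        by (simp only:)
    qed
    then show ?thesis using coeff by blast
  qed
  have compat: "restrict (B f g) U = D (restrict f U) (restrict g U)"
    if f: "f \<in> smooth_functions M UNIV" and g: "g \<in> smooth_functions M UNIV" for f g
  proof (rule extensionalityI[of _ U])
    note r = smooth_functions_restrict[OF f subset_UNIV] smooth_functions_restrict[OF g subset_UNIV]
    show "D (restrict f U) (restrict g U) \<in> extensional U" by (simp add: D_def)
    show "restrict (B f g) U x = D (restrict f U) (restrict g U) x" if "x \<in> U" for x
      using D_eq[OF r f g U that subset_refl] that by simp
  qed simp
  have "bidifferential_operator M U D"
    unfolding bidifferential_operator_def
    by (rule conjI[OF _ conjI[OF _ exI[of _ l]]];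
        intro ballI allI; rule closed bilinear local_form; assumption)
  moreover have "\<forall>f\<in>smooth_functions M UNIV. \<forall>g\<in>smooth_functions M UNIV.
      restrict (B f g) U = D (restrict f U) (restrict g U)"
    by (intro ballI compat)
  ultimately show ?thesis by (intro exI conjI)
qed

lemma localization_bidifferential_operator:
  assumes "bidifferential_operator M UNIV B" "open U"
  shows "bidifferential_operator M U (localization M B U)"
  unfolding localization_def by (rule conjunct1[OF someI_ex[OF localization_exists[OF assms]]])

lemma localization_restrict:
  assumes "bidifferential_operator M UNIV B" "open U"
    and "F \<in> smooth_functions M UNIV" "G \<in> smooth_functions M UNIV"
  shows "localization M B U (restrict F U) (restrict G U) = restrict (B F G) U"
  unfolding localization_def
  by (rule bspec[OF bspec[OF conjunct2[OF someI_ex[OF localization_exists[OF assms(1,2)]]]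
          assms(3)] assms(4), symmetric])

text \<open>The defining property of the localization speaks only of restrictions of global
  functions, while a smooth function on \<open>U\<close> need not be one. But the localization is
  itself a bidifferential operator on \<open>U\<close>, hence local, and extensions valid near
  \<open>x\<close> are enough. In particular the choice by \<open>SOME\<close> does not affect the
  value.\<close>

lemma localization_eq:
  assumes B: "bidifferential_operator M UNIV B" and U: "open U"
    and f: "f \<in> smooth_functions M U" and g: "g \<in> smooth_functions M U"
    and F: "F \<in> smooth_functions M UNIV" and G: "G \<in> smooth_functions M UNIV"
    and V: "open V" "x \<in> V" "V \<subseteq> U"
    and eq: "\<And>y. y \<in> V \<Longrightarrow> F y = f y" "\<And>y. y \<in> V \<Longrightarrow> G y = g y"
  shows "localization M B U f g x = B F G x"
proof -
  have x: "x \<in> U" using V by blast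
  have "localization M B U f g x = localization M B U (restrict F U) (restrict G U) x"
    by (rule bidifferential_operator_local[OF localization_bidifferential_operator[OF B U] U x f
          smooth_functions_restrict[OF F subset_UNIV] g smooth_functions_restrict[OF G subset_UNIV] V(1,2)])
      (use V(3) eq in auto)
  then show ?thesis using localization_restrict[OF B U F G] x by simp
qed

end

section \<open>The algebra of formal series\<close>

declare restrict_UNIV [simp]

lemma series_algebra_simps [simp]:
  "carrier (series_algebra M U D) = {f. \<forall>n. f n \<in> smooth_functions M U}"
  "f \<otimes>\<^bsub>series_algebra M U D\<^esub> g = star U D f g"
  "\<one>\<^bsub>series_algebra M U D\<^esub> = (\<lambda>n. \<lambda>x\<in>U. if n = 0 then 1 else 0)"
  "\<zero>\<^bsub>series_algebra M U D\<^esub> = (\<lambda>n. \<lambda>x\<in>U. 0)"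
  "f \<oplus>\<^bsub>series_algebra M U D\<^esub> g = (\<lambda>n. \<lambda>x\<in>U. f n x + g n x)"
  "a \<odot>\<^bsub>series_algebra M U D\<^esub> f = (\<lambda>n. \<lambda>x\<in>U. \<Sum>i\<le>n. fps_nth a i * f (n - i) x)"
  by (simp_all add: series_algebra_def)

lemma star_flip: "star U (\<lambda>l f g. D l g f) f g = star U D g f"
  unfolding star_def triples_def[symmetric]
  by (subst sum_triples_swap) (rule refl)

text \<open>At a fixed point \<open>x\<close> a formal series of functions is a power series and
  scalar multiplication is the Cauchy product, so module axioms become ring axioms of
  \<open>fps\<close>.\<close>

lemma smult_series_fps:
  "(\<Sum>i\<le>n. fps_nth a i * f (n - i) x) = fps_nth (a * Abs_fps (\<lambda>n. f n x)) n"
  by (simp add: fps_mult_nth atMost_atLeast0)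

context manifold_setting
begin

lemma smooth_functions_one: "(\<lambda>x\<in>U. if n = 0 then 1 else 0) \<in> smooth_functions M U"
  by (cases "n = 0") (simp_all add: smooth_functions_const)

lemma smooth_functions_smult:
  fixes f :: "nat \<Rightarrow> 'x \<Rightarrow> 'k::real_normed_field"
  assumes "\<And>n. f n \<in> smooth_functions M U"
  shows "(\<lambda>x\<in>U. \<Sum>i\<le>n. fps_nth a i * f (n - i) x) \<in> smooth_functions M U"
proof -
  have "(\<lambda>x\<in>U. \<Sum>i\<le>n. (\<lambda>x\<in>U. fps_nth a i * f (n - i) x + (\<lambda>x\<in>U. 0) x) x) \<in> smooth_functions M U"
    by (rule smooth_functions_sum, rule smooth_functions_lincomb[OF assms smooth_functions_const])
  moreover have "(\<lambda>x\<in>U. \<Sum>i\<le>n. (\<lambda>x\<in>U. fps_nth a i * f (n - i) x + (\<lambda>x\<in>U. 0) x) x) =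
      (\<lambda>x\<in>U. \<Sum>i\<le>n. fps_nth a i * f (n - i) x)"
    by (rule restrict_ext) simp
  ultimately show ?thesis by (simp only:)
qed

text \<open>Stated for any operators that preserve smoothness, so that it covers the global product
  as well as the localized ones.\<close>

lemma smooth_functions_star:
  fixes f g :: "nat \<Rightarrow> 'x \<Rightarrow> 'k::real_or_complex"
  assumes D: "\<And>l f g. f \<in> smooth_functions M U \<Longrightarrow> g \<in> smooth_functions M U \<Longrightarrow> D l f g \<in> smooth_functions M U"
    and fg: "\<And>n. f n \<in> smooth_functions M U" "\<And>n. g n \<in> smooth_functions M U"
  shows "star U D f g n \<in> smooth_functions M U"
proof -
  have "(\<lambda>x\<in>U. \<Sum>t\<in>triples n. D (fst t) (f (fst (snd t))) (g (snd (snd t))) x) \<in> smooth_functions M U"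
    by (rule smooth_functions_sum) (rule D[OF fg])
  moreover have "star U D f g n =
      (\<lambda>x\<in>U. \<Sum>t\<in>triples n. D (fst t) (f (fst (snd t))) (g (snd (snd t))) x)"
    unfolding star_def triples_def[symmetric]
    by (intro restrict_ext sum.cong refl) (simp only: split_beta)
  ultimately show ?thesis by (simp only:)
qed

text \<open>Linearity is available for combinations \<open>a * f + g\<close>; with
  \<open>a = - 1\<close> and both functions zero the right-hand side cancels.\<close>

lemma bidifferential_operator_zero:
  fixes D :: "('x \<Rightarrow> 'b::real_or_complex) \<Rightarrow> ('x \<Rightarrow> 'b) \<Rightarrow> 'x \<Rightarrow> 'b"
  assumes D: "bidifferential_operator M UNIV D" and h: "h \<in> smooth_functions M UNIV"
  shows "D (\<lambda>x. 0) h = (\<lambda>x. 0)" "D h (\<lambda>x. 0) = (\<lambda>x. 0)"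
proof -
  have 0: "(\<lambda>x::'x. 0::'b) \<in> smooth_functions M UNIV"
    using smooth_functions_const[of "0::'b" UNIV] by simp
  have arg: "(\<lambda>x\<in>UNIV. - 1 * 0 + 0) = (\<lambda>x::'x. 0::'b)" by simp
  have cancel: "(\<lambda>x\<in>UNIV. - 1 * f x + f x) = (\<lambda>x. 0)" for f :: "'x \<Rightarrow> 'b"
    by (simp add: fun_eq_iff)
  show "D (\<lambda>x. 0) h = (\<lambda>x. 0)"
    using bidifferential_operator_lincomb(1)[OF D 0 0 h, of "- 1"] unfolding arg cancel .
  show "D h (\<lambda>x. 0) = (\<lambda>x. 0)"
    using bidifferential_operator_lincomb(2)[OF D 0 0 h, of "- 1"] unfolding arg cancel .
qed

lemma bidifferential_operator_sum:
  fixes D :: "('x \<Rightarrow> 'b::real_or_complex) \<Rightarrow> ('x \<Rightarrow> 'b) \<Rightarrow> 'x \<Rightarrow> 'b"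
  assumes D: "bidifferential_operator M UNIV D" and h: "h \<in> smooth_functions M UNIV"
    and "finite I" and f: "\<And>i. i \<in> I \<Longrightarrow> f i \<in> smooth_functions M UNIV"
  shows "D (\<lambda>x. \<Sum>i\<in>I. a i * f i x) h = (\<lambda>x. \<Sum>i\<in>I. a i * D (f i) h x) \<and>
    D h (\<lambda>x. \<Sum>i\<in>I. a i * f i x) = (\<lambda>x. \<Sum>i\<in>I. a i * D h (f i) x)"
  using assms(3) f
proof (induction I)
  case empty
  then show ?case using bidifferential_operator_zero[OF D h] by simp
next
  case (insert i I)
  have smooth: "(\<lambda>x. a i * f i x) \<in> smooth_functions M UNIV" if "i \<in> I" for i
    using smooth_functions_lincomb[of "f i" UNIV "\<lambda>x\<in>UNIV. 0" "a i"] smooth_functions_const[of "0::'b" UNIV]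
      insert.prems that by simp
  have "(\<lambda>x\<in>UNIV. \<Sum>i\<in>I. a i * f i x) \<in> smooth_functions M UNIV"
    by (rule smooth_functions_sum) (rule smooth)
  then have "(\<lambda>x. \<Sum>i\<in>I. a i * f i x) \<in> smooth_functions M UNIV" by simp
  from bidifferential_operator_lincomb[OF D insert.prems[OF insertI1] this h, of "a i"]
  show ?case using insert by simp
qed

text \<open>The coefficient $t_n$ enters the $n$-th coefficient of $s \star t$ only through $s_0 t_n$, so
  it can be solved for near $x_0$ with a global function \<open>u\<close> that equals $1/s_0$ there. For a
  left inverse the lemma is applied to the opposite product.\<close>

lemma right_inverse_near:
  fixes D :: "nat \<Rightarrow> ('x \<Rightarrow> 'k::real_or_complex) \<Rightarrow> ('x \<Rightarrow> 'k) \<Rightarrow> 'x \<Rightarrow> 'k"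
  assumes D: "\<And>l f g. f \<in> smooth_functions M UNIV \<Longrightarrow> g \<in> smooth_functions M UNIV \<Longrightarrow>
      D l f g \<in> smooth_functions M UNIV"
    and D0: "\<And>f g. f \<in> smooth_functions M UNIV \<Longrightarrow> g \<in> smooth_functions M UNIV \<Longrightarrow>
      D 0 f g = (\<lambda>x. f x * g x)"
    and s: "\<And>n. s n \<in> smooth_functions M UNIV" and nz: "s 0 x0 \<noteq> 0"
  obtains t V where "\<And>n. t n \<in> smooth_functions M UNIV" "open V" "x0 \<in> V"
    "\<And>n x. x \<in> V \<Longrightarrow> star UNIV D s t n x = (if n = 0 then 1 else 0)"
proof -
  define U where "U = s 0 -` (- {0})"
  have U: "open U" "x0 \<in> U"
    unfolding U_def using smooth_functions_continuous[OF s open_UNIV] nz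
    by (auto intro!: open_vimage)
  have inv: "(\<lambda>x\<in>U. inverse (restrict (s 0) U x)) \<in> smooth_functions M U"
    by (rule smooth_functions_inverse[OF smooth_functions_restrict[OF s subset_UNIV]]) (simp add: U_def)
  obtain u V where u: "u \<in> smooth_functions M UNIV" and V: "open V" "x0 \<in> V" "V \<subseteq> U"
    and u_eq: "\<forall>y\<in>V. u y = (\<lambda>x\<in>U. inverse (restrict (s 0) U x)) y"
    by (rule smooth_extension3[OF U inv inv inv]) (rule that; assumption)
  have su: "s 0 x * u x = 1" if "x \<in> V" for x
    using that V(3) u_eq by (auto simp: U_def)
  define T where "T n = {(l, p, q)\<in>triples n. q < n}" for n
  \<comment> \<open>The recursion runs on the whole manifold with \<open>u\<close> in place of the
    reciprocal, so every \<open>t n\<close> is global. The inverse equation is claimed on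
    \<open>V\<close> only, and \<open>V\<close> was fixed together with \<open>u\<close>, so it
    serves all orders.\<close>
  define \<Phi> where "\<Phi> n t = (\<lambda>x. if n = 0 then u x else
      - u x * (\<Sum>(l, p, q)\<in>T n. D l (s p) (t q) x))" for n and t :: "nat \<Rightarrow> 'x \<Rightarrow> 'k"
  have "\<exists>t. \<forall>n. t n = \<Phi> n t"
  proof (rule course_of_values_recursion)
    fix n and t t' :: "nat \<Rightarrow> 'x \<Rightarrow> 'k"
    assume "\<And>q. q < n \<Longrightarrow> t q = t' q"
    then have "D l (s p) (t q) = D l (s p) (t' q)" if "(l, p, q) \<in> T n" for l p q
      using that by (simp add: T_def)
    then show "\<Phi> n t = \<Phi> n t'"
      unfolding \<Phi>_def by (intro ext if_cong arg_cong2[where f = "(*)"] sum.cong refl) auto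
  qed
  then obtain t where t: "\<And>n. t n = \<Phi> n t" by blast
  have smooth: "t n \<in> smooth_functions M UNIV" for n
  proof (induction n rule: less_induct)
    case (less n)
    show ?case
    proof (cases "n = 0")
      case True
      then show ?thesis using u by (subst t) (simp add: \<Phi>_def)
    next
      case False
      have "(\<lambda>x\<in>UNIV. \<Sum>i\<in>T n. D (fst i) (s (fst (snd i))) (t (snd (snd i))) x)
          \<in> smooth_functions M UNIV" (is "?f \<in> _")
        by (rule smooth_functions_sum, rule D[OF s less.IH]) (auto simp: T_def)
      then have "(\<lambda>x\<in>UNIV. (\<lambda>x\<in>UNIV. (\<lambda>x\<in>UNIV. - 1) x * u x) x * ?f x) \<in> smooth_functions M UNIV"
        by (rule smooth_functions_mult[OF smooth_functions_mult[OF smooth_functions_const u]])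
      then show ?thesis using False by (subst t) (simp add: \<Phi>_def split_beta)
    qed
  qed
  have "star UNIV D s t n x = (if n = 0 then 1 else 0)" if x: "x \<in> V" for n x
  proof (cases "n = 0")
    case True
    have "t 0 x = u x" by (subst t) (simp add: \<Phi>_def)
    then show ?thesis
      using True su[OF x] by (simp add: star_apply triples_0 D0[OF s smooth])
  next
    case False
    \<comment> \<open>The condition \<open>q < n\<close> in \<open>T n\<close> removes exactly the
      triple that carries the unknown \<open>t n\<close>: there \<open>q = n\<close> forces the
      other two indices to be 0.\<close>
    have "triples n = insert (0, 0, n) (T n)" by (auto simp: triples_def T_def)
    moreover have "finite (T n)" by (rule finite_subset[OF _ finite_triples[of n]]) (auto simp: T_def)
    moreover have "(0, 0, n) \<notin> T n" by (simp add: T_def)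
    ultimately have "star UNIV D s t n x =
        D 0 (s 0) (t n) x + (\<Sum>(l, p, q)\<in>T n. D l (s p) (t q) x)"
      by (simp add: star_apply)
    also have "t n x = - u x * (\<Sum>(l, p, q)\<in>T n. D l (s p) (t q) x)"
      using False by (subst t) (simp add: \<Phi>_def)
    then have "D 0 (s 0) (t n) x = - (s 0 x * u x) * (\<Sum>(l, p, q)\<in>T n. D l (s p) (t q) x)"
      by (simp add: D0[OF s smooth])
    finally show ?thesis using False by (simp add: su[OF x])
  qed
  then show ?thesis by (rule that[OF smooth V(1,2)])
qed

end

locale star_setting = manifold_setting M
  for M :: "('x::{t2_space,second_countable_topology}, 'e::real_inner) manifold" +
  fixes C :: "nat \<Rightarrow> ('x \<Rightarrow> 'k) \<Rightarrow> ('x \<Rightarrow> 'k) \<Rightarrow> 'x \<Rightarrow> 'k::real_or_complex"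
  assumes star_product: "star_product M C"
begin

lemma bidiff: "bidifferential_operator M UNIV (C l)"
  using star_product by (simp add: star_product_def)

lemma C_0: "f \<in> smooth_functions M UNIV \<Longrightarrow> g \<in> smooth_functions M UNIV \<Longrightarrow> C 0 f g = (\<lambda>x. f x * g x)"
  using star_product by (simp add: star_product_def)

abbreviation "R \<equiv> series_algebra M UNIV C"

lemma R_assoc:
  "f \<in> carrier R \<Longrightarrow> g \<in> carrier R \<Longrightarrow> h \<in> carrier R \<Longrightarrow>
    (f \<otimes>\<^bsub>R\<^esub> g) \<otimes>\<^bsub>R\<^esub> h = f \<otimes>\<^bsub>R\<^esub> (g \<otimes>\<^bsub>R\<^esub> h)"
  using star_product unfolding star_product_def Let_def by blast

lemma R_one: "f \<in> carrier R \<Longrightarrow> \<one>\<^bsub>R\<^esub> \<otimes>\<^bsub>R\<^esub> f = f" "f \<in> carrier R \<Longrightarrow> f \<otimes>\<^bsub>R\<^esub> \<one>\<^bsub>R\<^esub> = f"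
  using star_product unfolding star_product_def Let_def by blast+

lemma star_closed:
  "f \<in> carrier R \<Longrightarrow> g \<in> carrier R \<Longrightarrow> star UNIV C f g n \<in> smooth_functions M UNIV"
  by (rule smooth_functions_star) (simp_all add: bidifferential_operator_closed[OF bidiff])

lemma C_add:
  assumes "f \<in> smooth_functions M UNIV" "g \<in> smooth_functions M UNIV" "h \<in> smooth_functions M UNIV"
  shows "C l (\<lambda>x. f x + g x) h = (\<lambda>x. C l f h x + C l g h x)"
    "C l h (\<lambda>x. f x + g x) = (\<lambda>x. C l h f x + C l h g x)"
  using bidifferential_operator_lincomb[OF bidiff[of l] assms, where a = 1] by simp_all

lemma unital_algebra_R: "unital_algebra (ring_of_type_algebra :: 'k fps ring) R"
proof -
  note add_closed = smooth_functions_add[where U = UNIV, simplified]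
  note const_closed = smooth_functions_const[where U = UNIV, simplified]
  have one_closed: "(\<lambda>x. if n = 0 then 1 else 0) \<in> smooth_functions M UNIV" for n :: nat
    using smooth_functions_one[where U = UNIV and n = n] by simp
  note smult_closed = smooth_functions_smult[where U = UNIV, simplified]
  have group: "abelian_group R"
  proof (rule abelian_groupI)
    fix f assume f: "f \<in> carrier R"
    have "(\<lambda>x\<in>UNIV. - 1 * f n x + (\<lambda>x\<in>UNIV. 0) x) \<in> smooth_functions M UNIV" for n
      by (intro smooth_functions_lincomb smooth_functions_const) (use f in simp)
    then have "(\<lambda>n x. - f n x) \<in> carrier R" by simp
    moreover have "(\<lambda>n x. - f n x) \<oplus>\<^bsub>R\<^esub> f = \<zero>\<^bsub>R\<^esub>" by simp
    ultimately show "\<exists>g\<in>carrier R. g \<oplus>\<^bsub>R\<^esub> f = \<zero>\<^bsub>R\<^esub>" by blast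
  qed (simp_all add: add_closed const_closed add.assoc add.commute add.left_commute)
  have monoid: "Group.monoid R"
    using R_assoc R_one by (intro monoidI) (simp_all add: star_closed one_closed)
  have ring: "ring R"
  proof (rule ringI[OF group monoid])
    fix f g h assume "f \<in> carrier R" "g \<in> carrier R" "h \<in> carrier R"
    then have "star UNIV C (\<lambda>n x. f n x + g n x) h n x = star UNIV C f h n x + star UNIV C g h n x"
      "star UNIV C h (\<lambda>n x. f n x + g n x) n x = star UNIV C h f n x + star UNIV C h g n x" for n x
      by (simp_all add: star_apply C_add split_beta sum.distrib)
    then show "(f \<oplus>\<^bsub>R\<^esub> g) \<otimes>\<^bsub>R\<^esub> h = f \<otimes>\<^bsub>R\<^esub> h \<oplus>\<^bsub>R\<^esub> g \<otimes>\<^bsub>R\<^esub> h"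
      "h \<otimes>\<^bsub>R\<^esub> (f \<oplus>\<^bsub>R\<^esub> g) = h \<otimes>\<^bsub>R\<^esub> f \<oplus>\<^bsub>R\<^esub> h \<otimes>\<^bsub>R\<^esub> g"
      by (simp_all add: fun_eq_iff)
  qed
  have "module (ring_of_type_algebra :: 'k fps ring) R"
  proof (rule moduleI[OF cring_from_type_algebra group])
    fix a b :: "'k fps" and f g assume f: "f \<in> carrier R" and g: "g \<in> carrier R"
    show "a \<odot>\<^bsub>R\<^esub> f \<in> carrier R"
      using f by (simp add: smult_closed)
    show "(a \<oplus>\<^bsub>ring_of_type_algebra\<^esub> b) \<odot>\<^bsub>R\<^esub> f = a \<odot>\<^bsub>R\<^esub> f \<oplus>\<^bsub>R\<^esub> b \<odot>\<^bsub>R\<^esub> f"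
      by (simp add: ring_of_type_algebra_def distrib_right sum.distrib)
    show "a \<odot>\<^bsub>R\<^esub> (f \<oplus>\<^bsub>R\<^esub> g) = a \<odot>\<^bsub>R\<^esub> f \<oplus>\<^bsub>R\<^esub> a \<odot>\<^bsub>R\<^esub> g"
      by (simp add: distrib_left sum.distrib)
    show "(a \<otimes>\<^bsub>ring_of_type_algebra\<^esub> b) \<odot>\<^bsub>R\<^esub> f = a \<odot>\<^bsub>R\<^esub> (b \<odot>\<^bsub>R\<^esub> f)"
      by (simp add: ring_of_type_algebra_def smult_series_fps mult.assoc)
        (simp add: fps_mult_nth[of a] atMost_atLeast0)
    have "\<one>\<^bsub>ring_of_type_algebra\<^esub> = (1 :: 'k fps)"
      by (simp add: ring_of_type_algebra_def)
    then show "\<one>\<^bsub>ring_of_type_algebra\<^esub> \<odot>\<^bsub>R\<^esub> f = f"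
      by (simp only: series_algebra_simps restrict_UNIV smult_series_fps mult_1_left fps_nth_Abs_fps)
  qed
  moreover have "(a \<odot>\<^bsub>R\<^esub> f) \<otimes>\<^bsub>R\<^esub> g = a \<odot>\<^bsub>R\<^esub> (f \<otimes>\<^bsub>R\<^esub> g) \<and>
      f \<otimes>\<^bsub>R\<^esub> (a \<odot>\<^bsub>R\<^esub> g) = a \<odot>\<^bsub>R\<^esub> (f \<otimes>\<^bsub>R\<^esub> g)"
    if f: "f \<in> carrier R" and g: "g \<in> carrier R" for f g and a :: "'k fps"
  proof -
    \<comment> \<open>Each order involves only finitely many terms, so linearity of
      \<open>C l\<close> over the ground field is enough for linearity over formal power
      series.\<close>
    have "C l (\<lambda>x. \<Sum>i\<le>n. fps_nth a i * f (n - i) x) (g q) = (\<lambda>x. \<Sum>i\<le>n. fps_nth a i * C l (f (n - i)) (g q) x)"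
      "C l (f q) (\<lambda>x. \<Sum>i\<le>n. fps_nth a i * g (n - i) x) = (\<lambda>x. \<Sum>i\<le>n. fps_nth a i * C l (f q) (g (n - i)) x)"
      for l n q
      using bidifferential_operator_sum[OF bidiff[of l], where h = "g q" and I = "{..n}"
          and f = "\<lambda>i. f (n - i)" and a = "fps_nth a"]
        bidifferential_operator_sum[OF bidiff[of l], where h = "f q" and I = "{..n}"
          and f = "\<lambda>i. g (n - i)" and a = "fps_nth a"] f g
      by simp_all
    then have "star UNIV C (\<lambda>n x. \<Sum>i\<le>n. fps_nth a i * f (n - i) x) g n x =
          (\<Sum>i\<le>n. fps_nth a i * star UNIV C f g (n - i) x)"
      "star UNIV C f (\<lambda>n x. \<Sum>i\<le>n. fps_nth a i * g (n - i) x) n x =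
          (\<Sum>i\<le>n. fps_nth a i * star UNIV C f g (n - i) x)" for n x
      using sum_triples_shift_left[where h = "\<lambda>l p q. C l (f p) (g q) x" and a = "fps_nth a" and n = n]
        sum_triples_shift_right[where h = "\<lambda>l p q. C l (f p) (g q) x" and a = "fps_nth a" and n = n]
      by (simp_all add: star_apply)
    then show ?thesis by (simp add: fun_eq_iff)
  qed
  ultimately show ?thesis
    using ring by (intro unital_algebra.intro unital_algebra_axioms.intro) blast+
qed

text \<open>A coefficient of the product is a finite sum of local terms, and the same
  \<open>V\<close> serves every order \<open>n\<close>.\<close>

lemma star_local:
  assumes "f \<in> carrier R" "f' \<in> carrier R" "g \<in> carrier R" "g' \<in> carrier R"
    and V: "open V" "x \<in> V" and eq: "\<And>n y. y \<in> V \<Longrightarrow> f n y = f' n y" "\<And>n y. y \<in> V \<Longrightarrow> g n y = g' n y"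
  shows "star UNIV C f g n x = star UNIV C f' g' n x"
proof -
  have "C l (f p) (g q) x = C l (f' p) (g' q) x" for l p q
    by (rule bidifferential_operator_local[OF bidiff open_UNIV UNIV_I _ _ _ _ V]) (use assms in auto)
  then show ?thesis by (simp add: star_apply)
qed

lemma local_algebra_simps [simp]:
  "carrier (local_algebra M C U) = {f. \<forall>n. f n \<in> smooth_functions M U}"
  "f \<otimes>\<^bsub>local_algebra M C U\<^esub> g = star U (\<lambda>k. localization M (C k) U) f g"
  "\<one>\<^bsub>local_algebra M C U\<^esub> = (\<lambda>n. \<lambda>x\<in>U. if n = 0 then 1 else 0)"
  "\<zero>\<^bsub>local_algebra M C U\<^esub> = (\<lambda>n. \<lambda>x\<in>U. 0)"
  "f \<oplus>\<^bsub>local_algebra M C U\<^esub> g = (\<lambda>n. \<lambda>x\<in>U. f n x + g n x)"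
  "a \<odot>\<^bsub>local_algebra M C U\<^esub> f = (\<lambda>n. \<lambda>x\<in>U. \<Sum>i\<le>n. fps_nth a i * f (n - i) x)"
  by (simp_all add: local_algebra_def)

lemma local_star_closed:
  assumes "open U" "f \<in> carrier (local_algebra M C U)" "g \<in> carrier (local_algebra M C U)"
  shows "star U (\<lambda>k. localization M (C k) U) f g n \<in> smooth_functions M U"
  using assms(2,3)
  by (intro smooth_functions_star)
    (auto intro: bidifferential_operator_closed[OF localization_bidifferential_operator[OF bidiff assms(1)]])

text \<open>Near \<open>x\<close> the localized product is the global product of any extensions.
  This carries the multiplication of germs back to \<open>R\<close>.\<close>

lemma local_star_eq:
  assumes "open U" "f \<in> carrier (local_algebra M C U)" "g \<in> carrier (local_algebra M C U)"
    and "F \<in> carrier R" "G \<in> carrier R" and V: "open V" "x \<in> V" "V \<subseteq> U"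
    and eq: "\<And>n y. y \<in> V \<Longrightarrow> F n y = f n y" "\<And>n y. y \<in> V \<Longrightarrow> G n y = g n y"
  shows "star U (\<lambda>k. localization M (C k) U) f g n x = star UNIV C F G n x"
proof -
  have "localization M (C l) U (f p) (g q) x = C l (F p) (G q) x" for l p q
    by (rule localization_eq[OF bidiff assms(1) _ _ _ _ V]) (use assms in auto)
  then show ?thesis using V by (auto simp: star_apply)
qed

end

section \<open>The stalk\<close>

text \<open>Well-definedness in the encoding of the stalk: a union over representatives collapses if
  there is a representative and all of them give the same germ.\<close>

lemma UN_pairs_eqI:
  assumes "(a, b) \<in> A" and "\<And>a b. (a, b) \<in> A \<Longrightarrow> B a b = c"
  shows "(\<Union>(a, b)\<in>A. B a b) = c"
  using assms by force

context star_setting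
begin

context
  fixes x0 :: 'x
begin

abbreviation "\<eta> \<equiv> germ M C x0 UNIV"
abbreviation "R_x0 \<equiv> stalk M C x0"

lemma local_sections_iff:
  "(U, f) \<in> local_sections M C x0 \<longleftrightarrow> open U \<and> x0 \<in> U \<and> (\<forall>n. f n \<in> smooth_functions M U)"
  by (simp add: local_sections_def)

lemma germ_rel_iff:
  "((U, f), (V, g)) \<in> germ_rel M C x0 \<longleftrightarrow>
    (U, f) \<in> local_sections M C x0 \<and> (V, g) \<in> local_sections M C x0 \<and>
    (\<exists>W. open W \<and> x0 \<in> W \<and> W \<subseteq> U \<inter> V \<and> (\<forall>n. \<forall>x\<in>W. f n x = g n x))"
  by (simp add: germ_rel_def restrict_series_eq_iff)

lemma equiv_germ_rel: "equiv (local_sections M C x0) (germ_rel M C x0)"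
proof (rule equivI)
  show "germ_rel M C x0 \<subseteq> local_sections M C x0 \<times> local_sections M C x0"
    by (auto simp: germ_rel_def)
  show "refl_on (local_sections M C x0) (germ_rel M C x0)"
    by (rule refl_onI) (force simp: germ_rel_iff local_sections_iff)
  show "sym (germ_rel M C x0)"
  proof (rule symI)
    fix s t assume "(s, t) \<in> germ_rel M C x0"
    moreover obtain U f V g where "s = (U, f)" "t = (V, g)" by (metis surj_pair)
    ultimately show "(t, s) \<in> germ_rel M C x0"
      by (simp add: germ_rel_iff) (metis Int_commute)
  qed
  show "trans (germ_rel M C x0)"
  proof (rule transI)
    fix s t u assume st: "(s, t) \<in> germ_rel M C x0" and tu: "(t, u) \<in> germ_rel M C x0"
    obtain U f V g Z h where s: "s = (U, f)" "t = (V, g)" "u = (Z, h)" by (metis surj_pair)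
    from st obtain W where Uf: "(U, f) \<in> local_sections M C x0"
      and W: "open W" "x0 \<in> W" "W \<subseteq> U \<inter> V" "\<forall>n. \<forall>x\<in>W. f n x = g n x"
      unfolding s germ_rel_iff by (elim conjE exE) (rule that)
    from tu obtain W' where Zh: "(Z, h) \<in> local_sections M C x0"
      and W': "open W'" "x0 \<in> W'" "W' \<subseteq> V \<inter> Z" "\<forall>n. \<forall>x\<in>W'. g n x = h n x"
      unfolding s germ_rel_iff by (elim conjE exE) (rule that)
    show "(s, u) \<in> germ_rel M C x0"
      unfolding s germ_rel_iff
    proof (intro conjI exI[of _ "W \<inter> W'"] allI ballI)
      show "f n x = h n x" if "x \<in> W \<inter> W'" for n x
        using that W(4) W'(4) by simp
    qed (use W W' in \<open>auto intro: Uf Zh\<close>)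
  qed
qed

section \<open>The germ map and the algebra structure of the stalk\<close>

lemma R_local_section: "F \<in> carrier R \<Longrightarrow> (UNIV, F) \<in> local_sections M C x0"
  by (simp add: local_sections_iff)

lemma germ_eq_eta:
  assumes "(U, f) \<in> local_sections M C x0" "F \<in> carrier R"
    and "open W" "x0 \<in> W" "W \<subseteq> U" "\<And>n x. x \<in> W \<Longrightarrow> f n x = F n x"
  shows "germ M C x0 U f = \<eta> F"
  unfolding germ_def
proof (rule equiv_class_eq[OF equiv_germ_rel])
  show "((U, f), (UNIV, F)) \<in> germ_rel M C x0"
    unfolding germ_rel_iff using assms R_local_section by (intro conjI exI[of _ W]) auto
qed

lemma eta_eq_iff:
  assumes "F \<in> carrier R" "G \<in> carrier R"
  shows "\<eta> F = \<eta> G \<longleftrightarrow> (\<exists>W. open W \<and> x0 \<in> W \<and> (\<forall>n. \<forall>x\<in>W. F n x = G n x))"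
  unfolding germ_def
  using eq_equiv_class_iff[OF equiv_germ_rel R_local_section[OF assms(1)] R_local_section[OF assms(2)]]
    R_local_section[OF assms(1)] R_local_section[OF assms(2)]
  by (simp add: germ_rel_iff)

lemma eta_memberE:
  assumes "(U, f) \<in> \<eta> F"
  obtains W where "(U, f) \<in> local_sections M C x0" "open W" "x0 \<in> W" "W \<subseteq> U"
    "\<And>n x. x \<in> W \<Longrightarrow> F n x = f n x"
proof -
  have "((UNIV, F), (U, f)) \<in> germ_rel M C x0"
    using assms by (simp add: germ_def)
  then obtain W where "(U, f) \<in> local_sections M C x0" "open W" "x0 \<in> W" "W \<subseteq> UNIV \<inter> U"
      "\<forall>n. \<forall>x\<in>W. F n x = f n x"
    unfolding germ_rel_iff by (elim conjE exE) (rule that)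
  then show ?thesis by (intro that[of W]) auto
qed

lemma eta_self_member: "F \<in> carrier R \<Longrightarrow> (UNIV, F) \<in> \<eta> F"
  unfolding germ_def by (rule equiv_class_self[OF equiv_germ_rel R_local_section])

lemma stalk_carrier: "carrier R_x0 = \<eta> ` carrier R"
proof
  show "\<eta> ` carrier R \<subseteq> carrier R_x0"
    using R_local_section by (auto simp: stalk_def germ_def intro!: quotientI simp del: series_algebra_simps)
  show "carrier R_x0 \<subseteq> \<eta> ` carrier R"
  proof
    fix \<phi> assume "\<phi> \<in> carrier R_x0"
    then obtain U f where Uf: "(U, f) \<in> local_sections M C x0" and \<phi>: "\<phi> = germ M C x0 U f"
      by (auto simp: stalk_def germ_def elim!: quotientE)
    then have U: "open U" "x0 \<in> U" and f: "\<And>n. f n \<in> smooth_functions M U"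
      by (simp_all add: local_sections_iff)
    obtain F V where F: "\<And>n. F n \<in> smooth_functions M UNIV" and V: "open V" "x0 \<in> V" "V \<subseteq> U"
      and eq: "\<And>n x. x \<in> V \<Longrightarrow> F n x = f n x"
      by (rule smooth_extension[OF U f]) (rule that)
    have "F \<in> carrier R" using F by simp
    moreover have "\<phi> = \<eta> F"
      unfolding \<phi> using eq by (intro germ_eq_eta[OF Uf \<open>F \<in> carrier R\<close> V]) simp
    ultimately show "\<phi> \<in> \<eta> ` carrier R" by blast
  qed
qed

text \<open>Arbitrary representatives agree with \<open>F\<close> and \<open>G\<close> on two
  different neighbourhoods, and on their intersection the local sum agrees with the global one. As
  \<open>F\<close> and \<open>G\<close> are global, this single comparison settles both independence
  of representatives and additivity.\<close>

lemma eta_add: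
  assumes F: "F \<in> carrier R" and G: "G \<in> carrier R"
  shows "\<eta> (F \<oplus>\<^bsub>R\<^esub> G) = \<eta> F \<oplus>\<^bsub>R_x0\<^esub> \<eta> G"
proof -
  have "germ M C x0 (U \<inter> V)
      (restrict_series f (U \<inter> V) \<oplus>\<^bsub>local_algebra M C (U \<inter> V)\<^esub> restrict_series g (U \<inter> V)) = \<eta> (F \<oplus>\<^bsub>R\<^esub> G)"
    if f: "(U, f) \<in> \<eta> F" and g: "(V, g) \<in> \<eta> G" for U f V g
  proof -
    obtain W where f: "(U, f) \<in> local_sections M C x0" and W: "open W" "x0 \<in> W" "W \<subseteq> U"
      and F_eq: "\<And>n x. x \<in> W \<Longrightarrow> F n x = f n x" by (rule eta_memberE[OF f]) (rule that)
    obtain W' where g: "(V, g) \<in> local_sections M C x0" and W': "open W'" "x0 \<in> W'" "W' \<subseteq> V"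
      and G_eq: "\<And>n x. x \<in> W' \<Longrightarrow> G n x = g n x" by (rule eta_memberE[OF g]) (rule that)
    show ?thesis
    proof (rule germ_eq_eta[of _ _ _ "W \<inter> W'"])
      have "restrict_series f (U \<inter> V) n \<in> smooth_functions M (U \<inter> V)"
        "restrict_series g (U \<inter> V) n \<in> smooth_functions M (U \<inter> V)" for n
        using f g by (auto simp: restrict_series_def local_sections_iff intro: smooth_functions_restrict)
      then show "(U \<inter> V, restrict_series f (U \<inter> V) \<oplus>\<^bsub>local_algebra M C (U \<inter> V)\<^esub> restrict_series g (U \<inter> V))
          \<in> local_sections M C x0"
        using f g by (auto simp: local_sections_iff intro!: smooth_functions_add)
      show "F \<oplus>\<^bsub>R\<^esub> G \<in> carrier R"
        using F G smooth_functions_add[where U = UNIV, of "F n" "G n" for n] by simp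
    qed (use W W' F_eq G_eq in \<open>auto simp: restrict_series_def\<close>)
  qed
  then have "(\<Union>(U, f)\<in>\<eta> F. \<Union>(V, g)\<in>\<eta> G. germ M C x0 (U \<inter> V)
      (restrict_series f (U \<inter> V) \<oplus>\<^bsub>local_algebra M C (U \<inter> V)\<^esub> restrict_series g (U \<inter> V))) = \<eta> (F \<oplus>\<^bsub>R\<^esub> G)"
    by (intro UN_pairs_eqI[OF eta_self_member[OF F]] UN_pairs_eqI[OF eta_self_member[OF G]])
  then show ?thesis by (simp add: stalk_def del: series_algebra_simps local_algebra_simps)
qed

lemma eta_mult:
  assumes F: "F \<in> carrier R" and G: "G \<in> carrier R"
  shows "\<eta> (F \<otimes>\<^bsub>R\<^esub> G) = \<eta> F \<otimes>\<^bsub>R_x0\<^esub> \<eta> G"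
proof -
  have "germ M C x0 (U \<inter> V)
      (restrict_series f (U \<inter> V) \<otimes>\<^bsub>local_algebra M C (U \<inter> V)\<^esub> restrict_series g (U \<inter> V)) = \<eta> (F \<otimes>\<^bsub>R\<^esub> G)"
    if f: "(U, f) \<in> \<eta> F" and g: "(V, g) \<in> \<eta> G" for U f V g
  proof -
    obtain W where f: "(U, f) \<in> local_sections M C x0" and W: "open W" "x0 \<in> W" "W \<subseteq> U"
      and F_eq: "\<And>n x. x \<in> W \<Longrightarrow> F n x = f n x" by (rule eta_memberE[OF f]) (rule that)
    obtain W' where g: "(V, g) \<in> local_sections M C x0" and W': "open W'" "x0 \<in> W'" "W' \<subseteq> V"
      and G_eq: "\<And>n x. x \<in> W' \<Longrightarrow> G n x = g n x" by (rule eta_memberE[OF g]) (rule that)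
    have UV: "open (U \<inter> V)" "x0 \<in> U \<inter> V"
      using f g by (auto simp: local_sections_iff)
    have fg: "restrict_series f (U \<inter> V) \<in> carrier (local_algebra M C (U \<inter> V))"
      "restrict_series g (U \<inter> V) \<in> carrier (local_algebra M C (U \<inter> V))"
      using f g by (auto simp: restrict_series_def local_sections_iff intro: smooth_functions_restrict)
    show ?thesis
    proof (rule germ_eq_eta[of _ _ _ "W \<inter> W'"])
      show "(U \<inter> V, restrict_series f (U \<inter> V) \<otimes>\<^bsub>local_algebra M C (U \<inter> V)\<^esub> restrict_series g (U \<inter> V))
          \<in> local_sections M C x0"
        using UV local_star_closed[OF UV(1) fg] by (simp add: local_sections_iff)
      show "F \<otimes>\<^bsub>R\<^esub> G \<in> carrier R"
        using star_closed[OF F G] by simp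
      \<comment> \<open>Here the localization enters: the product formed over
        \<open>U \<inter> V\<close> is evaluated at \<open>x\<close> through the global series
        \<open>F\<close> and \<open>G\<close>.\<close>
      show "(restrict_series f (U \<inter> V) \<otimes>\<^bsub>local_algebra M C (U \<inter> V)\<^esub> restrict_series g (U \<inter> V)) n x =
          (F \<otimes>\<^bsub>R\<^esub> G) n x" if x: "x \<in> W \<inter> W'" for n x
        unfolding local_algebra_simps series_algebra_simps
        by (rule local_star_eq[OF UV(1) fg F G open_Int[OF W(1) W'(1)] x])
          (use W W' F_eq G_eq in \<open>auto simp: restrict_series_def\<close>)
    qed (use W W' in auto)
  qed
  then have "(\<Union>(U, f)\<in>\<eta> F. \<Union>(V, g)\<in>\<eta> G. germ M C x0 (U \<inter> V)
      (restrict_series f (U \<inter> V) \<otimes>\<^bsub>local_algebra M C (U \<inter> V)\<^esub> restrict_series g (U \<inter> V))) = \<eta> (F \<otimes>\<^bsub>R\<^esub> G)"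
    by (intro UN_pairs_eqI[OF eta_self_member[OF F]] UN_pairs_eqI[OF eta_self_member[OF G]])
  then show ?thesis by (simp add: stalk_def del: series_algebra_simps local_algebra_simps)
qed

lemma eta_smult:
  fixes a :: "'k fps"
  assumes F: "F \<in> carrier R"
  shows "\<eta> (a \<odot>\<^bsub>R\<^esub> F) = a \<odot>\<^bsub>R_x0\<^esub> \<eta> F"
proof -
  have "germ M C x0 U (a \<odot>\<^bsub>local_algebra M C U\<^esub> f) = \<eta> (a \<odot>\<^bsub>R\<^esub> F)"
    if f: "(U, f) \<in> \<eta> F" for U f
  proof -
    obtain W where f: "(U, f) \<in> local_sections M C x0" and W: "open W" "x0 \<in> W" "W \<subseteq> U"
      and F_eq: "\<And>n x. x \<in> W \<Longrightarrow> F n x = f n x" by (rule eta_memberE[OF f]) (rule that)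
    show ?thesis
    proof (rule germ_eq_eta[of _ _ _ W])
      show "(U, a \<odot>\<^bsub>local_algebra M C U\<^esub> f) \<in> local_sections M C x0"
        using f by (auto simp: local_sections_iff intro!: smooth_functions_smult)
      show "a \<odot>\<^bsub>R\<^esub> F \<in> carrier R"
        using F smooth_functions_smult[where U = UNIV and f = F] by simp
    qed (use W F_eq in auto)
  qed
  then have "(\<Union>(U, f)\<in>\<eta> F. germ M C x0 U (a \<odot>\<^bsub>local_algebra M C U\<^esub> f)) = \<eta> (a \<odot>\<^bsub>R\<^esub> F)"
    by (intro UN_pairs_eqI[OF eta_self_member[OF F]])
  then show ?thesis by (simp add: stalk_def del: series_algebra_simps local_algebra_simps)
qed

lemma eta_morphism: "algebra_morphism (ring_of_type_algebra :: 'k fps ring) R R_x0 \<eta>"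
  using eta_add eta_mult eta_smult stalk_carrier
  by (intro unital_algebra_surjective_image[OF unital_algebra_R]) (simp_all add: stalk_def)

section \<open>Units and kernel of the germ map\<close>

lemma eta_one: "\<eta> \<one>\<^bsub>R\<^esub> = \<one>\<^bsub>R_x0\<^esub>" and eta_zero: "\<eta> \<zero>\<^bsub>R\<^esub> = \<zero>\<^bsub>R_x0\<^esub>"
  by (simp_all add: stalk_def)

text \<open>\<open>t\<close> and \<open>t'\<close> come from separate recursions, with
  neighbourhoods of their own, and may differ as series. Their germs are a right and a left inverse
  of \<open>\<eta> s\<close>, hence equal in the monoid of the stalk.\<close>

lemma eta_Units:
  assumes s: "s \<in> nonvanishing_at M C x0"
  shows "\<eta> s \<in> Units R_x0"
proof -
  interpret R: unital_algebra "ring_of_type_algebra :: 'k fps ring" R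
    by (rule unital_algebra_R)
  interpret B: unital_algebra "ring_of_type_algebra :: 'k fps ring" R_x0
    using eta_morphism by (simp add: algebra_morphism_def)
  have sR: "s \<in> carrier R" and nz: "s 0 x0 \<noteq> 0"
    using s by (simp_all add: nonvanishing_at_def)
  then have s_smooth: "s n \<in> smooth_functions M UNIV" for n by simp
  note closed = bidifferential_operator_closed[OF bidiff]
  obtain t V where t: "\<And>n. t n \<in> smooth_functions M UNIV" and V: "open V" "x0 \<in> V"
    "\<And>n x. x \<in> V \<Longrightarrow> star UNIV C s t n x = (if n = 0 then 1 else 0)"
  proof (rule right_inverse_near[where D = C and s = s and ?x0.0 = x0])
    show "C l f g \<in> smooth_functions M UNIV"
      if "f \<in> smooth_functions M UNIV" "g \<in> smooth_functions M UNIV" for l f g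
      using that by (rule closed)
    show "C 0 f g = (\<lambda>x. f x * g x)"
      if "f \<in> smooth_functions M UNIV" "g \<in> smooth_functions M UNIV" for f g
      using that by (rule C_0)
  qed (rule s_smooth nz that; assumption)+
  obtain t' V' where t': "\<And>n. t' n \<in> smooth_functions M UNIV" and V': "open V'" "x0 \<in> V'"
    "\<And>n x. x \<in> V' \<Longrightarrow> star UNIV (\<lambda>l f g. C l g f) s t' n x = (if n = 0 then 1 else 0)"
  proof (rule right_inverse_near[where D = "\<lambda>l f g. C l g f" and s = s and ?x0.0 = x0])
    show "C l g f \<in> smooth_functions M UNIV"
      if "f \<in> smooth_functions M UNIV" "g \<in> smooth_functions M UNIV" for l f g
      using that by (rule closed[rotated])
    show "C 0 g f = (\<lambda>x. f x * g x)"
      if "f \<in> smooth_functions M UNIV" "g \<in> smooth_functions M UNIV" for f g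
      using C_0[OF that(2,1)] by (simp add: mult.commute)
  qed (rule s_smooth nz that; assumption)+
  have left_eq: "star UNIV C t' s n x = (if n = 0 then 1 else 0)" if "x \<in> V'" for n x
    using V'(3)[OF that, of n] by (simp only: star_flip[where D = C])
  have tR: "t \<in> carrier R" and t'R: "t' \<in> carrier R" using t t' by simp_all
  have "\<eta> (s \<otimes>\<^bsub>R\<^esub> t) = \<eta> \<one>\<^bsub>R\<^esub>"
    unfolding eta_eq_iff[OF R.m_closed[OF sR tR] R.one_closed] using V by auto
  then have right: "\<eta> s \<otimes>\<^bsub>R_x0\<^esub> \<eta> t = \<one>\<^bsub>R_x0\<^esub>"
    by (simp only: eta_mult[OF sR tR] eta_one)
  have "\<eta> (t' \<otimes>\<^bsub>R\<^esub> s) = \<eta> \<one>\<^bsub>R\<^esub>"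
    unfolding eta_eq_iff[OF R.m_closed[OF t'R sR] R.one_closed] using V'(1,2) left_eq by auto
  then have left: "\<eta> t' \<otimes>\<^bsub>R_x0\<^esub> \<eta> s = \<one>\<^bsub>R_x0\<^esub>"
    by (simp only: eta_mult[OF t'R sR] eta_one)
  have carrier: "\<eta> s \<in> carrier R_x0" "\<eta> t \<in> carrier R_x0" "\<eta> t' \<in> carrier R_x0"
    unfolding stalk_carrier by (rule imageI, fact)+
  have "\<eta> t' = \<eta> t"
    by (rule B.inv_unique[OF left right carrier(1) carrier(3) carrier(2)])
  with left have "\<eta> t \<otimes>\<^bsub>R_x0\<^esub> \<eta> s = \<one>\<^bsub>R_x0\<^esub>"
    by (simp only:)
  then show ?thesis
    unfolding Units_def using right carrier(1,2) by (intro CollectI conjI bexI[of _ "\<eta> t"])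
qed

lemma eta_kernel:
  assumes r: "r \<in> carrier R"
  shows "\<eta> r = \<zero>\<^bsub>R_x0\<^esub> \<longleftrightarrow> (\<exists>s\<in>nonvanishing_at M C x0. r \<otimes>\<^bsub>R\<^esub> s = \<zero>\<^bsub>R\<^esub>)"
proof -
  interpret R: unital_algebra "ring_of_type_algebra :: 'k fps ring" R
    by (rule unital_algebra_R)
  interpret B: unital_algebra "ring_of_type_algebra :: 'k fps ring" R_x0
    using eta_morphism by (simp add: algebra_morphism_def)
  show ?thesis
  proof
    assume "\<eta> r = \<zero>\<^bsub>R_x0\<^esub>"
    then have "\<eta> r = \<eta> \<zero>\<^bsub>R\<^esub>" by (simp only: eta_zero)
    then obtain W where W: "open W" "x0 \<in> W" and r0: "\<And>n x. x \<in> W \<Longrightarrow> r n x = \<zero>\<^bsub>R\<^esub> n x"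
      unfolding eta_eq_iff[OF r R.zero_closed] by blast
    obtain h :: "'x \<Rightarrow> 'k" and A V where h: "h \<in> smooth_functions M UNIV" and A: "open A" "A \<union> W = UNIV"
      and h0: "\<And>x. x \<in> A \<Longrightarrow> h x = 0" and "open V" and V: "x0 \<in> V" "V \<subseteq> W" "\<And>x. x \<in> V \<Longrightarrow> h x = 1"
      by (rule bump_function[OF W]) (rule that)
    \<comment> \<open>The series is concentrated in order 0; its leading term is 1 at
      \<open>x0\<close>, which puts it into the denominator set.\<close>
    define s where "s n = (if n = 0 then h else (\<lambda>x. 0))" for n :: nat
    have sR: "s \<in> carrier R"
      using h R.zero_closed by (simp add: s_def)
    have "star UNIV C r s n x = \<zero>\<^bsub>R\<^esub> n x" for n x
    \<comment> \<open>\<open>A\<close> and \<open>W\<close> are open and cover the manifold. Near a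
      point of \<open>A\<close> the factor \<open>s\<close> may be replaced by 0, near a point of
      \<open>W\<close> the factor \<open>r\<close>, so the product vanishes everywhere and in every
      order.\<close>
    proof (cases "x \<in> A")
      case True
      have "star UNIV C r s n x = star UNIV C r \<zero>\<^bsub>R\<^esub> n x"
        by (rule star_local[OF r r sR R.zero_closed A(1) True]) (simp_all add: s_def h0)
      then show ?thesis using R.r_null[OF r] by simp
    next
      case False
      then have "x \<in> W" using A(2) by blast
      have "star UNIV C r s n x = star UNIV C \<zero>\<^bsub>R\<^esub> s n x"
        by (rule star_local[OF r R.zero_closed sR sR W(1) \<open>x \<in> W\<close> r0 refl])
      then show ?thesis using R.l_null[OF sR] by simp
    qed
    then have "r \<otimes>\<^bsub>R\<^esub> s = \<zero>\<^bsub>R\<^esub>"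
      unfolding series_algebra_simps(2) by (intro ext)
    moreover have "s \<in> nonvanishing_at M C x0"
      using sR V(1,3) by (simp add: nonvanishing_at_def s_def)
    ultimately show "\<exists>s\<in>nonvanishing_at M C x0. r \<otimes>\<^bsub>R\<^esub> s = \<zero>\<^bsub>R\<^esub>" by blast
  next
    assume "\<exists>s\<in>nonvanishing_at M C x0. r \<otimes>\<^bsub>R\<^esub> s = \<zero>\<^bsub>R\<^esub>"
    then obtain s where s: "s \<in> nonvanishing_at M C x0" and rs: "r \<otimes>\<^bsub>R\<^esub> s = \<zero>\<^bsub>R\<^esub>" by blast
    have sR: "s \<in> carrier R" using s by (simp add: nonvanishing_at_def)
    have carrier: "\<eta> r \<in> carrier R_x0" "\<eta> s \<in> carrier R_x0"
      unfolding stalk_carrier by (rule imageI, fact)+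
    have "\<eta> r \<otimes>\<^bsub>R_x0\<^esub> \<eta> s = \<zero>\<^bsub>R_x0\<^esub>"
      unfolding eta_mult[OF r sR, symmetric] rs eta_zero ..
    then have "\<eta> r \<otimes>\<^bsub>R_x0\<^esub> \<eta> s \<otimes>\<^bsub>R_x0\<^esub> inv\<^bsub>R_x0\<^esub> (\<eta> s) = \<zero>\<^bsub>R_x0\<^esub>"
      using eta_Units[OF s] by simp
    then show "\<eta> r = \<zero>\<^bsub>R_x0\<^esub>"
      using eta_Units[OF s] carrier by (simp add: B.m_assoc)
  qed
qed

text \<open>In order 0 only the triple \<open>(0, 0, 0)\<close> occurs, so the leading term of a
  product is the pointwise product of the leading terms, and a field has no zero divisors.\<close>

lemma nonvanishing_multiplicative: "multiplicative_subset R (nonvanishing_at M C x0)"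
proof -
  interpret R: unital_algebra "ring_of_type_algebra :: 'k fps ring" R
    by (rule unital_algebra_R)
  have "\<one>\<^bsub>R\<^esub> \<in> nonvanishing_at M C x0"
    unfolding nonvanishing_at_def using R.one_closed by auto
  moreover have "s \<otimes>\<^bsub>R\<^esub> t \<in> nonvanishing_at M C x0"
    if "s \<in> nonvanishing_at M C x0" "t \<in> nonvanishing_at M C x0" for s t
  proof -
    have s: "s \<in> carrier R" "s 0 x0 \<noteq> 0" and t: "t \<in> carrier R" "t 0 x0 \<noteq> 0"
      using that by (simp_all add: nonvanishing_at_def)
    have "(s \<otimes>\<^bsub>R\<^esub> t) 0 x0 = s 0 x0 * t 0 x0"
      using s(1) t(1) by (simp add: star_apply triples_0 C_0)
    then show ?thesis
      unfolding nonvanishing_at_def using s t R.m_closed[OF s(1) t(1)] by simp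
  qed
  ultimately show ?thesis
    by (auto simp: multiplicative_subset_def nonvanishing_at_def simp del: series_algebra_simps)
qed

theorem stalk_right_fraction_algebra:
  "right_fraction_algebra (ring_of_type_algebra :: 'k fps ring) R (nonvanishing_at M C x0) R_x0 \<eta>"
  unfolding right_fraction_algebra_def
proof (intro conjI ballI nonvanishing_multiplicative eta_morphism)
  interpret B: unital_algebra "ring_of_type_algebra :: 'k fps ring" R_x0
    using eta_morphism by (simp add: algebra_morphism_def)
  show "\<eta> s \<in> Units R_x0" if "s \<in> nonvanishing_at M C x0" for s
    using that by (rule eta_Units)
  show "\<exists>r\<in>carrier R. \<exists>s\<in>nonvanishing_at M C x0. b = \<eta> r \<otimes>\<^bsub>R_x0\<^esub> inv\<^bsub>R_x0\<^esub> (\<eta> s)"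
    if b: "b \<in> carrier R_x0" for b
  proof -
    obtain r where r: "r \<in> carrier R" "b = \<eta> r"
      using b unfolding stalk_carrier by blast
    \<comment> \<open>Since \<open>\<eta>\<close> is surjective, the denominator 1 suffices for
      every germ.\<close>
    have "b = \<eta> r \<otimes>\<^bsub>R_x0\<^esub> inv\<^bsub>R_x0\<^esub> (\<eta> \<one>\<^bsub>R\<^esub>)"
      unfolding eta_one using r(2) b by (simp del: series_algebra_simps)
    moreover have "\<one>\<^bsub>R\<^esub> \<in> nonvanishing_at M C x0"
      using nonvanishing_multiplicative unfolding multiplicative_subset_def by blast
    ultimately show ?thesis using r(1) by blast
  qed
  show "{r \<in> carrier R. \<eta> r = \<zero>\<^bsub>R_x0\<^esub>} =
      {r \<in> carrier R. \<exists>s\<in>nonvanishing_at M C x0. r \<otimes>\<^bsub>R\<^esub> s = \<zero>\<^bsub>R\<^esub>}"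
    using eta_kernel by (intro Collect_cong conj_cong refl)
qed

end

end

theorem theorem3p1:
  fixes M :: "('x::{t2_space,second_countable_topology}, 'e::real_inner) manifold"
    and \<pi> :: "('x, 'e) chart \<Rightarrow> nat \<Rightarrow> nat \<Rightarrow> 'x \<Rightarrow> real"
    and C :: "nat \<Rightarrow> ('x \<Rightarrow> 'k) \<Rightarrow> ('x \<Rightarrow> 'k) \<Rightarrow> 'x \<Rightarrow> 'k::real_or_complex"
    and x0 :: 'x
  defines "K \<equiv> (ring_of_type_algebra :: 'k fps ring)"
    and "R \<equiv> series_algebra M UNIV C"
    and "R_x0 \<equiv> stalk M C x0"
    and "\<eta> \<equiv> germ M C x0 UNIV"
    and "S \<equiv> nonvanishing_at M C x0"
  assumes "poisson_manifold M \<pi>"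
    and "star_product_on_poisson M \<pi> C"
  shows "right_fraction_algebra K R S R_x0 \<eta> \<and>
    right_denominator_set R S \<and>
    isomorphic_algebras K (ore_localization R S) R_x0"
proof -
  interpret star_setting M C
    using assms(6,7) by unfold_locales (simp_all add: poisson_manifold_def star_product_on_poisson_def)
  have "right_fraction_algebra K R S R_x0 \<eta>"
    unfolding K_def R_def R_x0_def \<eta>_def S_def by (rule stalk_right_fraction_algebra)
  then show ?thesis
    using right_fraction_algebra_denominator_set right_fraction_algebra_isomorphic_ore_localization
    by blast
qed

end
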